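(* Let $X$ be a complex manifold, $k\geq0$ an integer, and $L$ a holomorphic line bundle on $X$. For any $s_0,\dots,s_k\in H^0(X,L)$, the locally defined jet differential equations $W_U(s_0,\dots,s_k)\in E_{k,k'}T_X^*(U)$ (where $U\subset X$ ranges over the open subsets on which $L$ is trivialized) glue together into a section $$W(s_0,\dots,s_k)\in H^0\big(X,E_{k,k'}T_X^*\otimes L^{k+1}\big).$$
   Context: $k':=k(k+1)/2$. $p_k:J_kX\to X$ is the bundle of $k$-jets $[\gamma]_k$ of germs of holomorphic curves $\gamma:(\mathbb{C},0)\to X$, with $p_k([\gamma]_k)=\gamma(0)$. $\mathbb{G}_k$ is the group of $k$-jets of biholomorphism germs of $(\mathbb{C},0)$: $\varphi(t)=a_1t+\cdots+a_kt^k$, $a_1\neq0$, modulo $t^{k+1}$. $E_{k,m}T_X^*$ is the sheaf on $X$ with $E_{k,m}T_X^*(U)=\{Q\in\mathcal{O}(p_k^{-1}(U)): Q([\gamma\circ\varphi]_k)=\varphi'(0)^mQ([\gamma]_k)\ \forall[\gamma]_k\in p_k^{-1}(U),\forall\varphi\in\mathbb{G}_k\}$ (for $k=0$, $J_0X=X$ and no invariance condition is imposed, with $m=0$). For open $U\subset X$, $f\in\mathcal{O}(U)$ and $0\le p\le k$, define $d_U^{[p]}f\in\mathcal{O}(p_k^{-1}(U))$ by $d_U^{[p]}f([\gamma]_k)=(f\circ\gamma)^{(p)}(0)$. For $f_0,\dots,f_k\in\mathcal{O}(U)$, $W_U(f_0,\dots,f_k)=\det\big(d_U^{[p]}f_j\big)_{0\le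 p,j\le k}$, which lies in $E_{k,k'}T_X^*(U)$. If $U$ is an open set with a chosen trivialization of $L|_U$, a section $s\in H^0(X,L)$ corresponds to a function $s_U\in\mathcal{O}(U)$, and $W_U(s_0,\dots,s_k):=W_U(s_{0,U},\dots,s_{k,U})$. *)

theory Defs
  imports
    "HOL-Complex_Analysis.Complex_Analysis"
    "HOL-Algebra.Free_Abelian_Groups"
    "Jordan_Normal_Form.Determinant"
begin

section \<open>Complex manifolds\<close>

text \<open>The dimension is a number and not a type: this admits dimension 0, and a manifold and its
  jet spaces of every order are treated by the same definitions. The points of \<open>cspace n\<close>
  are the functions in \<open>{..<n} \<rightarrow>\<^sub>E UNIV\<close>.\<close>

definition cspace :: "nat \<Rightarrow> (nat \<Rightarrow> complex) topology" where
  "cspace n = product_topology (\<lambda>_. euclidean) {..<n}"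

definition holomorphic_several :: "nat \<Rightarrow> (nat \<Rightarrow> complex) set \<Rightarrow> ((nat \<Rightarrow> complex) \<Rightarrow> complex) \<Rightarrow> bool" where
  "holomorphic_several n \<Omega> f \<longleftrightarrow>
     continuous_map (subtopology (cspace n) \<Omega>) euclidean f \<and>
     (\<forall>z\<in>\<Omega>. \<forall>i<n. (\<lambda>w. f (z(i := w))) holomorphic_on {w. z(i := w) \<in> \<Omega>})"

type_synonym 'a chart = "'a set \<times> ('a \<Rightarrow> nat \<Rightarrow> complex)"

text \<open>\<open>hol_functions n A S\<close> is the space of holomorphic functions on the open set \<open>S\<close> of
  the space with charts \<open>A\<close> into \<open>cspace n\<close>. Here and below, a function on a set \<open>S\<close>
  is \<open>undefined\<close> outside \<open>S\<close>, so that it is determined by its values on \<open>S\<close>.\<close>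

definition hol_functions :: "nat \<Rightarrow> 'a chart set \<Rightarrow> 'a set \<Rightarrow> ('a \<Rightarrow> complex) set" where
  "hol_functions n A S =
     {f \<in> extensional S. \<forall>(V, \<phi>)\<in>A. holomorphic_several n (\<phi> ` (S \<inter> V)) (f \<circ> inv_into V \<phi>)}"

record 'a manifold =
  mdim :: nat
  mtop :: "'a topology"
  atlas :: "'a chart set"

definition complex_manifold :: "'a manifold \<Rightarrow> bool" where
  "complex_manifold M \<longleftrightarrow>
     Hausdorff_space (mtop M) \<and> second_countable (mtop M) \<and>
     (\<Union>(V, \<phi>)\<in>atlas M. V) = topspace (mtop M) \<and>
     (\<forall>(V, \<phi>)\<in>atlas M. openin (mtop M) V \<and> openin (cspace (mdim M)) (\<phi> ` V) \<and>
        homeomorphic_map (subtopology (mtop M) V) (subtopology (cspace (mdim M)) (\<phi> ` V)) \<phi>) \<and>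
     (\<forall>(V, \<phi>)\<in>atlas M. \<forall>(V', \<psi>)\<in>atlas M. \<forall>i<mdim M.
        holomorphic_several (mdim M) (\<phi> ` (V \<inter> V')) (\<lambda>z. \<psi> (inv_into V \<phi> z) i))"

definition hol_fun :: "'a manifold \<Rightarrow> 'a set \<Rightarrow> ('a \<Rightarrow> complex) set" where
  "hol_fun M U = hol_functions (mdim M) (atlas M) U"


section \<open>Jets of holomorphic curves\<close>

text \<open>A germ at 0 is given by any function on the plane that represents it; its values away
  from 0 are irrelevant.\<close>

definition curve_germs :: "'a manifold \<Rightarrow> (complex \<Rightarrow> 'a) set" where
  "curve_germs M = {\<gamma>. \<exists>D. open D \<and> 0 \<in> D \<and> continuous_map (top_of_set D) (mtop M) \<gamma> \<and>
     (\<forall>(V, \<phi>)\<in>atlas M. \<forall>i<mdim M. (\<lambda>t. \<phi> (\<gamma> t) i) holomorphic_on {t\<in>D. \<gamma> t \<in> V})}"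

definition same_jet :: "'a manifold \<Rightarrow> nat \<Rightarrow> (complex \<Rightarrow> 'a) \<Rightarrow> (complex \<Rightarrow> 'a) \<Rightarrow> bool" where
  "same_jet M k \<gamma> \<delta> \<longleftrightarrow> \<gamma> 0 = \<delta> 0 \<and>
     (\<forall>(V, \<phi>)\<in>atlas M. \<gamma> 0 \<in> V \<longrightarrow> (\<forall>i<mdim M. \<forall>p\<le>k.
        (deriv ^^ p) (\<lambda>t. \<phi> (\<gamma> t) i) 0 = (deriv ^^ p) (\<lambda>t. \<phi> (\<delta> t) i) 0))"

type_synonym 'a jet = "(complex \<Rightarrow> 'a) set"

definition jet :: "'a manifold \<Rightarrow> nat \<Rightarrow> (complex \<Rightarrow> 'a) \<Rightarrow> 'a jet" where
  "jet M k \<gamma> = {\<delta> \<in> curve_germs M. same_jet M k \<gamma> \<delta>}"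

definition jet_space :: "'a manifold \<Rightarrow> nat \<Rightarrow> 'a jet set" where
  "jet_space M k = jet M k ` curve_germs M"

definition jet_rep :: "'a jet \<Rightarrow> complex \<Rightarrow> 'a" where
  "jet_rep j = (SOME \<gamma>. \<gamma> \<in> j)"

definition jet_proj :: "'a jet \<Rightarrow> 'a" where
  "jet_proj j = jet_rep j 0"

definition jets_over :: "'a manifold \<Rightarrow> nat \<Rightarrow> 'a set \<Rightarrow> 'a jet set" where
  "jets_over M k U = {j \<in> jet_space M k. jet_proj j \<in> U}"

text \<open>The chart of the jet space induced by a chart \<open>(V, \<phi>)\<close>: coordinate \<open>p * n + i\<close> is the
  derivative of order \<open>p\<close> at 0 of the \<open>i\<close>-th component of the curve read in \<open>\<phi>\<close>.\<close>

definition jet_coords :: "'a manifold \<Rightarrow> nat \<Rightarrow> ('a \<Rightarrow> nat \<Rightarrow> complex) \<Rightarrow> 'a jet \<Rightarrow> nat \<Rightarrow> complex" where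
  "jet_coords M k \<phi> j = (\<lambda>q\<in>{..<mdim M * (k + 1)}.
     (deriv ^^ (q div mdim M)) (\<lambda>t. \<phi> (jet_rep j t) (q mod mdim M)) 0)"

definition jet_atlas :: "'a manifold \<Rightarrow> nat \<Rightarrow> 'a jet chart set" where
  "jet_atlas M k = (\<lambda>(V, \<phi>). (jets_over M k V, jet_coords M k \<phi>)) ` atlas M"

definition jet_fun :: "'a manifold \<Rightarrow> nat \<Rightarrow> 'a set \<Rightarrow> ('a jet \<Rightarrow> complex) set" where
  "jet_fun M k U = hol_functions (mdim M * (k + 1)) (jet_atlas M k) (jets_over M k U)"

text \<open>The elements of the reparametrisation group of order \<open>k\<close>, each given by its polynomial
  representative of degree at most \<open>k\<close>.\<close>

definition reparam :: "nat \<Rightarrow> (complex \<Rightarrow> complex) set" where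
  "reparam k = {\<lambda>t. \<Sum>i=1..k. a i * t ^ i |a. a 1 \<noteq> 0}"

definition inv_jet_diff :: "'a manifold \<Rightarrow> nat \<Rightarrow> nat \<Rightarrow> 'a set \<Rightarrow> ('a jet \<Rightarrow> complex) set" where
  "inv_jet_diff M k m U = {Q \<in> jet_fun M k U. k > 0 \<longrightarrow>
     (\<forall>\<gamma>\<in>curve_germs M. \<gamma> 0 \<in> U \<longrightarrow> (\<forall>\<phi>\<in>reparam k.
        Q (jet M k (\<gamma> \<circ> \<phi>)) = deriv \<phi> 0 ^ m * Q (jet M k \<gamma>)))}"


section \<open>Wronskians\<close>

definition jet_deriv :: "'a manifold \<Rightarrow> nat \<Rightarrow> 'a set \<Rightarrow> nat \<Rightarrow> ('a \<Rightarrow> complex) \<Rightarrow> 'a jet \<Rightarrow> complex" where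
  "jet_deriv M k U p f = (\<lambda>j\<in>jets_over M k U. (deriv ^^ p) (f \<circ> jet_rep j) 0)"

definition wronskian :: "'a manifold \<Rightarrow> nat \<Rightarrow> 'a set \<Rightarrow> (nat \<Rightarrow> 'a \<Rightarrow> complex) \<Rightarrow> 'a jet \<Rightarrow> complex" where
  "wronskian M k U f = (\<lambda>j\<in>jets_over M k U.
     Determinant.det (Matrix.mat (k + 1) (k + 1) (\<lambda>(p, i). jet_deriv M k U p (f i) j)))"


section \<open>Holomorphic line bundles\<close>

text \<open>A local trivialisation over \<open>U\<close> is given by its fibre coordinate \<open>\<tau>\<close>, i.e. it is the map
  \<open>v \<mapsto> (lproj L v, \<tau> v)\<close> from the part of the total space over \<open>U\<close> to the product of \<open>U\<close> with the
  complex plane. The total space has the complex structure for which the members of \<open>ltrivs\<close> are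
  biholomorphic. The vector space axioms in the fibres follow, since each fibre is mapped
  bijectively and compatibly with the operations onto the complex plane.\<close>

record ('a, 'l) line_bundle =
  ltotal :: "'l set"
  lproj :: "'l \<Rightarrow> 'a"
  lplus :: "'l \<Rightarrow> 'l \<Rightarrow> 'l"
  lscale :: "complex \<Rightarrow> 'l \<Rightarrow> 'l"
  ltrivs :: "('a set \<times> ('l \<Rightarrow> complex)) set"

definition lfibre :: "('a, 'l) line_bundle \<Rightarrow> 'a \<Rightarrow> 'l set" where
  "lfibre L x = {v \<in> ltotal L. lproj L v = x}"

definition lframe :: "('a, 'l) line_bundle \<Rightarrow> ('l \<Rightarrow> complex) \<Rightarrow> 'a \<Rightarrow> 'l" where
  "lframe L \<tau> x = inv_into (lfibre L x) \<tau> 1"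

text \<open>The last condition concerns the transition functions from the trivialisations \<open>\<sigma>\<close> of the
  bundle to \<open>\<tau>\<close>. They have no zeros because \<open>\<tau>\<close> is injective on the fibres.\<close>

definition trivialization :: "'a manifold \<Rightarrow> ('a, 'l) line_bundle \<Rightarrow> 'a set \<Rightarrow> ('l \<Rightarrow> complex) \<Rightarrow> bool" where
  "trivialization M L U \<tau> \<longleftrightarrow> openin (mtop M) U \<and>
     (\<forall>x\<in>U. bij_betw \<tau> (lfibre L x) UNIV \<and>
        (\<forall>v\<in>lfibre L x. \<forall>w\<in>lfibre L x. \<tau> (lplus L v w) = \<tau> v + \<tau> w) \<and>
        (\<forall>v\<in>lfibre L x. \<forall>c. \<tau> (lscale L c v) = c * \<tau> v)) \<and>
     (\<forall>(V, \<sigma>)\<in>ltrivs L. (\<lambda>x\<in>U \<inter> V. \<tau> (lframe L \<sigma> x)) \<in> hol_fun M (U \<inter> V))"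

definition holomorphic_line_bundle :: "'a manifold \<Rightarrow> ('a, 'l) line_bundle \<Rightarrow> bool" where
  "holomorphic_line_bundle M L \<longleftrightarrow>
     lproj L ` ltotal L \<subseteq> topspace (mtop M) \<and>
     (\<forall>x. \<forall>v\<in>lfibre L x. \<forall>w\<in>lfibre L x. lplus L v w \<in> lfibre L x) \<and>
     (\<forall>x. \<forall>v\<in>lfibre L x. \<forall>c. lscale L c v \<in> lfibre L x) \<and>
     (\<Union>(V, \<sigma>)\<in>ltrivs L. V) = topspace (mtop M) \<and>
     (\<forall>(V, \<sigma>)\<in>ltrivs L. trivialization M L V \<sigma>)"

definition lsections :: "'a manifold \<Rightarrow> ('a, 'l) line_bundle \<Rightarrow> 'a set \<Rightarrow> ('a \<Rightarrow> 'l) set" where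
  "lsections M L U = {s \<in> extensional U. (\<forall>x\<in>U. s x \<in> lfibre L x) \<and>
     (\<forall>(V, \<sigma>)\<in>ltrivs L. (\<lambda>x\<in>U \<inter> V. \<sigma> (s x)) \<in> hol_fun M (U \<inter> V))}"

text \<open>The local Wronskian of the sections \<open>s\<close> of \<open>L\<close> in the trivialisation \<open>\<tau>\<close> over \<open>U\<close>.\<close>

definition lwronskian :: "'a manifold \<Rightarrow> ('a, 'l) line_bundle \<Rightarrow> nat \<Rightarrow> 'a set \<Rightarrow> ('l \<Rightarrow> complex) \<Rightarrow>
    (nat \<Rightarrow> 'a \<Rightarrow> 'l) \<Rightarrow> 'a jet \<Rightarrow> complex" where
  "lwronskian M L k U \<tau> s = wronskian M k U (\<lambda>j. \<lambda>x\<in>U. \<tau> (s j x))"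


section \<open>Tensor powers of a line bundle\<close>

text \<open>The \<open>r\<close>-th tensor power of a finite-dimensional vector space is realised as the dual of the
  space of its \<open>r\<close>-linear forms; the decomposable tensor of \<open>v\<close> is evaluation at \<open>v\<close>.\<close>

definition multilinear_forms :: "('a, 'l) line_bundle \<Rightarrow> nat \<Rightarrow> 'a \<Rightarrow> ((nat \<Rightarrow> 'l) \<Rightarrow> complex) set" where
  "multilinear_forms L r x = {m \<in> extensional ({..<r} \<rightarrow>\<^sub>E lfibre L x).
     \<forall>v\<in>{..<r} \<rightarrow>\<^sub>E lfibre L x. \<forall>i<r. \<forall>w\<in>lfibre L x.
       (\<forall>w'\<in>lfibre L x. m (v(i := lplus L w w')) = m (v(i := w)) + m (v(i := w'))) \<and>
       (\<forall>c. m (v(i := lscale L c w)) = c * m (v(i := w)))}"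

definition tensor_fibre :: "('a, 'l) line_bundle \<Rightarrow> nat \<Rightarrow> 'a \<Rightarrow> (((nat \<Rightarrow> 'l) \<Rightarrow> complex) \<Rightarrow> complex) set" where
  "tensor_fibre L r x = {T \<in> extensional (multilinear_forms L r x).
     \<forall>m\<in>multilinear_forms L r x.
       (\<forall>m'\<in>multilinear_forms L r x.
          T (\<lambda>v\<in>{..<r} \<rightarrow>\<^sub>E lfibre L x. m v + m' v) = T m + T m') \<and>
       (\<forall>c. T (\<lambda>v\<in>{..<r} \<rightarrow>\<^sub>E lfibre L x. c * m v) = c * T m)}"

definition pure_tensor :: "('a, 'l) line_bundle \<Rightarrow> nat \<Rightarrow> 'a \<Rightarrow> (nat \<Rightarrow> 'l) \<Rightarrow>
    (((nat \<Rightarrow> 'l) \<Rightarrow> complex) \<Rightarrow> complex)" where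
  "pure_tensor L r x v = (\<lambda>m\<in>multilinear_forms L r x. m (restrict v {..<r}))"

text \<open>The trivialisation induced by \<open>\<tau>\<close> sends the decomposable tensor of \<open>v\<close> to the product of the
  numbers \<open>\<tau> (v i)\<close>.\<close>

definition tensor_power :: "'a manifold \<Rightarrow> ('a, 'l) line_bundle \<Rightarrow> nat \<Rightarrow>
    ('a, 'a \<times> (((nat \<Rightarrow> 'l) \<Rightarrow> complex) \<Rightarrow> complex)) line_bundle" where
  "tensor_power M L r = \<lparr>
     ltotal = (SIGMA x:topspace (mtop M). tensor_fibre L r x),
     lproj = fst,
     lplus = (\<lambda>(x, T) (_, T'). (x, \<lambda>m\<in>multilinear_forms L r x. T m + T' m)),
     lscale = (\<lambda>c (x, T). (x, \<lambda>m\<in>multilinear_forms L r x. c * T m)),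
     ltrivs = (\<lambda>(U, \<tau>). (U, \<lambda>(x, T). T (\<lambda>v\<in>{..<r} \<rightarrow>\<^sub>E lfibre L x. \<Prod>i<r. \<tau> (v i)))) ` ltrivs L\<rparr>"

definition frame_power :: "('a, 'l) line_bundle \<Rightarrow> nat \<Rightarrow> 'a set \<Rightarrow> ('l \<Rightarrow> complex) \<Rightarrow>
    'a \<Rightarrow> 'a \<times> (((nat \<Rightarrow> 'l) \<Rightarrow> complex) \<Rightarrow> complex)" where
  "frame_power L r U \<tau> = (\<lambda>x\<in>U. (x, pure_tensor L r x (\<lambda>_. lframe L \<tau> x)))"


section \<open>Sheaves of modules and their tensor product\<close>

text \<open>\<open>sh_plus F U\<close> and \<open>sh_act F U\<close> are the operations on the sections over \<open>U\<close>, and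
  \<open>sh_res F V\<close> restricts sections over larger sets to \<open>V\<close>.\<close>

record ('a, 'f) module_sheaf =
  sh_sec :: "'a set \<Rightarrow> 'f set"
  sh_res :: "'a set \<Rightarrow> 'f \<Rightarrow> 'f"
  sh_plus :: "'a set \<Rightarrow> 'f \<Rightarrow> 'f \<Rightarrow> 'f"
  sh_act :: "'a set \<Rightarrow> ('a \<Rightarrow> complex) \<Rightarrow> 'f \<Rightarrow> 'f"

definition inv_jet_sheaf :: "'a manifold \<Rightarrow> nat \<Rightarrow> nat \<Rightarrow> ('a, 'a jet \<Rightarrow> complex) module_sheaf" where
  "inv_jet_sheaf M k m = \<lparr>
     sh_sec = inv_jet_diff M k m,
     sh_res = (\<lambda>V Q. restrict Q (jets_over M k V)),
     sh_plus = (\<lambda>U Q R. \<lambda>j\<in>jets_over M k U. Q j + R j),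
     sh_act = (\<lambda>U a Q. \<lambda>j\<in>jets_over M k U. a (jet_proj j) * Q j)\<rparr>"

definition bundle_sheaf :: "'a manifold \<Rightarrow> ('a, 'l) line_bundle \<Rightarrow> ('a, 'a \<Rightarrow> 'l) module_sheaf" where
  "bundle_sheaf M L = \<lparr>
     sh_sec = lsections M L,
     sh_res = (\<lambda>V s. restrict s V),
     sh_plus = (\<lambda>U s t. \<lambda>x\<in>U. lplus L (s x) (t x)),
     sh_act = (\<lambda>U a s. \<lambda>x\<in>U. lscale L (a x) (s x))\<rparr>"

text \<open>The tensor product of the modules of sections over \<open>U\<close>, over the ring of holomorphic
  functions on \<open>U\<close>, is the free abelian group \<open>tensor_gen F G U\<close> modulo the subgroup
  \<open>tensor_rel M F G U\<close>.\<close>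

definition tensor_gen :: "('a, 'f) module_sheaf \<Rightarrow> ('a, 'g) module_sheaf \<Rightarrow> 'a set \<Rightarrow> ('f \<times> 'g \<Rightarrow>\<^sub>0 int) monoid" where
  "tensor_gen F G U = free_Abelian_group (sh_sec F U \<times> sh_sec G U)"

definition tensor_rel :: "'a manifold \<Rightarrow> ('a, 'f) module_sheaf \<Rightarrow> ('a, 'g) module_sheaf \<Rightarrow> 'a set \<Rightarrow>
    ('f \<times> 'g \<Rightarrow>\<^sub>0 int) set" where
  "tensor_rel M F G U = generate (tensor_gen F G U)
     ({frag_of (sh_plus F U f f', g) - frag_of (f, g) - frag_of (f', g) |f f' g.
         f \<in> sh_sec F U \<and> f' \<in> sh_sec F U \<and> g \<in> sh_sec G U} \<union>
      {frag_of (f, sh_plus G U g g') - frag_of (f, g) - frag_of (f, g') |f g g'.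
         f \<in> sh_sec F U \<and> g \<in> sh_sec G U \<and> g' \<in> sh_sec G U} \<union>
      {frag_of (sh_act F U a f, g) - frag_of (f, sh_act G U a g) |a f g.
         a \<in> hol_fun M U \<and> f \<in> sh_sec F U \<and> g \<in> sh_sec G U})"

definition tensor_res :: "('a, 'f) module_sheaf \<Rightarrow> ('a, 'g) module_sheaf \<Rightarrow> 'a set \<Rightarrow>
    ('f \<times> 'g \<Rightarrow>\<^sub>0 int) \<Rightarrow> ('f \<times> 'g \<Rightarrow>\<^sub>0 int)" where
  "tensor_res F G V = frag_extend (\<lambda>(f, g). frag_of (sh_res F V f, sh_res G V g))"

text \<open>The germ at \<open>x\<close> of a local section of the presheaf tensor product, as the class of all its
  representatives on open neighbourhoods of \<open>x\<close>.\<close>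

definition tensor_germ :: "'a manifold \<Rightarrow> ('a, 'f) module_sheaf \<Rightarrow> ('a, 'g) module_sheaf \<Rightarrow> 'a \<Rightarrow>
    'a set \<Rightarrow> ('f \<times> 'g \<Rightarrow>\<^sub>0 int) \<Rightarrow> ('a set \<times> ('f \<times> 'g \<Rightarrow>\<^sub>0 int)) set" where
  "tensor_germ M F G x V c = {(V', d). openin (mtop M) V' \<and> x \<in> V' \<and>
     d \<in> carrier (tensor_gen F G V') \<and>
     (\<exists>W. openin (mtop M) W \<and> x \<in> W \<and> W \<subseteq> V \<inter> V' \<and>
        tensor_res F G W c - tensor_res F G W d \<in> tensor_rel M F G W)}"

type_synonym ('a, 'f, 'g) tensor_section = "'a \<Rightarrow> ('a set \<times> ('f \<times> 'g \<Rightarrow>\<^sub>0 int)) set"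

text \<open>The sections over \<open>U\<close> of the tensor product sheaf, i.e. of the sheafification of the presheaf
  tensor product: functions to the germs that are locally induced by one section of the
  presheaf.\<close>

definition tensor_sections :: "'a manifold \<Rightarrow> ('a, 'f) module_sheaf \<Rightarrow> ('a, 'g) module_sheaf \<Rightarrow> 'a set \<Rightarrow>
    ('a, 'f, 'g) tensor_section set" where
  "tensor_sections M F G U = {\<sigma> \<in> extensional U. \<forall>x\<in>U. \<exists>V c. openin (mtop M) V \<and> x \<in> V \<and> V \<subseteq> U \<and>
     c \<in> carrier (tensor_gen F G V) \<and> (\<forall>y\<in>V. \<sigma> y = tensor_germ M F G y V c)}"

definition tensor_of :: "'a manifold \<Rightarrow> ('a, 'f) module_sheaf \<Rightarrow> ('a, 'g) module_sheaf \<Rightarrow> 'a set \<Rightarrow>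
    'f \<Rightarrow> 'g \<Rightarrow> ('a, 'f, 'g) tensor_section" where
  "tensor_of M F G U f g = (\<lambda>x\<in>U. tensor_germ M F G x U (frag_of (f, g)))"

end

theory Submission
  imports Defs
begin

text \<open>If \<open>\<tau>' = g \<tau>\<close> on the overlap of two trivialisations, then the Leibniz rule expresses the
  matrix of derivatives of the \<open>\<tau>' s\<^sub>i\<close> as a lower triangular matrix with diagonal entries \<open>g\<close> times
  that of the \<open>\<tau> s\<^sub>i\<close>. So the Wronskian is multiplied by \<open>g ^ (k + 1)\<close>, and \<open>g\<close> to the same power
  relates the frames of the tensor power: the two local tensors differ by a defining relation of the
  tensor product. The chain rule gives the invariance under reparametrisation in the same way, with
  diagonal entries \<open>\<phi>'(0) ^ p\<close>. Holomorphy in the jet coordinates follows from Cauchy's formula for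
  the derivatives of \<open>F \<circ> \<gamma>\<close> at 0, where \<open>\<gamma>\<close> is the Taylor polynomial with the given
  coefficients, without any explicit form of the iterated chain rule.\<close>

section \<open>Holomorphic dependence on parameters\<close>

text \<open>A jet is known only through the curve picked by \<open>jet_rep\<close>, while holomorphy
  on the jet space refers to coordinates that are derivatives of this curve. The link is that the
  derivatives of a composite up to order \<open>k\<close> depend only on those of the curve up to
  order \<open>k\<close>: the unknown curve may be exchanged for a polynomial that varies
  holomorphically with the coordinates. Since holomorphy in several variables is encoded as
  continuity together with holomorphy in each variable, already the composition with a curve has to
  be derived, from one-variable integral formulas with parameters. On the bundle side, sections are
  tested in the members of \<open>ltrivs\<close> only, but local Wronskians are formed in every
  trivialisation; the passage between the two uses that holomorphy is local. Sections of the tensor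
  product are functions into germs. The global one can therefore be defined point by point from any
  trivialisation chosen there, and equality of the germs on overlaps yields both that it is locally
  induced by a single tensor and that its restrictions are the prescribed ones.\<close>

lemma continuous_on_contour_integral_linepath:
  assumes "continuous_on (S \<times> closed_segment a b) (\<lambda>(x, w). f x w)"
  shows "continuous_on S (\<lambda>x. contour_integral (linepath a b) (f x))"
proof -
  have "continuous_on (S \<times> cbox 0 1) (\<lambda>(x, t). f x (linepath a b t) * (b - a))"
    unfolding case_prod_unfold
    by (intro continuous_intros continuous_on_compose2[OF assms, of _ "\<lambda>p. (fst p, linepath a b (snd p))",
          unfolded case_prod_unfold fst_conv snd_conv])
      (auto intro!: continuous_intros simp: linepath_def in_segment)
  from integral_continuous_on_param[OF this]
  show ?thesis
    by (simp add: contour_integral_integral vector_derivative_linepath_at)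
qed

lemma continuous_on_contour_integral_circlepath:
  assumes "continuous_on (S \<times> sphere z r) (\<lambda>(x, w). f x w)" "0 \<le> r"
  shows "continuous_on S (\<lambda>x. contour_integral (circlepath z r) (f x))"
proof -
  have "circlepath z r t \<in> sphere z r" for t
    using assms(2) by (auto simp: circlepath dist_norm norm_mult)
  then have "continuous_on (S \<times> cbox 0 1)
      (\<lambda>(x, t). f x (circlepath z r t) * vector_derivative (circlepath z r) (at t))"
    unfolding case_prod_unfold vector_derivative_circlepath
    by (intro continuous_intros continuous_on_compose2[OF assms(1), of _ "\<lambda>p. (fst p, circlepath z r (snd p))",
          unfolded case_prod_unfold fst_conv snd_conv])
      (auto intro!: continuous_intros simp: circlepath)
  from integral_continuous_on_param[OF this]
  show ?thesis
    by (simp add: contour_integral_integral)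
qed

text \<open>Morera's theorem: by Fubini, integrating over a triangle commutes with integrating over
  the circle, and for each fixed \<open>u\<close> the triangle integral of \<open>K w u\<close>
  vanishes by Cauchy's theorem. No derivative is taken under the integral sign.\<close>

lemma holomorphic_on_contour_integral_circlepath:
  fixes K :: "complex \<Rightarrow> complex \<Rightarrow> complex"
  assumes S: "open S" and r: "0 < r"
    and cont: "continuous_on (S \<times> sphere z r) (\<lambda>(w, u). K w u)"
    and hol: "\<And>u. u \<in> sphere z r \<Longrightarrow> (\<lambda>w. K w u) holomorphic_on S"
  shows "(\<lambda>w. contour_integral (circlepath z r) (K w)) holomorphic_on S"
proof -
  let ?H = "\<lambda>w. contour_integral (circlepath z r) (K w)"
  let ?J = "\<lambda>a b u. contour_integral (linepath a b) (\<lambda>w. K w u)"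
  have edge: "contour_integral (linepath a b) ?H = contour_integral (circlepath z r) (?J a b)"
    and intg: "(?J a b) contour_integrable_on (circlepath z r)"
    if ab: "closed_segment a b \<subseteq> S" for a b
  proof -
    show "contour_integral (linepath a b) ?H = contour_integral (circlepath z r) (?J a b)"
    proof (rule contour_integral_swap)
      show "continuous_on (path_image (linepath a b) \<times> path_image (circlepath z r)) (\<lambda>(y1, y2). K y1 y2)"
        using ab r by (auto intro: continuous_on_subset[OF cont])
    qed (auto intro!: continuous_intros simp: vector_derivative_linepath_at vector_derivative_circlepath)
    \<comment> \<open>Integrability of the edge integrals as functions of \<open>u\<close> is what
      permits adding the three edges under the circle integral.\<close>
    have "continuous_on (sphere z r \<times> closed_segment a b) (\<lambda>(u, w). K w u)"
      using ab by (auto intro: continuous_on_subset[OF continuous_on_swap_args[OF cont]])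
    then have "continuous_on (sphere z r) (?J a b)"
      by (rule continuous_on_contour_integral_linepath)
    then show "(?J a b) contour_integrable_on (circlepath z r)"
      using r by (simp add: contour_integrable_continuous_circlepath)
  qed
  have "?H analytic_on S"
  proof (rule Morera_triangle)
    show "continuous_on S ?H"
      using cont r by (intro continuous_on_contour_integral_circlepath) auto
    show "open S" by fact
    fix a b c
    show "convex hull {a, b, c} \<subseteq> S \<longrightarrow> contour_integral (linepath a b) ?H +
        contour_integral (linepath b c) ?H + contour_integral (linepath c a) ?H = 0"
    proof
      assume abc: "convex hull {a, b, c} \<subseteq> S"
      have seg: "closed_segment a b \<subseteq> S" "closed_segment b c \<subseteq> S" "closed_segment c a \<subseteq> S"
        using abc by (auto simp: segment_convex_hull dest!: subsetD[OF hull_mono[of "{a,b}" "{a,b,c}"], rotated]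
            subsetD[OF hull_mono[of "{b,c}" "{a,b,c}"], rotated] subsetD[OF hull_mono[of "{c,a}" "{a,b,c}"], rotated])
      have "?J a b u + ?J b c u + ?J c a u = 0" if u: "u \<in> sphere z r" for u
      proof -
        have "(\<lambda>w. K w u) holomorphic_on convex hull {a, b, c}"
          using hol[OF u] abc by (rule holomorphic_on_subset)
        from has_chain_integral_chain_integral3[OF Cauchy_theorem_triangle[OF this]]
        show ?thesis .
      qed
      then have "contour_integral (circlepath z r) (\<lambda>u. ?J a b u + ?J b c u + ?J c a u)
          = contour_integral (circlepath z r) (\<lambda>u. 0)"
        using r by (intro contour_integral_eq) auto
      then show "contour_integral (linepath a b) ?H +
          contour_integral (linepath b c) ?H + contour_integral (linepath c a) ?H = 0"
        by (simp add: edge seg intg contour_integral_add contour_integrable_add)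
    qed
  qed
  then show ?thesis by (rule analytic_imp_holomorphic)
qed

text \<open>Cauchy's formula in the second variable moves \<open>z t\<close> out of \<open>G\<close>
  and into the kernel \<open>1 / (u - z t)\<close>, over a circle that does not depend on
  \<open>t\<close>. For fixed \<open>u\<close> the integrand is a quotient of functions holomorphic
  in \<open>t\<close>, so separate holomorphy and joint continuity of \<open>G\<close> are
  enough.\<close>

lemma holomorphic_on_diagonal:
  fixes G :: "complex \<Rightarrow> complex \<Rightarrow> complex"
  assumes S: "open S" and z: "z holomorphic_on S" and r: "0 < r"
    and zr: "\<And>t. t \<in> S \<Longrightarrow> z t \<in> ball a r"
    and cont: "continuous_on (S \<times> cball a r) (\<lambda>(t, u). G t u)"
    and hol1: "\<And>u. u \<in> cball a r \<Longrightarrow> (\<lambda>t. G t u) holomorphic_on S"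
    and hol2: "\<And>t. t \<in> S \<Longrightarrow> G t holomorphic_on ball a r"
  shows "(\<lambda>t. G t (z t)) holomorphic_on S"
proof -
  have "(\<lambda>t. contour_integral (circlepath a r) (\<lambda>u. G t u / (u - z t))) holomorphic_on S"
  proof (rule holomorphic_on_contour_integral_circlepath[OF S r])
    have nz: "z t \<noteq> u" if "t \<in> S" "u \<in> sphere a r" for t u
      using zr[OF that(1)] that(2) by auto
    have "continuous_on (S \<times> sphere a r) (\<lambda>p. z (fst p))"
      by (rule continuous_on_compose2[OF holomorphic_on_imp_continuous_on[OF z]]) (auto intro: continuous_intros)
    moreover have "continuous_on (S \<times> sphere a r) (\<lambda>p. G (fst p) (snd p))"
      by (rule continuous_on_subset[OF cont[unfolded case_prod_unfold]]) auto
    ultimately show "continuous_on (S \<times> sphere a r) (\<lambda>(t, u). G t u / (u - z t))"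
      using nz unfolding case_prod_unfold by (intro continuous_intros) force+
    show "(\<lambda>t. G t u / (u - z t)) holomorphic_on S" if "u \<in> sphere a r" for u
      using nz that by (intro holomorphic_intros hol1 z) force+
  qed
  then have "(\<lambda>t. 1 / (2 * of_real pi * \<i>) * contour_integral (circlepath a r) (\<lambda>u. G t u / (u - z t))) holomorphic_on S"
    by (intro holomorphic_intros)
  moreover have "1 / (2 * of_real pi * \<i>) * contour_integral (circlepath a r) (\<lambda>u. G t u / (u - z t)) = G t (z t)"
    if t: "t \<in> S" for t
  proof -
    have "continuous_on (cball a r) (G t)"
      using t by (intro continuous_on_compose2[OF cont, of _ "\<lambda>u. (t, u)", unfolded case_prod_conv])
        (auto intro!: continuous_intros)
    then have "((\<lambda>u. G t u / (u - z t)) has_contour_integral 2 * of_real pi * \<i> * G t (z t)) (circlepath a r)"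
      using hol2[OF t] zr[OF t] by (intro Cauchy_integral_circlepath) (auto simp: dist_norm norm_minus_commute)
    from contour_integral_unique[OF this] show ?thesis by simp
  qed
  ultimately show ?thesis
    by (metis (no_types, lifting) holomorphic_cong)
qed

text \<open>Cauchy's formula for the derivative of order \<open>p\<close> at the centre of the disc
  is an integral over one circle for all \<open>w\<close>; the dependence on \<open>w\<close> is
  thus that of a contour integral with a parameter.\<close>

lemma holomorphic_on_higher_deriv_parameter:
  fixes H :: "complex \<Rightarrow> complex \<Rightarrow> complex"
  assumes S: "open S" and r: "0 < r"
    and cont: "continuous_on (S \<times> cball a r) (\<lambda>(w, t). H w t)"
    and hol1: "\<And>t. t \<in> cball a r \<Longrightarrow> (\<lambda>w. H w t) holomorphic_on S"
    and hol2: "\<And>w. w \<in> S \<Longrightarrow> H w holomorphic_on ball a r"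
  shows "(\<lambda>w. (deriv ^^ p) (H w) a) holomorphic_on S"
proof -
  have "(\<lambda>w. contour_integral (circlepath a r) (\<lambda>t. H w t / (t - a) ^ Suc p)) holomorphic_on S"
  proof (rule holomorphic_on_contour_integral_circlepath[OF S r])
    have "continuous_on (S \<times> sphere a r) (\<lambda>p. H (fst p) (snd p))"
      by (rule continuous_on_subset[OF cont[unfolded case_prod_unfold]]) auto
    then show "continuous_on (S \<times> sphere a r) (\<lambda>(w, t). H w t / (t - a) ^ Suc p)"
      using r unfolding case_prod_unfold by (intro continuous_intros) auto
    show "(\<lambda>w. H w t / (t - a) ^ Suc p) holomorphic_on S" if "t \<in> sphere a r" for t
      using r that by (intro holomorphic_intros hol1) auto
  qed
  then have "(\<lambda>w. fact p / (2 * of_real pi * \<i>) *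
      contour_integral (circlepath a r) (\<lambda>t. H w t / (t - a) ^ Suc p)) holomorphic_on S"
    by (intro holomorphic_intros)
  moreover have "fact p / (2 * of_real pi * \<i>) *
      contour_integral (circlepath a r) (\<lambda>t. H w t / (t - a) ^ Suc p) = (deriv ^^ p) (H w) a"
    if w: "w \<in> S" for w
  proof -
    have "continuous_on (cball a r) (H w)"
      using w by (intro continuous_on_compose2[OF cont, of _ "\<lambda>u. (w, u)", unfolded case_prod_conv])
        (auto intro!: continuous_intros)
    from Cauchy_contour_integral_circlepath[OF this hol2[OF w], of a p] r show ?thesis by simp
  qed
  ultimately show ?thesis
    by (metis (no_types, lifting) holomorphic_cong)
qed

text \<open>The same integral formula, with a parameter from any topological space: all coordinates
  of a jet vary at once when joint continuity is checked, whereas holomorphy is checked in one of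
  them.\<close>

lemma continuous_on_higher_deriv_parameter:
  fixes H :: "'x::topological_space \<Rightarrow> complex \<Rightarrow> complex"
  assumes r: "0 < r"
    and cont: "continuous_on (T \<times> cball a r) (\<lambda>(x, t). H x t)"
    and hol: "\<And>x. x \<in> T \<Longrightarrow> H x holomorphic_on ball a r"
  shows "continuous_on T (\<lambda>x. (deriv ^^ p) (H x) a)"
proof -
  have contH: "continuous_on (cball a r) (H x)" if "x \<in> T" for x
    using that by (intro continuous_on_compose2[OF cont, of _ "\<lambda>u. (x, u)", unfolded case_prod_conv])
      (auto intro!: continuous_intros)
  have "continuous_on T (\<lambda>x. fact p / (2 * of_real pi * \<i>) *
      contour_integral (circlepath a r) (\<lambda>t. H x t / (t - a) ^ Suc p))"
  proof (intro continuous_intros continuous_on_contour_integral_circlepath)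
    have "continuous_on (T \<times> sphere a r) (\<lambda>p. H (fst p) (snd p))"
      by (rule continuous_on_subset[OF cont[unfolded case_prod_unfold]]) auto
    then show "continuous_on (T \<times> sphere a r) (\<lambda>(w, t). H w t / (t - a) ^ Suc p)"
      using r unfolding case_prod_unfold by (intro continuous_intros) auto
  qed (use r in auto)
  moreover have "fact p / (2 * of_real pi * \<i>) *
      contour_integral (circlepath a r) (\<lambda>t. H x t / (t - a) ^ Suc p) = (deriv ^^ p) (H x) a"
    if x: "x \<in> T" for x
    using Cauchy_contour_integral_circlepath[OF contH[OF x] hol[OF x], of a p] r by simp
  ultimately show ?thesis
    by (metis (no_types, lifting) continuous_on_cong)
qed

section \<open>Holomorphic functions of several variables along curves\<close>

text \<open>The coordinates from \<open>n\<close> on have the constant value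
  \<open>undefined\<close> and hence are continuous too, so the identity is continuous in both
  directions. The subspace form gives access to \<open>continuous_on\<close> and \<open>open\<close>
  on the type of all functions from \<open>nat\<close> to \<open>complex\<close>.\<close>

lemma cspace_eq: "cspace n = top_of_set (extensional {..<n})"
proof -
  have 1: "continuous_map (top_of_set (extensional {..<n})) (cspace n) id"
    unfolding cspace_def by (auto simp: continuous_map_componentwise intro!: continuous_on_product_coordinates[THEN continuous_on_subset])
  have "continuous_map (cspace n) euclidean (\<lambda>x. x i)" for i
  proof (cases "i < n")
    case True
    then show ?thesis by (auto simp: cspace_def intro: continuous_map_product_projection)
  next
    case False
    have "continuous_map (cspace n) euclidean (\<lambda>x. undefined)" by simp
    then show ?thesis
      by (rule continuous_map_eq) (use False in \<open>auto simp: cspace_def PiE_iff extensional_def\<close>)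
  qed
  then have "continuous_map (cspace n) euclidean id"
    unfolding euclidean_product_topology[symmetric]
    by (auto simp: continuous_map_componentwise)
  then have 2: "continuous_map (cspace n) (top_of_set (extensional {..<n})) id"
    by (auto simp: continuous_map_in_subtopology cspace_def PiE_iff)
  have ts: "topspace (cspace n) = extensional {..<n}"
    by (rule Set.set_eqI) (simp add: cspace_def PiE_iff)
  show ?thesis
    unfolding topology_eq
  proof (intro allI iffI)
    fix S
    assume S: "openin (cspace n) S"
    then have "S \<subseteq> extensional {..<n}" using openin_subset ts by metis
    then show "openin (top_of_set (extensional {..<n})) S"
      using openin_continuous_map_preimage[OF 1 S] by (simp add: Int_absorb1 Collect_conj_eq)
  next
    fix S :: "(nat \<Rightarrow> complex) set"
    assume S: "openin (top_of_set (extensional {..<n})) S"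
    then have "S \<subseteq> extensional {..<n}" using openin_subset by fastforce
    then show "openin (cspace n) S"
      using openin_continuous_map_preimage[OF 2 S] by (simp add: Int_absorb1 Collect_conj_eq ts)
  qed
qed

lemma holomorphic_several_iff:
  assumes "\<Omega> \<subseteq> extensional {..<n}"
  shows "holomorphic_several n \<Omega> f \<longleftrightarrow> continuous_on \<Omega> f \<and>
    (\<forall>z\<in>\<Omega>. \<forall>i<n. (\<lambda>w. f (z(i := w))) holomorphic_on {w. z(i := w) \<in> \<Omega>})"
  using assms by (simp add: holomorphic_several_def cspace_eq subtopology_subtopology Int_absorb1)

lemma openin_cspace_subset: "openin (cspace n) \<Omega> \<Longrightarrow> \<Omega> \<subseteq> extensional {..<n}"
  by (auto simp: cspace_eq openin_open)

lemma openin_cspace_contains_box: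
  assumes "openin (cspace n) \<Omega>" "x \<in> \<Omega>"
  obtains r where "0 < r" "(\<Pi>\<^sub>E i\<in>{..<n}. cball (x i) r) \<subseteq> \<Omega>"
proof -
  obtain U where U: "\<And>i. i < n \<Longrightarrow> open (U i)" "x \<in> Pi\<^sub>E {..<n} U" "Pi\<^sub>E {..<n} U \<subseteq> \<Omega>"
    using assms(1)[unfolded cspace_def openin_product_topology_alt, rule_format, OF assms(2)] by auto
  have "\<exists>r>0. cball (x i) r \<subseteq> U i" if "i < n" for i
    using U(1)[OF that] PiE_mem[OF U(2), of i] that unfolding open_contains_cball by blast
  then obtain \<rho> where \<rho>: "\<And>i. i < n \<Longrightarrow> \<rho> i > 0 \<and> cball (x i) (\<rho> i) \<subseteq> U i"
    by metis
  \<comment> \<open>The extra element 1 keeps the minimum meaningful when \<open>n\<close> is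
    0.\<close>
  define r where "r = Min (insert 1 (\<rho> ` {..<n}))"
  have r: "r > 0" using \<rho> by (simp add: r_def)
  have "cball (x i) r \<subseteq> U i" if "i < n" for i
  proof -
    have "r \<le> \<rho> i" using that by (auto simp: r_def)
    then show ?thesis using \<rho>[OF that] by auto
  qed
  then have "(\<Pi>\<^sub>E i\<in>{..<n}. cball (x i) r) \<subseteq> Pi\<^sub>E {..<n} U"
    by (auto intro!: PiE_mono)
  from that[OF r subset_trans[OF this U(3)]] show thesis .
qed

lemma holomorphic_on_local:
  assumes "\<And>x. x \<in> S \<Longrightarrow> \<exists>T. open T \<and> x \<in> T \<and> f holomorphic_on T"
  shows "f holomorphic_on S"
  unfolding holomorphic_on_def
proof
  fix x assume "x \<in> S"
  then obtain T where "open T" "x \<in> T" "f holomorphic_on T" using assms by blast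
  then have "f field_differentiable at x" by (simp add: holomorphic_on_imp_differentiable_at)
  then show "f field_differentiable at x within S" by (rule field_differentiable_at_within)
qed

text \<open>The components of the curve are substituted one at a time, each time by restriction to a diagonal.\<close>

lemma holomorphic_several_compose_curve:
  assumes \<Omega>: "openin (cspace n) \<Omega>" and F: "holomorphic_several n \<Omega> F" and S: "open S"
    and z\<Omega>: "\<And>t. t \<in> S \<Longrightarrow> z t \<in> \<Omega>"
    and z: "\<And>i. i < n \<Longrightarrow> (\<lambda>t. z t i) holomorphic_on S"
  shows "(\<lambda>t. F (z t)) holomorphic_on S"
proof (rule holomorphic_on_local)
  fix t0 assume t0: "t0 \<in> S"
  have ext: "\<Omega> \<subseteq> extensional {..<n}" by (rule openin_cspace_subset[OF \<Omega>])
  have F1: "continuous_on \<Omega> F"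
    and F2: "\<And>x i. x \<in> \<Omega> \<Longrightarrow> i < n \<Longrightarrow> (\<lambda>w. F (x(i := w))) holomorphic_on {w. x(i := w) \<in> \<Omega>}"
    using F unfolding holomorphic_several_iff[OF ext] by auto
  obtain r where r: "0 < r" and box: "(\<Pi>\<^sub>E i\<in>{..<n}. cball (z t0 i) r) \<subseteq> \<Omega>"
    using openin_cspace_contains_box[OF \<Omega> z\<Omega>[OF t0]] by blast
  define B where "B = (\<Pi>\<^sub>E i\<in>{..<n}. cball (z t0 i) r)"
  \<comment> \<open>A neighbourhood of \<open>t0\<close> on which the curve stays in the polydisc
    \<open>B\<close>, so that points with some coordinates from the curve and the others from
    \<open>B\<close> remain in \<open>\<Omega>\<close>.\<close>
  define T where "T = S \<inter> (\<Inter>i\<in>{..<n}. {t \<in> S. z t i \<in> ball (z t0 i) r})"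
  have "open {t \<in> S. z t i \<in> ball (z t0 i) r}" if "i < n" for i
    using continuous_open_preimage[OF holomorphic_on_imp_continuous_on[OF z[OF that]] S open_ball]
    by (simp add: vimage_def Int_def)
  then have "open T" unfolding T_def using S by (intro open_Int open_INT) auto
  moreover have "t0 \<in> T" using t0 r by (auto simp: T_def)
  moreover have "(\<lambda>t. F (z t)) holomorphic_on T"
  proof -
    have TB: "z t i \<in> ball (z t0 i) r" if "t \<in> T" "i < n" for t i
      using that by (auto simp: T_def)
    have zT: "(\<lambda>t. z t i) holomorphic_on T" if "i < n" for i
      using z[OF that] by (rule holomorphic_on_subset) (auto simp: T_def)
    have "(\<lambda>t. F (\<lambda>i. if i < j then z t i else a i)) holomorphic_on T"
      if "j \<le> n" "a \<in> B" for j a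
      using that
    proof (induction j arbitrary: a)
      case 0
      show ?case by simp
    next
      case (Suc j)
      then have j: "j < n" by simp
      define G where "G t u = F (\<lambda>i. if i < j then z t i else (a(j := u)) i)" for t u
      have mem: "(\<lambda>i. if i < j then z t i else (a(j := u)) i) \<in> \<Omega>"
        if "t \<in> T" "u \<in> cball (z t0 j) r" for t u
      proof -
        have "(\<lambda>i. if i < j then z t i else (a(j := u)) i) \<in> B"
          using Suc.prems that TB[OF that(1)] unfolding B_def
          by (auto simp: PiE_iff extensional_def less_imp_le)
        then show ?thesis using box by (auto simp: B_def)
      qed
      have "(\<lambda>t. G t (z t j)) holomorphic_on T"
      proof (rule holomorphic_on_diagonal[OF \<open>open T\<close> zT[OF j] r])
        show "z t j \<in> ball (z t0 j) r" if "t \<in> T" for t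
          using TB[OF that j] .
        show "continuous_on (T \<times> cball (z t0 j) r) (\<lambda>(t, u). G t u)"
          unfolding G_def case_prod_unfold
        proof (rule continuous_on_compose2[OF F1])
          show "continuous_on (T \<times> cball (z t0 j) r)
              (\<lambda>p i. if i < j then z (fst p) i else (a(j := snd p)) i)"
          proof (rule continuous_on_coordinatewise_then_product)
            fix i
            consider "i < j" | "i = j" | "i > j" by linarith
            then show "continuous_on (T \<times> cball (z t0 j) r)
              (\<lambda>p. if i < j then z (fst p) i else (a(j := snd p)) i)"
            proof cases
              case 1
              then have "continuous_on (T \<times> cball (z t0 j) r) (\<lambda>p. z (fst p) i)"
                using j by (intro continuous_on_compose2[OF holomorphic_on_imp_continuous_on[OF zT[of i]]])
                  (auto intro!: continuous_intros)
              then show ?thesis using 1 by simp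
            qed (auto intro!: continuous_intros)
          qed
        qed (use mem in auto)
        show "(\<lambda>t. G t u) holomorphic_on T" if "u \<in> cball (z t0 j) r" for u
          unfolding G_def using Suc.prems j that
          by (intro Suc.IH) (auto simp: B_def PiE_iff extensional_def)
        show "G t holomorphic_on ball (z t0 j) r" if "t \<in> T" for t
        proof -
          let ?x = "\<lambda>i. if i < j then z t i else a i"
          have upd: "?x(j := u) = (\<lambda>i. if i < j then z t i else (a(j := u)) i)" for u
            by auto
          have "?x(j := a j) \<in> \<Omega>"
            unfolding upd using that Suc.prems j by (intro mem) (auto simp: B_def PiE_iff)
          then have x: "?x \<in> \<Omega>" by (simp add: fun_upd_idem)
          have "ball (z t0 j) r \<subseteq> {w. ?x(j := w) \<in> \<Omega>}"
            unfolding upd using mem[OF that] by auto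
          from holomorphic_on_subset[OF F2[OF x j] this]
          show ?thesis unfolding upd G_def .
        qed
      qed
      moreover have "(\<lambda>i. if i < j then z t i else (a(j := z t j)) i) = (\<lambda>i. if i < Suc j then z t i else a i)" for t
        by (auto simp: less_Suc_eq)
      ultimately show ?case by (simp add: G_def)
    qed
    moreover have "z t0 \<in> B"
      using r z\<Omega>[OF t0] ext by (auto simp: B_def PiE_iff)
    ultimately have "(\<lambda>t. F (\<lambda>i. if i < n then z t i else z t0 i)) holomorphic_on T"
      by blast
    moreover have "(\<lambda>i. if i < n then z t i else z t0 i) = z t" if "t \<in> T" for t
    proof -
      have "z t \<in> extensional {..<n}" "z t0 \<in> extensional {..<n}"
        using z\<Omega> t0 that ext by (auto simp: T_def)
      then show ?thesis by (auto simp: extensional_def fun_eq_iff)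
    qed
    ultimately show ?thesis by (metis (no_types, lifting) holomorphic_cong)
  qed
  ultimately show "\<exists>T. open T \<and> t0 \<in> T \<and> (\<lambda>t. F (z t)) holomorphic_on T" by blast
qed

section \<open>Derivatives at 0 of composites along curves with equal jets\<close>

text \<open>Cauchy's inequality on the circle of radius x bounds the derivative by p! C x^(k + 1 -
  p). The exponent is positive because \<open>p \<le> k\<close>, so the bound tends to 0 with
  x.\<close>

lemma higher_deriv_eq_0_of_bound:
  fixes h :: "complex \<Rightarrow> complex"
  assumes r: "0 < r" and h: "h holomorphic_on ball 0 r"
    and bound: "\<And>t. t \<in> ball 0 r \<Longrightarrow> norm (h t) \<le> C * norm t ^ Suc k" and p: "p \<le> k"
  shows "(deriv ^^ p) h 0 = 0"
proof -
  have "((\<lambda>x. fact p * (C * x ^ (Suc k - p))) \<longlongrightarrow> fact p * (C * 0 ^ (Suc k - p))) (at_right 0)"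
    by (intro tendsto_intros)
  moreover have "\<forall>\<^sub>F x in at_right 0. norm ((deriv ^^ p) h 0) \<le> fact p * (C * x ^ (Suc k - p))"
    using eventually_at_right_real[OF r]
  proof eventually_elim
    case (elim x)
    have "norm ((deriv ^^ p) h 0) \<le> fact p * (C * x ^ Suc k) / x ^ p"
    proof (rule Cauchy_inequality)
      show "h holomorphic_on ball 0 x" "continuous_on (cball 0 x) h"
        using elim by (auto intro!: holomorphic_on_subset[OF h] holomorphic_on_imp_continuous_on)
      show "norm (h t) \<le> C * x ^ Suc k" if "norm (0 - t) = x" for t
        using bound[of t] that elim by auto
    qed (use elim in auto)
    also have "\<dots> = fact p * (C * x ^ (Suc k - p))"
      using p elim by (simp add: power_diff)
    finally show ?case .
  qed
  ultimately have "norm ((deriv ^^ p) h 0) \<le> fact p * (C * 0 ^ (Suc k - p))"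
    by (intro tendsto_lowerbound) auto
  then show ?thesis using p by (simp add: Suc_diff_le)
qed

text \<open>\<open>f - g\<close> vanishes to order \<open>k + 1\<close> at 0, so its quotient by
  \<open>t ^ Suc k\<close> has a removable singularity. The identity holds for every
  \<open>t\<close>, also outside the disc: for \<open>t \<noteq> 0\<close> it defines
  \<open>d\<close>, and at 0 it is the equality of the values.\<close>

lemma higher_deriv_eq_imp_factor:
  fixes f g :: "complex \<Rightarrow> complex"
  assumes S: "open S" "0 \<in> S" and f: "f holomorphic_on S" and g: "g holomorphic_on S"
    and eq: "\<And>q. q \<le> k \<Longrightarrow> (deriv ^^ q) f 0 = (deriv ^^ q) g 0"
  obtains d r where "0 < r" "d holomorphic_on ball 0 r" "\<And>t. f t = g t + t ^ Suc k * d t"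
proof -
  define F where "F = fps_expansion f 0 - fps_expansion g 0"
  have fF: "(\<lambda>t. f t - g t) has_fps_expansion F"
    unfolding F_def using S f g by (intro fps_expansion_intros has_fps_expansion_fps_expansion) auto
  have F0: "fps_nth F q = 0" if "q < Suc k" for q
    using eq[of q] that by (simp add: F_def fps_expansion_def)
  define d where "d = (\<lambda>t. if t = 0 then fps_nth F (Suc k) else (f t - g t) / t ^ Suc k)"
  have "d has_fps_expansion fps_shift (Suc k) F" if "F \<noteq> 0"
    unfolding d_def using that F0
    by (intro has_fps_expansion_shift[OF fF] subdegree_geI) auto
  \<comment> \<open>The zero series has \<open>subdegree\<close> 0 by convention, so the lower bound
    on the \<open>subdegree\<close> behind the shift is available only for
    \<open>F \<noteq> 0\<close>.\<close>
  moreover have "d has_fps_expansion 0" if "F = 0"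
  proof -
    have "\<forall>\<^sub>F t in nhds 0. f t - g t = 0"
      using fF that by (auto simp: has_fps_expansion_def elim: eventually_mono)
    then have "\<forall>\<^sub>F t in nhds 0. d t = 0"
      by eventually_elim (simp add: d_def that)
    then show ?thesis by (auto simp: has_fps_expansion_def elim: eventually_mono)
  qed
  ultimately obtain D where "d has_fps_expansion D" by blast
  from has_fps_expansion_imp_holomorphic[OF this]
  obtain s where s: "open s" "0 \<in> s" "d holomorphic_on s" by metis
  then obtain r where "0 < r" "ball 0 r \<subseteq> s" by (metis open_contains_ball)
  moreover have "f t = g t + t ^ Suc k * d t" for t
    using eq[of 0] by (auto simp: d_def)
  ultimately show thesis
    by (intro that[of r d] holomorphic_on_subset[OF s(3)])
qed

text \<open>Open sets of \<open>cspace n\<close> are open only relative to the extensional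
  functions. As all values of \<open>g\<close> are extensional, an open set of the full function
  space with the same trace can be pulled back instead.\<close>

lemma continuous_on_openin_preimage_nbhd:
  fixes g :: "'x::topological_space \<Rightarrow> nat \<Rightarrow> complex"
  assumes \<Omega>: "openin (cspace n) \<Omega>" and S: "open S" "x \<in> S"
    and g: "continuous_on S g" "\<And>y. y \<in> S \<Longrightarrow> g y \<in> extensional {..<n}" "g x \<in> \<Omega>"
  obtains N where "open N" "x \<in> N" "N \<subseteq> S" "g ` N \<subseteq> \<Omega>"
proof -
  obtain O' where O: "open O'" "\<Omega> = extensional {..<n} \<inter> O'"
    using \<Omega> by (auto simp: cspace_eq openin_open)
  have "open (S \<inter> g -` O')"
    by (rule continuous_open_preimage[OF g(1) S(1) O(1)])
  then show thesis
    by (rule that) (use S g O in auto)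
qed

text \<open>Two curves with the same \<open>k\<close>-jet are joined by the family \<open>w t + u * d t\<close>, where the parameter
  \<open>u = t ^ (k + 1)\<close> yields the first curve and \<open>u = 0\<close> the second.\<close>

lemma higher_deriv_compose_curve_cong:
  assumes \<Omega>: "openin (cspace n) \<Omega>" and F: "holomorphic_several n \<Omega> F"
    and S: "open S" "0 \<in> S"
    and z: "\<And>t. t \<in> S \<Longrightarrow> z t \<in> \<Omega>" "\<And>i. i < n \<Longrightarrow> (\<lambda>t. z t i) holomorphic_on S"
    and w: "\<And>t. t \<in> S \<Longrightarrow> w t \<in> \<Omega>" "\<And>i. i < n \<Longrightarrow> (\<lambda>t. w t i) holomorphic_on S"
    and eq: "\<And>i q. i < n \<Longrightarrow> q \<le> k \<Longrightarrow> (deriv ^^ q) (\<lambda>t. z t i) 0 = (deriv ^^ q) (\<lambda>t. w t i) 0"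
    and p: "p \<le> k"
  shows "(deriv ^^ p) (\<lambda>t. F (z t)) 0 = (deriv ^^ p) (\<lambda>t. F (w t)) 0"
proof -
  have ext: "\<Omega> \<subseteq> extensional {..<n}" by (rule openin_cspace_subset[OF \<Omega>])
  have "\<exists>d r. 0 < r \<and> d holomorphic_on ball 0 r \<and> (\<forall>t. z t i = w t i + t ^ Suc k * d t)" if "i < n" for i
    using higher_deriv_eq_imp_factor[OF S z(2)[OF that] w(2)[OF that] eq[OF that]] by metis
  then obtain d \<rho> where d: "\<And>i. i < n \<Longrightarrow> 0 < \<rho> i \<and> d i holomorphic_on ball 0 (\<rho> i)"
    and zd: "\<And>i t. i < n \<Longrightarrow> z t i = w t i + t ^ Suc k * d i t"
    by metis
  define T where "T = S \<inter> (\<Inter>i\<in>{..<n}. ball 0 (\<rho> i))"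
  have T: "open T" "0 \<in> T" "T \<subseteq> S" using S d by (auto simp: T_def)
  have dT: "d i holomorphic_on T" if "i < n" for i
    using d[OF that] that by (auto simp: T_def elim!: holomorphic_on_subset)
  have wT: "(\<lambda>t. w t i) holomorphic_on T" if "i < n" for i
    using w(2)[OF that] T(3) by (rule holomorphic_on_subset)
  define g where "g = (\<lambda>(t, u). \<lambda>i\<in>{..<n}. w t i + u * d i t)"
  have gc: "continuous_on (T \<times> UNIV) g"
  proof (rule continuous_on_coordinatewise_then_product)
    fix i
    show "continuous_on (T \<times> UNIV) (\<lambda>x. g x i)"
    proof (cases "i < n")
      case True
      have fst: "continuous_on (T \<times> (UNIV :: complex set)) fst"
        by (rule continuous_on_fst[OF continuous_on_id])
      have "continuous_on (T \<times> (UNIV :: complex set)) (\<lambda>x. w (fst x) i)"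
        by (rule continuous_on_compose2[OF holomorphic_on_imp_continuous_on[OF wT[OF True]] fst]) auto
      moreover have "continuous_on (T \<times> (UNIV :: complex set)) (\<lambda>x. d i (fst x))"
        by (rule continuous_on_compose2[OF holomorphic_on_imp_continuous_on[OF dT[OF True]] fst]) auto
      ultimately have "continuous_on (T \<times> UNIV) (\<lambda>x. w (fst x) i + snd x * d i (fst x))"
        by (intro continuous_on_add continuous_on_mult continuous_on_snd[OF continuous_on_id])
      then show ?thesis using True by (simp add: g_def case_prod_unfold)
    qed (simp add: g_def case_prod_unfold)
  qed
  have wz: "w t \<in> extensional {..<n}" "z t \<in> extensional {..<n}" if "t \<in> T" for t
    using w(1) z(1) that T(3) ext by blast+
  have g0: "g (t, 0) = w t" if "t \<in> T" for t
    using wz(1)[OF that] by (auto simp: g_def fun_eq_iff extensional_def)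
  have gz: "g (t, t ^ Suc k) = z t" if "t \<in> T" for t
    using wz(2)[OF that] zd by (auto simp: g_def fun_eq_iff extensional_def)
  have 1: "open (T \<times> UNIV)" "(0, 0) \<in> T \<times> UNIV" using T by (auto intro: open_Times)
  have 2: "g y \<in> extensional {..<n}" for y
    by (auto simp: g_def case_prod_unfold)
  have 3: "g (0, 0) \<in> \<Omega>" using g0[OF T(2)] w(1) S(2) by simp
  obtain N where N: "open N" "(0, 0) \<in> N" "N \<subseteq> T \<times> UNIV" "g ` N \<subseteq> \<Omega>"
    by (rule continuous_on_openin_preimage_nbhd[OF \<Omega> 1 gc 2 3])
  obtain A B where AB: "open A" "open B" "0 \<in> A" "0 \<in> B" "A \<times> B \<subseteq> N"
    using open_prod_elim[OF N(1,2)] by (metis mem_Sigma_iff)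
  obtain e1 e2 where e: "0 < e1" "cball 0 e1 \<subseteq> A" "0 < e2" "cball 0 e2 \<subseteq> B"
    using AB by (meson open_contains_cball)
  \<comment> \<open>With radius at most 1, \<open>t ^ Suc k\<close> is no larger than
    \<open>t\<close> in norm, so the parameter value that gives the first curve stays in the disc
    where the family is controlled.\<close>
  define r where "r = Min {e1, e2, 1}"
  have r: "0 < r" "r \<le> 1" using e by (auto simp: r_def)
  have mem: "g (t, u) \<in> \<Omega>" "t \<in> T" if "t \<in> cball 0 r" "u \<in> cball 0 r" for t u
  proof -
    have "(t, u) \<in> A \<times> B" using that e by (auto simp: r_def)
    then show "g (t, u) \<in> \<Omega>" "t \<in> T" using AB N by blast+
  qed
  define G where "G t u = F (g (t, u))" for t u
  have "continuous_on (cball 0 r \<times> cball 0 r) (\<lambda>x. F (g x))"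
  proof (rule continuous_on_compose2[where g = F and f = g])
    show "continuous_on \<Omega> F" using F unfolding holomorphic_several_iff[OF ext] by blast
    show "continuous_on (cball 0 r \<times> cball 0 r) g"
      using mem(2) by (intro continuous_on_subset[OF gc]) (use r in force)
  qed (use mem in auto)
  then have "compact ((\<lambda>x. F (g x)) ` (cball 0 r \<times> cball 0 r))"
    by (intro compact_continuous_image compact_Times) auto
  from compact_imp_bounded[OF this]
  obtain M where "\<forall>x\<in>cball 0 r \<times> cball 0 r. norm (F (g x)) \<le> M"
    unfolding bounded_iff by auto
  then have M: "norm (G t u) \<le> M" if "t \<in> cball 0 r" "u \<in> cball 0 r" for t u
    using that unfolding G_def by blast
  have Gu: "G t holomorphic_on ball 0 r" if "t \<in> cball 0 r" for t
    unfolding G_def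
  proof (rule holomorphic_several_compose_curve[OF \<Omega> F open_ball])
    show "g (t, u) \<in> \<Omega>" if "u \<in> ball 0 r" for u
      using mem(1)[of t u] \<open>t \<in> cball 0 r\<close> that by simp
    show "(\<lambda>u. g (t, u) i) holomorphic_on ball 0 r" if "i < n" for i
      using that by (auto simp: g_def intro!: holomorphic_intros)
  qed
  \<comment> \<open>Cauchy's bound for the derivative in \<open>u\<close> at a point of the disc of
    radius \<open>r / 2\<close>, obtained from the bound \<open>M\<close> on the disc of radius
    \<open>r\<close>. It does not depend on \<open>t\<close>, which makes the Lipschitz estimate
    uniform.\<close>
  define C where "C = M / (r / 2)"
  have lip: "norm (G t u - G t 0) \<le> C * norm (u - 0)" if t: "t \<in> cball 0 r" and u: "u \<in> ball 0 (r / 2)" for t u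
  proof (rule field_differentiable_bound[where S = "ball 0 (r / 2)" and f' = "deriv (G t)"])
    fix v :: complex assume v: "v \<in> ball 0 (r / 2)"
    then have vr: "v \<in> ball 0 r" using r by auto
    show "(G t has_field_derivative deriv (G t) v) (at v within ball 0 (r / 2))"
      using holomorphic_derivI[OF Gu[OF t] open_ball vr] by (rule DERIV_subset) auto
    have "norm ((deriv ^^ 1) (G t) v) \<le> fact 1 * M / (r / 2) ^ 1"
    proof (rule Cauchy_inequality)
      have sub: "cball v (r / 2) \<subseteq> ball 0 r"
      proof
        fix y assume "y \<in> cball v (r / 2)"
        then have "norm (y - v) \<le> r / 2" by (simp add: dist_norm norm_minus_commute)
        then show "y \<in> ball 0 r" using v norm_triangle_sub[of y v] by simp
      qed
      then show "G t holomorphic_on ball v (r / 2)" "continuous_on (cball v (r / 2)) (G t)"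
        using holomorphic_on_subset[OF Gu[OF t] sub] ball_subset_cball[of v "r / 2"]
        by (blast intro: holomorphic_on_subset holomorphic_on_imp_continuous_on)+
      show "norm (G t y) \<le> M" if "norm (v - y) = r / 2" for y
        using subsetD[OF sub, of y] that M[OF t, of y] by (simp add: dist_norm)
    qed (use r in auto)
    then show "norm (deriv (G t) v) \<le> C" by (simp add: C_def)
  qed (use r u in auto)
  define r' where "r' = r / 2"
  have r': "0 < r'" "r' \<le> 1/2" "r' < r" using r by (auto simp: r'_def)
  have small: "t \<in> T" "t \<in> S" "t \<in> cball 0 r" if "t \<in> ball 0 r'" for t
    using mem(2)[of t 0] that r r' T(3) by auto
  have "(\<lambda>t. F (z t)) holomorphic_on ball 0 r'" "(\<lambda>t. F (w t)) holomorphic_on ball 0 r'"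
    using small(2) z(1) w(1)
    by (intro holomorphic_several_compose_curve[OF \<Omega> F open_ball]
        holomorphic_on_subset[OF z(2)] holomorphic_on_subset[OF w(2)]; blast)+
  note hol = this
  have "(deriv ^^ p) (\<lambda>t. F (z t) - F (w t)) 0 = 0"
  proof (rule higher_deriv_eq_0_of_bound[OF r'(1) _ _ p, where C = C])
    show "(\<lambda>t. F (z t) - F (w t)) holomorphic_on ball 0 r'" using hol by (intro holomorphic_intros)
    fix t :: complex assume t: "t \<in> ball 0 r'"
    have "norm t ^ Suc k \<le> norm t"
      using t r' power_decreasing[of 1 "Suc k" "norm t"] by auto
    then have "norm (t ^ Suc k) < r'"
      using t by (simp only: norm_power) simp
    then have "t ^ Suc k \<in> ball 0 (r / 2)"
      by (simp add: r'_def)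
    \<comment> \<open>At \<open>u = t ^ Suc k\<close> the Lipschitz estimate in \<open>u\<close>
      becomes a bound of order \<open>k + 1\<close> in \<open>t\<close>.\<close>
    from lip[OF small(3)[OF t] this]
    show "norm (F (z t) - F (w t)) \<le> C * norm t ^ Suc k"
      unfolding G_def gz[OF small(1)[OF t]] g0[OF small(1)[OF t]] by (simp add: norm_mult norm_power)
  qed
  moreover have "(deriv ^^ p) (\<lambda>t. F (z t) - F (w t)) 0
      = (deriv ^^ p) (\<lambda>t. F (z t)) 0 - (deriv ^^ p) (\<lambda>t. F (w t)) 0"
    using hol r'(1) by (intro higher_deriv_diff[of _ "ball 0 r'"]) auto
  ultimately show ?thesis by simp
qed

section \<open>Polynomial curves with prescribed jet coordinates\<close>

text \<open>The index \<open>q * n + i\<close> follows the layout of \<open>jet_coords\<close>. The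
  numbers \<open>c\<close> are derivatives and not Taylor coefficients, whence the division by
  \<open>fact q\<close>.\<close>

definition taylor_curve :: "nat \<Rightarrow> nat \<Rightarrow> (nat \<Rightarrow> complex) \<Rightarrow> complex \<Rightarrow> nat \<Rightarrow> complex" where
  "taylor_curve n k c t = (\<lambda>i\<in>{..<n}. \<Sum>q\<le>k. c (q * n + i) / fact q * t ^ q)"

lemma taylor_curve_extensional: "taylor_curve n k c t \<in> extensional {..<n}"
  by (simp add: taylor_curve_def)

lemma taylor_curve_0: "taylor_curve n k c 0 = restrict c {..<n}"
  by (auto simp: taylor_curve_def fun_eq_iff power_0_left if_distrib sum.delta cong: if_cong)

lemma holomorphic_on_taylor_curve: "i < n \<Longrightarrow> (\<lambda>t. taylor_curve n k c t i) holomorphic_on S"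
  by (auto simp: taylor_curve_def intro!: holomorphic_intros)

lemma holomorphic_on_taylor_curve_coeff:
  assumes "i < n"
  shows "(\<lambda>w. taylor_curve n k (c(m := w)) t i) holomorphic_on S"
proof -
  have "(\<lambda>w. (c(m := w)) l) holomorphic_on S" for l
    by (cases "l = m") auto
  then show ?thesis
    using assms unfolding taylor_curve_def by (simp del: fun_upd_apply) (intro holomorphic_intros; simp)
qed

lemma higher_deriv_taylor_curve:
  assumes "i < n" "q \<le> k"
  shows "(deriv ^^ q) (\<lambda>t. taylor_curve n k c t i) 0 = c (q * n + i)"
proof -
  let ?F = "\<Sum>q\<le>k. fps_const (c (q * n + i) / fact q) * fps_X ^ q"
  have "(\<lambda>t. taylor_curve n k c t i) has_fps_expansion ?F"
    using assms(1) unfolding taylor_curve_def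
    by (simp del: times_divide_eq_left, intro fps_expansion_intros)
  then have "fps_nth ?F q = (deriv ^^ q) (\<lambda>t. taylor_curve n k c t i) 0 / fact q"
    by (rule fps_nth_fps_expansion)
  moreover have "fps_nth ?F q = c (q * n + i) / fact q"
    using assms(2) by (simp add: fps_sum_nth fps_X_power_nth if_distrib sum.delta cong: if_cong)
  ultimately show ?thesis by simp
qed

lemma continuous_on_taylor_curve: "continuous_on A (\<lambda>x. taylor_curve n k (fst x) (snd x))"
proof (rule continuous_on_coordinatewise_then_product)
  fix i
  have c: "continuous_on A (\<lambda>x. fst x j)" for j
    by (rule continuous_on_compose2[OF continuous_on_product_coordinates continuous_on_fst[OF continuous_on_id]]) auto
  show "continuous_on A (\<lambda>x. taylor_curve n k (fst x) (snd x) i)"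
  proof (cases "i < n")
    case True
    then show ?thesis
      unfolding taylor_curve_def
      by (simp, intro continuous_on_sum continuous_on_mult continuous_on_divide continuous_on_power c
          continuous_on_const continuous_on_snd[OF continuous_on_id]) auto
  qed (simp add: taylor_curve_def)
qed

text \<open>By joint continuity, one disc in \<open>t\<close> serves all coefficient vectors near a
  given one, so Cauchy's formula for the derivative at 0 uses a common circle, and the two lemmas on
  derivatives with parameters apply. The domain restrains only the constant terms, which form the
  value of the curve at 0.\<close>

lemma holomorphic_several_higher_deriv_taylor_curve:
  assumes \<Omega>: "openin (cspace n) \<Omega>" and F: "holomorphic_several n \<Omega> F"
  shows "holomorphic_several (n * (k + 1)) {c \<in> extensional {..<n * (k + 1)}. restrict c {..<n} \<in> \<Omega>}
    (\<lambda>c. (deriv ^^ p) (\<lambda>t. F (taylor_curve n k c t)) 0)"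
proof -
  let ?\<Omega> = "{c \<in> extensional {..<n * (k + 1)}. restrict c {..<n} \<in> \<Omega>}"
  let ?\<Phi> = "\<lambda>c. (deriv ^^ p) (\<lambda>t. F (taylor_curve n k c t)) 0"
  have ext: "\<Omega> \<subseteq> extensional {..<n}" by (rule openin_cspace_subset[OF \<Omega>])
  have F1: "continuous_on \<Omega> F" using F unfolding holomorphic_several_iff[OF ext] by blast
  have loc: "\<exists>A r. open A \<and> c0 \<in> A \<and> 0 < r \<and> (\<forall>c\<in>A. \<forall>t\<in>cball 0 r. taylor_curve n k c t \<in> \<Omega>)"
    if c0: "c0 \<in> ?\<Omega>" for c0
  proof -
    have t0: "taylor_curve n k (fst (c0, 0)) (snd (c0, 0)) \<in> \<Omega>"
      using c0 by (simp add: taylor_curve_0)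
    obtain N where N: "open N" "(c0, 0) \<in> N" "(\<lambda>x. taylor_curve n k (fst x) (snd x)) ` N \<subseteq> \<Omega>"
      by (rule continuous_on_openin_preimage_nbhd[OF \<Omega> open_UNIV UNIV_I
            continuous_on_taylor_curve taylor_curve_extensional t0])
    obtain A B where AB: "open A" "open B" "(c0, 0) \<in> A \<times> B" "A \<times> B \<subseteq> N"
      by (rule open_prod_elim[OF N(1,2)])
    obtain r where r: "0 < r" "cball 0 r \<subseteq> B"
      using AB(2,3) unfolding open_contains_cball by auto
    have "taylor_curve n k c t \<in> \<Omega>" if "c \<in> A" "t \<in> cball 0 r" for c t
    proof -
      have "(c, t) \<in> N" using AB(4) r that by blast
      from imageI[OF this, of "\<lambda>x. taylor_curve n k (fst x) (snd x)"] N(3) show ?thesis by auto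
    qed
    then have "\<forall>c\<in>A. \<forall>t\<in>cball 0 r. taylor_curve n k c t \<in> \<Omega>" by blast
    moreover have "c0 \<in> A" using AB(3) by simp
    ultimately show ?thesis using AB(1) r(1) by blast
  qed
  have holt: "(\<lambda>t. F (taylor_curve n k c t)) holomorphic_on ball 0 r"
    if "\<forall>t\<in>cball 0 r. taylor_curve n k c t \<in> \<Omega>" for c r
    by (rule holomorphic_several_compose_curve[OF \<Omega> F open_ball])
      (use that in \<open>auto intro: holomorphic_on_taylor_curve\<close>)
  have contF: "continuous_on (A \<times> cball 0 r) (\<lambda>x. F (taylor_curve n k (fst x) (snd x)))"
    if "\<forall>c\<in>A. \<forall>t\<in>cball 0 r. taylor_curve n k c t \<in> \<Omega>" for A r
    by (rule continuous_on_compose2[OF F1 continuous_on_taylor_curve]) (use that in auto)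
  have "continuous_on ?\<Omega> ?\<Phi>"
    unfolding continuous_on_eq_continuous_within
  proof
    fix c0 assume "c0 \<in> ?\<Omega>"
    from loc[OF this] obtain A r where A: "open A" "c0 \<in> A" and r: "0 < r"
      and mem: "\<forall>c\<in>A. \<forall>t\<in>cball 0 r. taylor_curve n k c t \<in> \<Omega>" by blast
    have "continuous_on A ?\<Phi>"
      by (rule continuous_on_higher_deriv_parameter[OF r])
        (use contF[OF mem] holt mem in \<open>auto simp: case_prod_unfold\<close>)
    then have "isCont ?\<Phi> c0" using A by (simp add: continuous_on_eq_continuous_at)
    then show "continuous (at c0 within ?\<Omega>) ?\<Phi>" by (rule continuous_at_imp_continuous_within)
  qed
  moreover have "(\<lambda>w. ?\<Phi> (c(m := w))) holomorphic_on {w. c(m := w) \<in> ?\<Omega>}" for c m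
    unfolding holomorphic_on_def
  proof
    fix w0 assume "w0 \<in> {w. c(m := w) \<in> ?\<Omega>}"
    then have "c(m := w0) \<in> ?\<Omega>" by blast
    from loc[OF this] obtain A r where A: "open A" "c(m := w0) \<in> A" and r: "0 < r"
      and mem: "\<forall>c\<in>A. \<forall>t\<in>cball 0 r. taylor_curve n k c t \<in> \<Omega>" by blast
    have upd: "continuous_on UNIV (\<lambda>w. c(m := w))"
    proof (rule continuous_on_coordinatewise_then_product)
      show "continuous_on UNIV (\<lambda>w. (c(m := w)) l)" for l by (cases "l = m") auto
    qed
    define S where "S = (\<lambda>w. c(m := w)) -` A"
    have S: "open S" unfolding S_def by (rule open_vimage[OF A(1) upd])
    have "(\<lambda>w. ?\<Phi> (c(m := w))) holomorphic_on S"
    proof (rule holomorphic_on_higher_deriv_parameter[OF S r])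
      have "continuous_on (S \<times> cball 0 r) (\<lambda>x. (c(m := fst x), snd x))"
        by (intro continuous_on_Pair continuous_on_compose2[OF upd continuous_on_fst[OF continuous_on_id]]
            continuous_on_snd[OF continuous_on_id]) auto
      moreover have "(\<lambda>x. (c(m := fst x), snd x)) ` (S \<times> cball 0 r) \<subseteq> A \<times> cball 0 r"
        by (auto simp: S_def)
      ultimately show "continuous_on (S \<times> cball 0 r) (\<lambda>(w, t). F (taylor_curve n k (c(m := w)) t))"
        using continuous_on_compose2[OF contF[OF mem]] by (fastforce simp: case_prod_unfold)
      \<comment> \<open>With \<open>t\<close> fixed, the coefficient \<open>w\<close> becomes the
        parameter of a curve whose components are affine in \<open>w\<close>.\<close>
      show "(\<lambda>w. F (taylor_curve n k (c(m := w)) t)) holomorphic_on S" if "t \<in> cball 0 r" for t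
        by (rule holomorphic_several_compose_curve[OF \<Omega> F S])
          (use that mem in \<open>auto simp: S_def intro: holomorphic_on_taylor_curve_coeff\<close>)
      show "(\<lambda>t. F (taylor_curve n k (c(m := w)) t)) holomorphic_on ball 0 r" if "w \<in> S" for w
        by (rule holt) (use that mem in \<open>auto simp: S_def\<close>)
    qed
    moreover have "w0 \<in> S" using A by (simp add: S_def)
    ultimately show "(\<lambda>w. ?\<Phi> (c(m := w))) field_differentiable at w0 within {w. c(m := w) \<in> ?\<Omega>}"
      using S holomorphic_on_imp_differentiable_at field_differentiable_at_within by blast
  qed
  ultimately show ?thesis
    by (subst holomorphic_several_iff) auto
qed

section \<open>Holomorphic functions in charts\<close>

lemma holomorphic_several_alt:
  "holomorphic_several n \<Omega> f \<longleftrightarrow> continuous_on (extensional {..<n} \<inter> \<Omega>) f \<and>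
    (\<forall>z\<in>\<Omega>. \<forall>i<n. (\<lambda>w. f (z(i := w))) holomorphic_on {w. z(i := w) \<in> \<Omega>})"
  by (simp add: holomorphic_several_def cspace_eq subtopology_subtopology)

lemma holomorphic_several_subset:
  assumes "holomorphic_several n \<Omega> f" "\<Omega>' \<subseteq> \<Omega>"
  shows "holomorphic_several n \<Omega>' f"
  unfolding holomorphic_several_alt
proof (intro conjI ballI allI impI)
  show "continuous_on (extensional {..<n} \<inter> \<Omega>') f"
    using assms unfolding holomorphic_several_alt by (blast intro: continuous_on_subset)
  fix z i assume z: "z \<in> \<Omega>'" and i: "i < n"
  have "(\<lambda>w. f (z(i := w))) holomorphic_on {w. z(i := w) \<in> \<Omega>}"
    using assms z i unfolding holomorphic_several_alt by blast
  then show "(\<lambda>w. f (z(i := w))) holomorphic_on {w. z(i := w) \<in> \<Omega>'}"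
    by (rule holomorphic_on_subset) (use assms(2) in auto)
qed

lemma holomorphic_several_eq:
  assumes f: "holomorphic_several n \<Omega> f" and eq: "\<And>z. z \<in> \<Omega> \<Longrightarrow> f z = g z"
  shows "holomorphic_several n \<Omega> g"
  unfolding holomorphic_several_alt
proof (intro conjI ballI allI impI)
  show "continuous_on (extensional {..<n} \<inter> \<Omega>) g"
    using f unfolding holomorphic_several_alt by (auto simp: eq intro: continuous_on_eq)
  fix z i assume z: "z \<in> \<Omega>" and i: "i < n"
  then have "(\<lambda>w. f (z(i := w))) holomorphic_on {w. z(i := w) \<in> \<Omega>}"
    using f unfolding holomorphic_several_alt by blast
  then show "(\<lambda>w. g (z(i := w))) holomorphic_on {w. z(i := w) \<in> \<Omega>}"
    by (rule holomorphic_transform) (simp add: eq)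
qed

lemma holomorphic_several_const: "holomorphic_several n \<Omega> (\<lambda>z. c)"
  unfolding holomorphic_several_alt by simp

lemma holomorphic_several_add:
  "holomorphic_several n \<Omega> f \<Longrightarrow> holomorphic_several n \<Omega> g \<Longrightarrow> holomorphic_several n \<Omega> (\<lambda>z. f z + g z)"
  unfolding holomorphic_several_alt by (simp add: continuous_on_add holomorphic_on_add)

lemma holomorphic_several_mult:
  "holomorphic_several n \<Omega> f \<Longrightarrow> holomorphic_several n \<Omega> g \<Longrightarrow> holomorphic_several n \<Omega> (\<lambda>z. f z * g z)"
  unfolding holomorphic_several_alt by (simp add: continuous_on_mult holomorphic_on_mult)

lemma holomorphic_several_inverse:
  "holomorphic_several n \<Omega> f \<Longrightarrow> (\<And>z. z \<in> \<Omega> \<Longrightarrow> f z \<noteq> 0) \<Longrightarrow> holomorphic_several n \<Omega> (\<lambda>z. inverse (f z))"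
  unfolding holomorphic_several_alt by (auto intro!: continuous_on_inverse holomorphic_on_inverse)

text \<open>Both halves of the definition are local: continuity at a point sees only a neighbourhood
  of it, and a line in a coordinate direction meets an open set in an open set of
  parameters.\<close>

lemma holomorphic_several_local:
  assumes \<Omega>: "\<Omega> \<subseteq> extensional {..<n}"
    and loc: "\<And>z. z \<in> \<Omega> \<Longrightarrow> \<exists>U. openin (cspace n) U \<and> z \<in> U \<and> holomorphic_several n (\<Omega> \<inter> U) f"
  shows "holomorphic_several n \<Omega> f"
  unfolding holomorphic_several_iff[OF \<Omega>]
proof (intro conjI ballI allI impI)
  have loc': "\<exists>O'. open O' \<and> z \<in> O' \<and> holomorphic_several n (\<Omega> \<inter> O') f" if z: "z \<in> \<Omega>" for z
  proof -
    obtain U where U: "openin (cspace n) U" "z \<in> U" "holomorphic_several n (\<Omega> \<inter> U) f"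
      using loc[OF z] by blast
    then obtain O' where O': "open O'" "U = extensional {..<n} \<inter> O'"
      by (auto simp: cspace_eq openin_open)
    then have "\<Omega> \<inter> U = \<Omega> \<inter> O'" using \<Omega> by blast
    then show ?thesis using U O' by auto
  qed
  show "continuous_on \<Omega> f"
    unfolding continuous_on_eq_continuous_within
  proof
    fix z assume z: "z \<in> \<Omega>"
    then obtain O' where O': "open O'" "z \<in> O'" "holomorphic_several n (\<Omega> \<inter> O') f"
      using loc' by blast
    have "continuous_on (\<Omega> \<inter> O') f"
      using O'(3) holomorphic_several_iff[of "\<Omega> \<inter> O'" n f] \<Omega> by blast
    then have "continuous (at z within \<Omega> \<inter> O') f"
      using z O'(2) by (simp add: continuous_on_eq_continuous_within)
    moreover have "at z within \<Omega> \<inter> O' = at z within \<Omega>"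
      by (rule at_within_nhd[OF O'(2,1)]) auto
    ultimately show "continuous (at z within \<Omega>) f" by simp
  qed
  fix z i assume i: "i < n"
  show "(\<lambda>w. f (z(i := w))) holomorphic_on {w. z(i := w) \<in> \<Omega>}"
    unfolding holomorphic_on_def
  proof
    fix w0 assume "w0 \<in> {w. z(i := w) \<in> \<Omega>}"
    then have w0: "z(i := w0) \<in> \<Omega>" by simp
    then obtain O' where O': "open O'" "z(i := w0) \<in> O'" "holomorphic_several n (\<Omega> \<inter> O') f"
      using loc' by blast
    \<comment> \<open>The local hypothesis lives near \<open>z(i := w0)\<close>, so this point
      serves as base point of the line; the two updates at \<open>i\<close> collapse into
      one.\<close>
    have "(\<lambda>w. f ((z(i := w0))(i := w))) holomorphic_on {w. (z(i := w0))(i := w) \<in> \<Omega> \<inter> O'}"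
      using O'(2,3) w0 i unfolding holomorphic_several_alt by blast
    then have "(\<lambda>w. f (z(i := w))) field_differentiable (at w0 within {w. z(i := w) \<in> \<Omega> \<inter> O'})"
      using w0 O'(2) unfolding holomorphic_on_def by simp
    moreover have "at w0 within {w. z(i := w) \<in> \<Omega> \<inter> O'} = at w0 within {w. z(i := w) \<in> \<Omega>}"
    proof (rule at_within_nhd)
      have "continuous_on UNIV (\<lambda>w. z(i := w))"
      proof (rule continuous_on_coordinatewise_then_product)
        show "continuous_on UNIV (\<lambda>w. (z(i := w)) l)" for l by (cases "l = i") auto
      qed
      then show "open ((\<lambda>w. z(i := w)) -` O')" by (rule open_vimage[OF O'(1)])
      show "w0 \<in> (\<lambda>w. z(i := w)) -` O'" using O'(2) by simp
    qed auto
    ultimately show "(\<lambda>w. f (z(i := w))) field_differentiable (at w0 within {w. z(i := w) \<in> \<Omega>})"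
      by simp
  qed
qed

text \<open>If a chart is not injective on its domain, the inverse used in \<open>hol_functions\<close> may leave \<open>S\<close>.\<close>

definition chart_saturated :: "'a chart set \<Rightarrow> 'a set \<Rightarrow> bool" where
  "chart_saturated A S \<longleftrightarrow> (\<forall>(V, \<phi>)\<in>A. \<forall>x\<in>S \<inter> V. inv_into V \<phi> (\<phi> x) \<in> S)"

lemma hol_functionsI:
  assumes "f \<in> extensional S"
    "\<And>V \<phi>. (V, \<phi>) \<in> A \<Longrightarrow> holomorphic_several n (\<phi> ` (S \<inter> V)) (f \<circ> inv_into V \<phi>)"
  shows "f \<in> hol_functions n A S"
  using assms by (auto simp: hol_functions_def)

lemma hol_functionsD:
  assumes "f \<in> hol_functions n A S" "(V, \<phi>) \<in> A"
  shows "holomorphic_several n (\<phi> ` (S \<inter> V)) (f \<circ> inv_into V \<phi>)"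
  using assms by (auto simp: hol_functions_def)

lemma chart_saturatedD:
  "chart_saturated A S \<Longrightarrow> (V, \<phi>) \<in> A \<Longrightarrow> z \<in> \<phi> ` (S \<inter> V) \<Longrightarrow> inv_into V \<phi> z \<in> S"
  by (auto simp: chart_saturated_def)

text \<open>Saturation keeps \<open>inv_into V \<phi>\<close> inside \<open>S\<close>, where
  \<open>restrict f S\<close> still has the values of \<open>f\<close>; elsewhere it would be
  \<open>undefined\<close>.\<close>

lemma hol_functions_restrictI:
  assumes S: "chart_saturated A S"
    and f: "\<And>V \<phi>. (V, \<phi>) \<in> A \<Longrightarrow> holomorphic_several n (\<phi> ` (S \<inter> V)) (\<lambda>z. f (inv_into V \<phi> z))"
  shows "restrict f S \<in> hol_functions n A S"
proof (rule hol_functionsI)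
  fix V \<phi> assume A: "(V, \<phi>) \<in> A"
  show "holomorphic_several n (\<phi> ` (S \<inter> V)) (restrict f S \<circ> inv_into V \<phi>)"
    by (rule holomorphic_several_eq[OF f[OF A]]) (simp add: chart_saturatedD[OF S A])
qed simp

lemma hol_functions_restrict:
  assumes "f \<in> hol_functions n A S" "T \<subseteq> S" "chart_saturated A T"
  shows "restrict f T \<in> hol_functions n A T"
proof (rule hol_functions_restrictI[OF assms(3)])
  fix V \<phi> assume "(V, \<phi>) \<in> A"
  from hol_functionsD[OF assms(1) this] show "holomorphic_several n (\<phi> ` (T \<inter> V)) (\<lambda>z. f (inv_into V \<phi> z))"
    unfolding o_def by (rule holomorphic_several_subset) (use assms(2) in auto)
qed

lemma hol_functions_const: "chart_saturated A S \<Longrightarrow> (\<lambda>x\<in>S. c) \<in> hol_functions n A S"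
  by (rule hol_functions_restrictI) (auto intro: holomorphic_several_const)

lemma hol_functions_add:
  assumes "chart_saturated A S" "f \<in> hol_functions n A S" "g \<in> hol_functions n A S"
  shows "(\<lambda>x\<in>S. f x + g x) \<in> hol_functions n A S"
  using hol_functionsD[OF assms(2)] hol_functionsD[OF assms(3)] unfolding o_def
  by (intro hol_functions_restrictI[OF assms(1)] holomorphic_several_add)

lemma hol_functions_mult:
  assumes "chart_saturated A S" "f \<in> hol_functions n A S" "g \<in> hol_functions n A S"
  shows "(\<lambda>x\<in>S. f x * g x) \<in> hol_functions n A S"
  using hol_functionsD[OF assms(2)] hol_functionsD[OF assms(3)] unfolding o_def
  by (intro hol_functions_restrictI[OF assms(1)] holomorphic_several_mult)

lemma hol_functions_inverse:
  assumes "chart_saturated A S" "f \<in> hol_functions n A S" "\<And>x. x \<in> S \<Longrightarrow> f x \<noteq> 0"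
  shows "(\<lambda>x\<in>S. inverse (f x)) \<in> hol_functions n A S"
proof (rule hol_functions_restrictI[OF assms(1)])
  fix V \<phi> assume A: "(V, \<phi>) \<in> A"
  from hol_functionsD[OF assms(2) A]
  show "holomorphic_several n (\<phi> ` (S \<inter> V)) (\<lambda>z. inverse (f (inv_into V \<phi> z)))"
    unfolding o_def
    by (rule holomorphic_several_inverse) (use chart_saturatedD[OF assms(1) A] assms(3) in blast)
qed

lemma hol_functions_sum:
  assumes S: "chart_saturated A S" and f: "\<And>i. i \<in> I \<Longrightarrow> (\<lambda>x\<in>S. f i x) \<in> hol_functions n A S"
  shows "(\<lambda>x\<in>S. \<Sum>i\<in>I. f i x) \<in> hol_functions n A S"
  using f
proof (induction I rule: infinite_finite_induct)
  case (insert i I)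
  have "(\<lambda>x\<in>S. (\<lambda>x\<in>S. f i x) x + (\<lambda>x\<in>S. \<Sum>i\<in>I. f i x) x) \<in> hol_functions n A S"
    using insert by (intro hol_functions_add[OF S]) auto
  also have "(\<lambda>x\<in>S. (\<lambda>x\<in>S. f i x) x + (\<lambda>x\<in>S. \<Sum>i\<in>I. f i x) x) = (\<lambda>x\<in>S. \<Sum>i\<in>insert i I. f i x)"
    using insert.hyps by (auto simp: restrict_def fun_eq_iff)
  finally show ?case .
qed (simp_all add: hol_functions_const[OF S])

lemma hol_functions_prod:
  assumes S: "chart_saturated A S" and f: "\<And>i. i \<in> I \<Longrightarrow> (\<lambda>x\<in>S. f i x) \<in> hol_functions n A S"
  shows "(\<lambda>x\<in>S. \<Prod>i\<in>I. f i x) \<in> hol_functions n A S"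
  using f
proof (induction I rule: infinite_finite_induct)
  case (insert i I)
  have "(\<lambda>x\<in>S. (\<lambda>x\<in>S. f i x) x * (\<lambda>x\<in>S. \<Prod>i\<in>I. f i x) x) \<in> hol_functions n A S"
    using insert by (intro hol_functions_mult[OF S]) auto
  also have "(\<lambda>x\<in>S. (\<lambda>x\<in>S. f i x) x * (\<lambda>x\<in>S. \<Prod>i\<in>I. f i x) x) = (\<lambda>x\<in>S. \<Prod>i\<in>insert i I. f i x)"
    using insert.hyps by (auto simp: restrict_def fun_eq_iff)
  finally show ?case .
qed (simp_all add: hol_functions_const[OF S])

text \<open>By the Leibniz formula the determinant is a polynomial in its entries, and holomorphic
  functions form a ring that contains the constants.\<close>

lemma hol_functions_det:
  assumes S: "chart_saturated A S"
    and f: "\<And>p i. p < m \<Longrightarrow> i < m \<Longrightarrow> (\<lambda>x\<in>S. f p i x) \<in> hol_functions n A S"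
  shows "(\<lambda>x\<in>S. Determinant.det (Matrix.mat m m (\<lambda>(p, i). f p i x))) \<in> hol_functions n A S"
proof -
  have eq: "Determinant.det (Matrix.mat m m (\<lambda>(p, i). f p i x)) =
      (\<Sum>\<pi> | \<pi> permutes {0..<m}. signof \<pi> * (\<Prod>p = 0..<m. f p (\<pi> p) x) :: complex)" for x
  proof -
    have "(\<Prod>p = 0..<m. Matrix.mat m m (\<lambda>(p, i). f p i x) $$ (p, \<pi> p)) = (\<Prod>p = 0..<m. f p (\<pi> p) x)"
      if "\<pi> permutes {0..<m}" for \<pi>
      using permutes_in_image[OF that] by (intro prod.cong) auto
    then show ?thesis by (subst det_def'[of _ m]) auto
  qed
  have "(\<lambda>x\<in>S. signof \<pi> * (\<Prod>p = 0..<m. f p (\<pi> p) x)) \<in> hol_functions n A S"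
    if "\<pi> permutes {0..<m}" for \<pi>
  proof -
    have "(\<lambda>x\<in>S. (\<lambda>x\<in>S. signof \<pi>) x * (\<lambda>x\<in>S. \<Prod>p = 0..<m. f p (\<pi> p) x) x) \<in> hol_functions n A S"
      using permutes_in_image[OF that]
      by (intro hol_functions_mult hol_functions_const hol_functions_prod S f) auto
    also have "(\<lambda>x\<in>S. (\<lambda>x\<in>S. signof \<pi>) x * (\<lambda>x\<in>S. \<Prod>p = 0..<m. f p (\<pi> p) x) x)
        = (\<lambda>x\<in>S. signof \<pi> * (\<Prod>p = 0..<m. f p (\<pi> p) x))"
      by (simp add: restrict_def fun_eq_iff)
    finally show ?thesis .
  qed
  then show ?thesis unfolding eq by (intro hol_functions_sum[OF S]) auto
qed

section \<open>Jets and Wronskians\<close>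

lemma jet_rep_jet:
  assumes "\<gamma> \<in> curve_germs M"
  shows "jet_rep (jet M k \<gamma>) \<in> curve_germs M" "same_jet M k \<gamma> (jet_rep (jet M k \<gamma>))"
proof -
  have "\<gamma> \<in> jet M k \<gamma>" using assms by (auto simp: jet_def same_jet_def)
  then have "jet_rep (jet M k \<gamma>) \<in> jet M k \<gamma>" 
    unfolding jet_rep_def by (rule someI[where P = "\<lambda>\<delta>. \<delta> \<in> jet M k \<gamma>"])
  then show "jet_rep (jet M k \<gamma>) \<in> curve_germs M" "same_jet M k \<gamma> (jet_rep (jet M k \<gamma>))"
    by (auto simp: jet_def)
qed

lemma jet_proj_jet: "\<gamma> \<in> curve_germs M \<Longrightarrow> jet_proj (jet M k \<gamma>) = \<gamma> 0"
  using jet_rep_jet(2)[of \<gamma> M k] by (simp add: jet_proj_def same_jet_def)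

lemma jet_in_jets_over: "\<gamma> \<in> curve_germs M \<Longrightarrow> jet M k \<gamma> \<in> jets_over M k U \<longleftrightarrow> \<gamma> 0 \<in> U"
  by (auto simp: jets_over_def jet_space_def jet_proj_jet)

lemma jets_overD:
  assumes "j \<in> jets_over M k U"
  shows "jet_rep j \<in> curve_germs M" "jet_rep j 0 \<in> U" "jet_proj j \<in> U"
  using assms jet_rep_jet(1) by (auto simp: jets_over_def jet_space_def jet_proj_def)

lemma jets_over_mono: "U \<subseteq> U' \<Longrightarrow> jets_over M k U \<subseteq> jets_over M k U'"
  by (auto simp: jets_over_def)

lemma jets_over_Int: "jets_over M k (U \<inter> U') = jets_over M k U \<inter> jets_over M k U'"
  by (auto simp: jets_over_def)

lemma curve_germ_topspace: "\<gamma> \<in> curve_germs M \<Longrightarrow> \<gamma> 0 \<in> topspace (mtop M)"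
  by (auto simp: curve_germs_def continuous_map_def)

lemma curve_germ_compose:
  assumes \<gamma>: "\<gamma> \<in> curve_germs M" and \<phi>: "\<phi> holomorphic_on UNIV" "\<phi> 0 = 0"
  shows "\<gamma> \<circ> \<phi> \<in> curve_germs M"
proof -
  obtain D where D: "open D" "0 \<in> D" "continuous_map (top_of_set D) (mtop M) \<gamma>"
    and hol: "\<forall>(V, \<psi>)\<in>atlas M. \<forall>i<mdim M. (\<lambda>t. \<psi> (\<gamma> t) i) holomorphic_on {t \<in> D. \<gamma> t \<in> V}"
    using \<gamma> unfolding curve_germs_def by blast
  have cont: "continuous_on UNIV \<phi>" by (rule holomorphic_on_imp_continuous_on[OF \<phi>(1)])
  show ?thesis
    unfolding curve_germs_def
  proof (intro CollectI exI[of _ "\<phi> -` D"] conjI)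
    show "open (\<phi> -` D)" by (rule open_vimage[OF D(1) cont])
    show "0 \<in> \<phi> -` D" using D(2) \<phi>(2) by simp
    have "continuous_map (top_of_set (\<phi> -` D)) (top_of_set D) \<phi>"
      using continuous_on_subset[OF cont] by (auto simp: continuous_map_in_subtopology)
    then show "continuous_map (top_of_set (\<phi> -` D)) (mtop M) (\<gamma> \<circ> \<phi>)"
      using D(3) by (rule continuous_map_compose)
    show "\<forall>(V, \<psi>)\<in>atlas M. \<forall>i<mdim M. (\<lambda>t. \<psi> ((\<gamma> \<circ> \<phi>) t) i) holomorphic_on {t \<in> \<phi> -` D. (\<gamma> \<circ> \<phi>) t \<in> V}"
    proof (safe)
      fix V \<psi> i assume A: "(V, \<psi>) \<in> atlas M" "i < mdim M"
      have "((\<lambda>t. \<psi> (\<gamma> t) i) \<circ> \<phi>) holomorphic_on {t \<in> \<phi> -` D. (\<gamma> \<circ> \<phi>) t \<in> V}"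
        by (rule holomorphic_on_compose_gen[where t = "{t \<in> D. \<gamma> t \<in> V}"])
          (use A hol in \<open>auto intro: holomorphic_on_subset[OF \<phi>(1)]\<close>)
      then show "(\<lambda>t. \<psi> ((\<gamma> \<circ> \<phi>) t) i) holomorphic_on {t \<in> \<phi> -` D. (\<gamma> \<circ> \<phi>) t \<in> V}"
        by (simp add: o_def)
    qed
  qed
qed

section \<open>Functions along curves and in jet coordinates\<close>

context
  fixes M :: "'a manifold"
  assumes M: "complex_manifold M"
begin

lemma atlas_chart:
  assumes "(V, \<phi>) \<in> atlas M"
  shows "openin (mtop M) V" "openin (cspace (mdim M)) (\<phi> ` V)"
    "homeomorphic_map (subtopology (mtop M) V) (subtopology (cspace (mdim M)) (\<phi> ` V)) \<phi>"
  using M assms by (auto simp: complex_manifold_def)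

lemma atlas_inj_on: "(V, \<phi>) \<in> atlas M \<Longrightarrow> inj_on \<phi> V"
  using homeomorphic_imp_injective_map[OF atlas_chart(3)] openin_subset[OF atlas_chart(1)]
  by (simp add: Int_absorb1)

lemma atlas_extensional: "(V, \<phi>) \<in> atlas M \<Longrightarrow> x \<in> V \<Longrightarrow> \<phi> x \<in> extensional {..<mdim M}"
  using openin_cspace_subset[OF atlas_chart(2)] by auto

lemma atlas_image_open:
  assumes "(V, \<phi>) \<in> atlas M" "openin (mtop M) T"
  shows "openin (cspace (mdim M)) (\<phi> ` (T \<inter> V))"
proof -
  have "openin (subtopology (mtop M) V) (T \<inter> V)"
    using assms(2) by (auto simp: openin_subtopology)
  then have "openin (subtopology (cspace (mdim M)) (\<phi> ` V)) (\<phi> ` (T \<inter> V))"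
    using homeomorphic_imp_open_map[OF atlas_chart(3)[OF assms(1)]] by (auto simp: open_map_def)
  then show ?thesis using atlas_chart(2)[OF assms(1)] by (rule openin_trans_full)
qed

lemma atlas_cover: "x \<in> topspace (mtop M) \<Longrightarrow> \<exists>V \<phi>. (V, \<phi>) \<in> atlas M \<and> x \<in> V"
proof -
  assume "x \<in> topspace (mtop M)"
  moreover have "(\<Union>(V, \<phi>)\<in>atlas M. V) = topspace (mtop M)"
    using M unfolding complex_manifold_def by blast
  ultimately have "x \<in> (\<Union>(V, \<phi>)\<in>atlas M. V)" by simp
  then show "\<exists>V \<phi>. (V, \<phi>) \<in> atlas M \<and> x \<in> V" by auto
qed

lemma chart_saturated_atlas: "chart_saturated (atlas M) S"
  unfolding chart_saturated_def using atlas_inj_on by fastforce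

text \<open>A chart maps open sets to open sets and so transports the local criterion of several
  variables to the manifold. It serves to patch coordinates of sections that are known only on the
  overlaps with members of \<open>ltrivs\<close>.\<close>

lemma hol_fun_local:
  assumes ext: "f \<in> extensional S" and S: "S \<subseteq> topspace (mtop M)"
    and loc: "\<And>x. x \<in> S \<Longrightarrow> \<exists>T. openin (mtop M) T \<and> x \<in> T \<and> restrict f (S \<inter> T) \<in> hol_fun M (S \<inter> T)"
  shows "f \<in> hol_fun M S"
  unfolding hol_fun_def
proof (rule hol_functionsI[OF ext])
  fix V \<phi> assume A: "(V, \<phi>) \<in> atlas M"
  have inj: "inj_on \<phi> V" by (rule atlas_inj_on[OF A])
  show "holomorphic_several (mdim M) (\<phi> ` (S \<inter> V)) (f \<circ> inv_into V \<phi>)"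
  proof (rule holomorphic_several_local)
    show "\<phi> ` (S \<inter> V) \<subseteq> extensional {..<mdim M}" using atlas_extensional[OF A] by blast
    fix z assume "z \<in> \<phi> ` (S \<inter> V)"
    then obtain x where x: "x \<in> S" "x \<in> V" "z = \<phi> x" by blast
    obtain T where T: "openin (mtop M) T" "x \<in> T" "restrict f (S \<inter> T) \<in> hol_fun M (S \<inter> T)"
      using loc[OF x(1)] by blast
    have eq: "\<phi> ` (S \<inter> V) \<inter> \<phi> ` (T \<inter> V) = \<phi> ` (S \<inter> T \<inter> V)"
      using inj by (auto simp: inj_on_def)
    have "holomorphic_several (mdim M) (\<phi> ` (S \<inter> T \<inter> V)) (f \<circ> inv_into V \<phi>)"
      by (rule holomorphic_several_eq[OF hol_functionsD[OF T(3)[unfolded hol_fun_def] A]])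
        (use inj in auto)
    then show "\<exists>U. openin (cspace (mdim M)) U \<and> z \<in> U \<and> holomorphic_several (mdim M) (\<phi> ` (S \<inter> V) \<inter> U) (f \<circ> inv_into V \<phi>)"
      using atlas_image_open[OF A T(1)] x T(2) by (intro exI[of _ "\<phi> ` (T \<inter> V)"]) (simp add: eq)
  qed
qed

text \<open>Continuity keeps the curve near its base point, so after shrinking the parameter domain
  it is read in a single chart and stays in \<open>T\<close>.\<close>

lemma curve_germ_chart:
  assumes \<gamma>: "\<gamma> \<in> curve_germs M" and A: "(V, \<phi>) \<in> atlas M"
    and T: "openin (mtop M) T" "\<gamma> 0 \<in> T" "\<gamma> 0 \<in> V"
  obtains N where "open N" "0 \<in> N" "\<And>t. t \<in> N \<Longrightarrow> \<gamma> t \<in> T \<inter> V"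
    "\<And>i. i < mdim M \<Longrightarrow> (\<lambda>t. \<phi> (\<gamma> t) i) holomorphic_on N"
proof -
  obtain D where D: "open D" "0 \<in> D" "continuous_map (top_of_set D) (mtop M) \<gamma>"
    and hol: "\<forall>i<mdim M. (\<lambda>t. \<phi> (\<gamma> t) i) holomorphic_on {t \<in> D. \<gamma> t \<in> V}"
    using \<gamma> A unfolding curve_germs_def by blast
  define N where "N = {t \<in> D. \<gamma> t \<in> T \<inter> V}"
  have "openin (top_of_set D) N"
    using openin_continuous_map_preimage[OF D(3) openin_Int[OF T(1) atlas_chart(1)[OF A]]] by (simp add: N_def)
  then have "open N" using D(1) by (simp add: openin_open_eq)
  moreover have "(\<lambda>t. \<phi> (\<gamma> t) i) holomorphic_on N" if "i < mdim M" for i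
    using hol that by (auto simp: N_def elim!: allE[of _ i] holomorphic_on_subset)
  ultimately show thesis using D T by (intro that[of N]) (auto simp: N_def)
qed

lemma hol_fun_compose_curve_germ:
  assumes \<gamma>: "\<gamma> \<in> curve_germs M" and U: "openin (mtop M) U" "\<gamma> 0 \<in> U" and f: "f \<in> hol_fun M U"
  obtains N where "open N" "0 \<in> N" "(f \<circ> \<gamma>) holomorphic_on N"
proof -
  obtain V \<phi> where A: "(V, \<phi>) \<in> atlas M" "\<gamma> 0 \<in> V"
    using atlas_cover[OF curve_germ_topspace[OF \<gamma>]] by blast
  obtain N where N: "open N" "0 \<in> N" "\<And>t. t \<in> N \<Longrightarrow> \<gamma> t \<in> U \<inter> V"
    "\<And>i. i < mdim M \<Longrightarrow> (\<lambda>t. \<phi> (\<gamma> t) i) holomorphic_on N"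
    by (rule curve_germ_chart[OF \<gamma> A(1) U A(2)]) blast
  have "(\<lambda>t. (f \<circ> inv_into V \<phi>) (\<phi> (\<gamma> t))) holomorphic_on N"
    by (rule holomorphic_several_compose_curve[OF atlas_image_open[OF A(1) U(1)]
          hol_functionsD[OF f[unfolded hol_fun_def] A(1)] N(1)]) (use N(3,4) in auto)
  then have "(f \<circ> \<gamma>) holomorphic_on N"
    by (rule holomorphic_transform) (use N(3) atlas_inj_on[OF A(1)] in auto)
  then show thesis using N that by blast
qed

text \<open>In the chart, the germ and the Taylor curve of \<open>c\<close> have equal derivatives
  up to order \<open>k\<close>. The right-hand side contains the germ only through \<open>c\<close>:
  this yields independence of the representative as well as the expression of the derivative in jet
  coordinates.\<close>

lemma higher_deriv_compose_curve_germ: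
  assumes \<gamma>: "\<gamma> \<in> curve_germs M" and U: "openin (mtop M) U" "\<gamma> 0 \<in> U" and f: "f \<in> hol_fun M U"
    and A: "(V, \<phi>) \<in> atlas M" "\<gamma> 0 \<in> V" and p: "p \<le> k"
    and c: "\<And>i q. i < mdim M \<Longrightarrow> q \<le> k \<Longrightarrow> (deriv ^^ q) (\<lambda>t. \<phi> (\<gamma> t) i) 0 = c (q * mdim M + i)"
  shows "(deriv ^^ p) (f \<circ> \<gamma>) 0 = (deriv ^^ p) (\<lambda>t. (f \<circ> inv_into V \<phi>) (taylor_curve (mdim M) k c t)) 0"
proof -
  let ?\<Omega> = "\<phi> ` (U \<inter> V)" and ?F = "f \<circ> inv_into V \<phi>"
  have \<Omega>: "openin (cspace (mdim M)) ?\<Omega>" by (rule atlas_image_open[OF A(1) U(1)])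
  have F: "holomorphic_several (mdim M) ?\<Omega> ?F" by (rule hol_functionsD[OF f[unfolded hol_fun_def] A(1)])
  obtain N where N: "open N" "0 \<in> N" "\<And>t. t \<in> N \<Longrightarrow> \<gamma> t \<in> U \<inter> V"
    "\<And>i. i < mdim M \<Longrightarrow> (\<lambda>t. \<phi> (\<gamma> t) i) holomorphic_on N"
    by (rule curve_germ_chart[OF \<gamma> A(1) U A(2)]) blast
  \<comment> \<open>The entries for \<open>q = 0\<close> are the coordinates of the base point, so
    the Taylor curve starts at the same point of the chart.\<close>
  have "restrict c {..<mdim M} = \<phi> (\<gamma> 0)"
    using c[of _ 0] atlas_extensional[OF A] by (auto simp: fun_eq_iff extensional_def)
  then have t0: "taylor_curve (mdim M) k c 0 \<in> ?\<Omega>"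
    using U A by (simp add: taylor_curve_0)
  have cont: "continuous_on UNIV (taylor_curve (mdim M) k c)"
    using continuous_on_compose2[OF continuous_on_taylor_curve, of UNIV "\<lambda>t. (c, t)" UNIV]
    by (simp add: continuous_on_Pair)
  obtain N' where N': "open N'" "0 \<in> N'" "taylor_curve (mdim M) k c ` N' \<subseteq> ?\<Omega>"
    by (rule continuous_on_openin_preimage_nbhd[OF \<Omega> open_UNIV UNIV_I cont taylor_curve_extensional t0])
  have "(deriv ^^ p) (f \<circ> \<gamma>) 0 = (deriv ^^ p) (\<lambda>t. ?F (\<phi> (\<gamma> t))) 0"
  proof (rule higher_deriv_cong_ev[OF _ refl])
    show "\<forall>\<^sub>F t in nhds 0. (f \<circ> \<gamma>) t = ?F (\<phi> (\<gamma> t))"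
      using eventually_nhds_in_open[OF N(1,2)] N(3) atlas_inj_on[OF A(1)]
      by (auto elim!: eventually_mono)
  qed
  also have "\<dots> = (deriv ^^ p) (\<lambda>t. ?F (taylor_curve (mdim M) k c t)) 0"
  proof (rule higher_deriv_compose_curve_cong[OF \<Omega> F _ _ _ _ _ _ _ p])
    show "open (N \<inter> N')" "0 \<in> N \<inter> N'" using N N' by auto
    show "\<phi> (\<gamma> t) \<in> ?\<Omega>" "taylor_curve (mdim M) k c t \<in> ?\<Omega>" if "t \<in> N \<inter> N'" for t
      using N(3)[of t] N'(3) that by auto
    fix i assume i: "i < mdim M"
    show "(\<lambda>t. \<phi> (\<gamma> t) i) holomorphic_on N \<inter> N'"
      by (rule holomorphic_on_subset[OF N(4)[OF i]]) auto
    show "(\<lambda>t. taylor_curve (mdim M) k c t i) holomorphic_on N \<inter> N'"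
      by (rule holomorphic_on_taylor_curve[OF i])
    show "(deriv ^^ q) (\<lambda>t. \<phi> (\<gamma> t) i) 0 = (deriv ^^ q) (\<lambda>t. taylor_curve (mdim M) k c t i) 0"
      if "q \<le> k" for q
      using c[OF i that] higher_deriv_taylor_curve[OF i that] by simp
  qed
  finally show ?thesis .
qed

text \<open>Both derivatives equal the one along the Taylor curve of the common coefficients, read
  in one chart. This makes \<open>jet_deriv\<close> independent of the curve that
  \<open>jet_rep\<close> selects.\<close>

lemma same_jet_higher_deriv:
  assumes "\<gamma> \<in> curve_germs M" "\<delta> \<in> curve_germs M" and same: "same_jet M k \<gamma> \<delta>"
    and U: "openin (mtop M) U" "\<gamma> 0 \<in> U" and f: "f \<in> hol_fun M U" and p: "p \<le> k"
  shows "(deriv ^^ p) (f \<circ> \<gamma>) 0 = (deriv ^^ p) (f \<circ> \<delta>) 0"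
proof -
  obtain V \<phi> where A: "(V, \<phi>) \<in> atlas M" "\<gamma> 0 \<in> V"
    using atlas_cover[OF curve_germ_topspace[OF assms(1)]] by blast
  define c where "c l = (deriv ^^ (l div mdim M)) (\<lambda>t. \<phi> (\<gamma> t) (l mod mdim M)) 0" for l
  have \<gamma>: "(deriv ^^ q) (\<lambda>t. \<phi> (\<gamma> t) i) 0 = c (q * mdim M + i)" if "i < mdim M" "q \<le> k" for i q
    using that by (simp add: c_def)
  have \<delta>: "(deriv ^^ q) (\<lambda>t. \<phi> (\<delta> t) i) 0 = c (q * mdim M + i)" if "i < mdim M" "q \<le> k" for i q
    using same A that \<gamma>[OF that] unfolding same_jet_def by fastforce
  have "\<delta> 0 = \<gamma> 0" using same by (simp add: same_jet_def)
  then show ?thesis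
    using higher_deriv_compose_curve_germ[OF assms(1) U f A p \<gamma>]
      higher_deriv_compose_curve_germ[OF assms(2) U(1) _ f A(1) _ p \<delta>] U(2) A(2) by simp
qed

lemma jet_coords_restrict:
  assumes A: "(V, \<phi>) \<in> atlas M" and j: "j \<in> jets_over M k V"
  shows "restrict (jet_coords M k \<phi> j) {..<mdim M} = \<phi> (jet_proj j)"
  using atlas_extensional[OF A jets_overD(3)[OF j]]
  by (auto simp: jet_coords_def jet_proj_def fun_eq_iff extensional_def)

text \<open>The coordinates of order 0 determine the base point, because \<open>\<phi>\<close> is
  injective. Hence whichever jet \<open>inv_into\<close> selects among those with the given
  coordinates, it still lies over \<open>U\<close>.\<close>

lemma jet_coords_inv_into:
  assumes A: "(V, \<phi>) \<in> atlas M" and j: "j \<in> jets_over M k (U \<inter> V)"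
  defines "j' \<equiv> inv_into (jets_over M k V) (jet_coords M k \<phi>) (jet_coords M k \<phi> j)"
  shows "j' \<in> jets_over M k (U \<inter> V)" "jet_coords M k \<phi> j' = jet_coords M k \<phi> j"
proof -
  have jV: "j \<in> jets_over M k V" using j by (simp add: jets_over_Int)
  then have img: "jet_coords M k \<phi> j \<in> jet_coords M k \<phi> ` jets_over M k V" by blast
  have j': "j' \<in> jets_over M k V" unfolding j'_def by (rule inv_into_into[OF img])
  show eq: "jet_coords M k \<phi> j' = jet_coords M k \<phi> j" unfolding j'_def by (rule f_inv_into_f[OF img])
  have "\<phi> (jet_proj j') = \<phi> (jet_proj j)"
    using jet_coords_restrict[OF A j'] jet_coords_restrict[OF A jV] eq by simp
  then have "jet_proj j' = jet_proj j"
    using inj_onD[OF atlas_inj_on[OF A]] jets_overD(3)[OF j'] jets_overD(3)[OF jV] by blast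
  then show "j' \<in> jets_over M k (U \<inter> V)"
    using j j' by (simp add: jets_over_def)
qed

lemma chart_saturated_jet_atlas: "chart_saturated (jet_atlas M k) (jets_over M k U)"
proof -
  have "inv_into (jets_over M k V) (jet_coords M k \<phi>) (jet_coords M k \<phi> j) \<in> jets_over M k U"
    if "(V, \<phi>) \<in> atlas M" "j \<in> jets_over M k U" "j \<in> jets_over M k V" for V \<phi> j
    using jet_coords_inv_into(1)[OF that(1), of j k U] that by (simp add: jets_over_Int)
  then show ?thesis by (auto simp: chart_saturated_def jet_atlas_def)
qed

text \<open>In the induced chart the function is the derivative at 0 of \<open>?F\<close> along the
  Taylor curve of the coordinates, which is holomorphic in them. Whatever jet
  \<open>inv_into\<close> and whatever curve \<open>jet_rep\<close> select, the value is computed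
  from the coordinates alone.\<close>

lemma jet_deriv_in_jet_fun:
  assumes U: "openin (mtop M) U" and f: "f \<in> hol_fun M U" and p: "p \<le> k"
  shows "jet_deriv M k U p f \<in> jet_fun M k U"
  unfolding jet_fun_def
proof (rule hol_functionsI)
  show "jet_deriv M k U p f \<in> extensional (jets_over M k U)" by (simp add: jet_deriv_def)
  fix V' \<psi> assume "(V', \<psi>) \<in> jet_atlas M k"
  then obtain V \<phi> where A: "(V, \<phi>) \<in> atlas M" and V': "V' = jets_over M k V" "\<psi> = jet_coords M k \<phi>"
    by (auto simp: jet_atlas_def)
  let ?n = "mdim M" and ?\<Omega> = "\<phi> ` (U \<inter> V)" and ?F = "f \<circ> inv_into V \<phi>"
  have \<Omega>: "openin (cspace ?n) ?\<Omega>" by (rule atlas_image_open[OF A U])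
  have F: "holomorphic_several ?n ?\<Omega> ?F" by (rule hol_functionsD[OF f[unfolded hol_fun_def] A])
  show "holomorphic_several (?n * (k + 1)) (\<psi> ` (jets_over M k U \<inter> V')) (jet_deriv M k U p f \<circ> inv_into V' \<psi>)"
  proof (rule holomorphic_several_eq)
    show "holomorphic_several (?n * (k + 1)) (\<psi> ` (jets_over M k U \<inter> V'))
        (\<lambda>c. (deriv ^^ p) (\<lambda>t. ?F (taylor_curve ?n k c t)) 0)"
    proof (rule holomorphic_several_subset[OF holomorphic_several_higher_deriv_taylor_curve[OF \<Omega> F]], rule subsetI)
      fix c assume "c \<in> \<psi> ` (jets_over M k U \<inter> V')"
      then obtain j where j: "j \<in> jets_over M k (U \<inter> V)" "c = jet_coords M k \<phi> j"
        by (auto simp: V' jets_over_Int)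
      then have "restrict c {..<?n} = \<phi> (jet_proj j)"
        using jet_coords_restrict[OF A, of j k] by (simp add: jets_over_Int)
      then show "c \<in> {c \<in> extensional {..<?n * (k + 1)}. restrict c {..<?n} \<in> ?\<Omega>}"
        using jets_overD(3)[OF j(1)] j(2) by (simp add: jet_coords_def)
    qed
    fix c assume "c \<in> \<psi> ` (jets_over M k U \<inter> V')"
    then obtain j0 where j0: "j0 \<in> jets_over M k (U \<inter> V)" "c = jet_coords M k \<phi> j0"
      by (auto simp: V' jets_over_Int)
    define j where "j = inv_into V' \<psi> c"
    have j: "j \<in> jets_over M k (U \<inter> V)" "jet_coords M k \<phi> j = c"
      using jet_coords_inv_into[OF A j0(1)] by (simp_all add: j_def j0(2) V')
    have c: "(deriv ^^ q) (\<lambda>t. \<phi> (jet_rep j t) i) 0 = c (q * ?n + i)" if i: "i < ?n" and q: "q \<le> k" for i q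
    proof -
      \<comment> \<open>\<open>jet_coords\<close> is \<open>undefined\<close> from
        \<open>?n * (k + 1)\<close> on, so the index must be shown to lie below this bound before
        the entry can be read.\<close>
      have "q * ?n + i < q * ?n + ?n" using i by simp
      also have "\<dots> \<le> ?n * (k + 1)" using mult_le_mono1[OF q, of ?n] by (simp add: algebra_simps)
      finally have "c (q * ?n + i) = (deriv ^^ ((q * ?n + i) div ?n)) (\<lambda>t. \<phi> (jet_rep j t) ((q * ?n + i) mod ?n)) 0"
        unfolding j(2)[symmetric] jet_coords_def by simp
      then show ?thesis using i by simp
    qed
    have "j \<in> jets_over M k U" using j(1) by (simp add: jets_over_Int)
    then have "(jet_deriv M k U p f \<circ> inv_into V' \<psi>) c = (deriv ^^ p) (f \<circ> jet_rep j) 0"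
      by (simp add: jet_deriv_def j_def)
    also have "\<dots> = (deriv ^^ p) (\<lambda>t. ?F (taylor_curve ?n k c t)) 0"
      using jets_overD[OF j(1)] by (intro higher_deriv_compose_curve_germ[OF _ U _ f A _ p c]) auto
    finally show "(deriv ^^ p) (\<lambda>t. ?F (taylor_curve ?n k c t)) 0 = (jet_deriv M k U p f \<circ> inv_into V' \<psi>) c"
      by simp
  qed
qed

lemma jet_deriv_jet:
  assumes "\<gamma> \<in> curve_germs M" "openin (mtop M) U" "\<gamma> 0 \<in> U" "f \<in> hol_fun M U" "p \<le> k"
  shows "jet_deriv M k U p f (jet M k \<gamma>) = (deriv ^^ p) (f \<circ> \<gamma>) 0"
  using same_jet_higher_deriv[OF assms(1) jet_rep_jet[OF assms(1), of k] assms(2-5)] jet_in_jets_over[OF assms(1), of k U] assms(3)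
  by (simp add: jet_deriv_def)

lemma wronskian_in_jet_fun:
  assumes U: "openin (mtop M) U" and f: "\<And>i. i \<le> k \<Longrightarrow> f i \<in> hol_fun M U"
  shows "wronskian M k U f \<in> jet_fun M k U"
  unfolding wronskian_def jet_fun_def
proof (rule hol_functions_det[OF chart_saturated_jet_atlas])
  fix p i assume "p < k + 1" "i < k + 1"
  then have "jet_deriv M k U p (f i) \<in> jet_fun M k U"
    by (intro jet_deriv_in_jet_fun U f) auto
  then show "restrict (jet_deriv M k U p (f i)) (jets_over M k U) \<in> hol_functions (mdim M * (k + 1)) (jet_atlas M k) (jets_over M k U)"
    by (simp add: jet_fun_def jet_deriv_def)
qed

end

section \<open>Transformation of Wronskian determinants in one variable\<close>

text \<open>Shared by the product rule and the chain rule: both express row \<open>p\<close> through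
  the rows \<open>q \<le> p\<close> with coefficients that do not depend on the column, so the
  change is multiplication from the left by one matrix.\<close>

lemma det_lower_triangular_mult:
  fixes A A' B :: "nat \<Rightarrow> nat \<Rightarrow> 'r::comm_ring_1"
  assumes "\<And>p i. p < m \<Longrightarrow> i < m \<Longrightarrow> A' p i = (\<Sum>q\<le>p. B p q * A q i)"
  shows "Determinant.det (Matrix.mat m m (\<lambda>(p, i). A' p i)) =
    (\<Prod>p<m. B p p) * Determinant.det (Matrix.mat m m (\<lambda>(p, i). A p i))"
proof -
  define L where "L = Matrix.mat m m (\<lambda>(p, q). if q \<le> p then B p q else 0)"
  have L: "L \<in> carrier_mat m m" by (simp add: L_def)
  have "Matrix.mat m m (\<lambda>(p, i). A' p i) = L * Matrix.mat m m (\<lambda>(p, i). A p i)"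
  proof (rule eq_matI)
    fix p i assume "p < dim_row (L * Matrix.mat m m (\<lambda>(p, i). A p i))" "i < dim_col (L * Matrix.mat m m (\<lambda>(p, i). A p i))"
    then have pi: "p < m" "i < m" by (simp_all add: L_def)
    have "(L * Matrix.mat m m (\<lambda>(p, i). A p i)) $$ (p, i) = (\<Sum>q = 0..<m. (if q \<le> p then B p q else 0) * A q i)"
      using pi by (simp add: L_def scalar_prod_def)
    also have "\<dots> = (\<Sum>q\<le>p. B p q * A q i)"
      using pi by (intro sum.mono_neutral_cong_right) auto
    finally show "Matrix.mat m m (\<lambda>(p, i). A' p i) $$ (p, i) = (L * Matrix.mat m m (\<lambda>(p, i). A p i)) $$ (p, i)"
      using pi assms by simp
  qed (simp_all add: L_def)
  moreover have "Determinant.det L = (\<Prod>p<m. B p p)"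
  proof -
    have "Determinant.det L = prod_list (diag_mat L)"
      by (rule det_lower_triangular[OF _ L]) (simp add: L_def)
    then show ?thesis
      by (simp add: prod_list_diag_prod L_def atLeast0LessThan)
  qed
  ultimately show ?thesis by (simp add: det_mult[OF L])
qed

lemma higher_deriv_fps:
  fixes f :: "complex \<Rightarrow> complex"
  assumes "f has_fps_expansion F"
  shows "(deriv ^^ n) f 0 = fact n * fps_nth F n"
  using fps_nth_fps_expansion[OF assms, of n] by simp

lemma det_higher_deriv_compose:
  fixes f :: "nat \<Rightarrow> complex \<Rightarrow> complex"
  assumes f: "\<And>i. i \<le> k \<Longrightarrow> f i has_fps_expansion F i"
    and \<phi>: "\<phi> has_fps_expansion \<Phi>" "\<phi> 0 = 0"
  shows "Determinant.det (Matrix.mat (k + 1) (k + 1) (\<lambda>(p, i). (deriv ^^ p) (f i \<circ> \<phi>) 0)) =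
    deriv \<phi> 0 ^ (k * (k + 1) div 2) *
    Determinant.det (Matrix.mat (k + 1) (k + 1) (\<lambda>(p, i). (deriv ^^ p) (f i) 0))"
proof -
  have \<Phi>0: "fps_nth \<Phi> 0 = 0" using has_fps_expansion_imp_0_eq_fps_nth_0[OF \<phi>(1)] \<phi>(2) by simp
  \<comment> \<open>The partial Bell polynomial of p and q in the derivatives of
    \<open>\<phi>\<close> at 0. As \<open>\<Phi>\<close> has no constant term, it vanishes for
    \<open>q > p\<close>, and its diagonal value is the power \<open>p\<close> of the linear
    coefficient.\<close>
  define B where "B p q = fact p / fact q * fps_nth (\<Phi> ^ q) p" for p q
  have lower: "(deriv ^^ p) (f i \<circ> \<phi>) 0 = (\<Sum>q\<le>p. B p q * (deriv ^^ q) (f i) 0)"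
    if "p < k + 1" "i < k + 1" for p i
  proof -
    have i: "i \<le> k" using that by simp
    have "(deriv ^^ p) (f i \<circ> \<phi>) 0 = fact p * (\<Sum>q = 0..p. fps_nth (F i) q * fps_nth (\<Phi> ^ q) p)"
      by (simp add: higher_deriv_fps[OF has_fps_expansion_compose[OF f[OF i] \<phi>(1) \<Phi>0]] fps_compose_nth)
    also have "\<dots> = (\<Sum>q\<le>p. B p q * (deriv ^^ q) (f i) 0)"
      by (simp add: higher_deriv_fps[OF f[OF i]] B_def sum_distrib_left atMost_atLeast0 mult_ac)
    finally show ?thesis .
  qed
  have "Determinant.det (Matrix.mat (k + 1) (k + 1) (\<lambda>(p, i). (deriv ^^ p) (f i \<circ> \<phi>) 0)) =
      (\<Prod>p<k + 1. B p p) * Determinant.det (Matrix.mat (k + 1) (k + 1) (\<lambda>(p, i). (deriv ^^ p) (f i) 0))"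
    by (rule det_lower_triangular_mult[OF lower])
  also have "B p p = deriv \<phi> 0 ^ p" for p
    using higher_deriv_fps[OF \<phi>(1), of 1] by (simp add: B_def startsby_zero_power_nth_same[OF \<Phi>0])
  then have "(\<Prod>p<k + 1. B p p) = deriv \<phi> 0 ^ (\<Sum>p<k + 1. p)"
    by (simp only: power_sum)
  \<comment> \<open>The weight of the Wronskian is the sum of the diagonal exponents 0, ...,
    k.\<close>
  also have "(\<Sum>p<k + 1. p) = k * (k + 1) div 2"
    using gauss_sum_nat[of k] by (simp add: lessThan_Suc_atMost atMost_atLeast0)
  finally show ?thesis .
qed

lemma det_higher_deriv_mult:
  fixes f :: "nat \<Rightarrow> complex \<Rightarrow> complex"
  assumes f: "\<And>i. i \<le> k \<Longrightarrow> f i has_fps_expansion F i" and g: "g has_fps_expansion G"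
  shows "Determinant.det (Matrix.mat (k + 1) (k + 1) (\<lambda>(p, i). (deriv ^^ p) (\<lambda>t. f i t * g t) 0)) =
    g 0 ^ (k + 1) * Determinant.det (Matrix.mat (k + 1) (k + 1) (\<lambda>(p, i). (deriv ^^ p) (f i) 0))"
proof -
  \<comment> \<open>Since \<open>fps_nth G (p - q)\<close> is a derivative of \<open>g\<close>
    divided by \<open>fact (p - q)\<close>, this is the Leibniz coefficient:
    \<open>p choose q\<close> times the derivative of \<open>g\<close> of order \<open>p - q\<close>
    at 0.\<close>
  define B where "B p q = fact p / fact q * fps_nth G (p - q)" for p q
  have lower: "(deriv ^^ p) (\<lambda>t. f i t * g t) 0 = (\<Sum>q\<le>p. B p q * (deriv ^^ q) (f i) 0)"
    if "p < k + 1" "i < k + 1" for p i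
  proof -
    have i: "i \<le> k" using that by simp
    have "(deriv ^^ p) (\<lambda>t. f i t * g t) 0 = fact p * (\<Sum>q = 0..p. fps_nth (F i) q * fps_nth G (p - q))"
      by (simp add: higher_deriv_fps[OF has_fps_expansion_mult[OF f[OF i] g]] fps_mult_nth)
    also have "\<dots> = (\<Sum>q\<le>p. B p q * (deriv ^^ q) (f i) 0)"
      by (simp add: higher_deriv_fps[OF f[OF i]] B_def sum_distrib_left atMost_atLeast0 mult_ac)
    finally show ?thesis .
  qed
  have "Determinant.det (Matrix.mat (k + 1) (k + 1) (\<lambda>(p, i). (deriv ^^ p) (\<lambda>t. f i t * g t) 0)) =
      (\<Prod>p<k + 1. B p p) * Determinant.det (Matrix.mat (k + 1) (k + 1) (\<lambda>(p, i). (deriv ^^ p) (f i) 0))"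
    by (rule det_lower_triangular_mult[OF lower])
  also have "B p p = g 0" for p
    using has_fps_expansion_imp_0_eq_fps_nth_0[OF g] by (simp add: B_def)
  then have "(\<Prod>p<k + 1. B p p) = g 0 ^ (k + 1)" by simp
  finally show ?thesis .
qed

lemma reparamD:
  assumes "\<phi> \<in> reparam k"
  shows "\<phi> holomorphic_on UNIV" "\<phi> 0 = 0"
proof -
  obtain a where "\<phi> = (\<lambda>t. \<Sum>i=1..k. a i * t ^ i)"
    using assms by (auto simp: reparam_def)
  then show "\<phi> holomorphic_on UNIV" "\<phi> 0 = 0"
    by (auto intro!: holomorphic_intros sum.neutral)
qed

section \<open>Wronskians as invariant jet differentials\<close>

context
  fixes M :: "'a manifold"
  assumes M: "complex_manifold M"
begin

lemma hol_fun_compose_curve_germ_fps: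
  assumes "\<gamma> \<in> curve_germs M" "openin (mtop M) U" "\<gamma> 0 \<in> U" "f \<in> hol_fun M U"
  shows "(f \<circ> \<gamma>) has_fps_expansion fps_expansion (f \<circ> \<gamma>) 0"
proof -
  obtain N where "open N" "0 \<in> N" "(f \<circ> \<gamma>) holomorphic_on N"
    by (rule hol_fun_compose_curve_germ[OF M assms])
  then show ?thesis by (rule has_fps_expansion_fps_expansion)
qed

text \<open>Evaluation along an arbitrary representative is what invariance requires: the curve that
  \<open>jet_rep\<close> selects for the jet of \<open>\<gamma> \<circ> \<phi>\<close> need not be a
  reparametrisation of the one selected for the jet of \<open>\<gamma>\<close>.\<close>

lemma wronskian_jet:
  assumes \<gamma>: "\<gamma> \<in> curve_germs M" and U: "openin (mtop M) U" "\<gamma> 0 \<in> U"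
    and f: "\<And>i. i \<le> k \<Longrightarrow> f i \<in> hol_fun M U"
  shows "wronskian M k U f (jet M k \<gamma>) =
    Determinant.det (Matrix.mat (k + 1) (k + 1) (\<lambda>(p, i). (deriv ^^ p) (f i \<circ> \<gamma>) 0))"
proof -
  have "Matrix.mat (k + 1) (k + 1) (\<lambda>(p, i). jet_deriv M k U p (f i) (jet M k \<gamma>)) =
      Matrix.mat (k + 1) (k + 1) (\<lambda>(p, i). (deriv ^^ p) (f i \<circ> \<gamma>) 0)"
    using f by (intro cong_mat) (auto intro!: jet_deriv_jet[OF M \<gamma> U])
  then show ?thesis
    using jet_in_jets_over[OF \<gamma>, of k U] U(2) by (simp add: wronskian_def)
qed

lemma wronskian_in_inv_jet_diff:
  assumes U: "openin (mtop M) U" and f: "\<And>i. i \<le> k \<Longrightarrow> f i \<in> hol_fun M U"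
  shows "wronskian M k U f \<in> inv_jet_diff M k (k * (k + 1) div 2) U"
proof -
  have "wronskian M k U f (jet M k (\<gamma> \<circ> \<phi>)) = deriv \<phi> 0 ^ (k * (k + 1) div 2) * wronskian M k U f (jet M k \<gamma>)"
    if \<gamma>: "\<gamma> \<in> curve_germs M" "\<gamma> 0 \<in> U" and \<phi>: "\<phi> \<in> reparam k" for \<gamma> \<phi>
  proof -
    note \<phi>' = reparamD[OF \<phi>]
    have \<gamma>\<phi>: "\<gamma> \<circ> \<phi> \<in> curve_germs M" "(\<gamma> \<circ> \<phi>) 0 \<in> U"
      using curve_germ_compose[OF \<gamma>(1) \<phi>'] \<gamma>(2) \<phi>'(2) by auto
    have "\<phi> has_fps_expansion fps_expansion \<phi> 0"
      using \<phi>'(1) by (intro has_fps_expansion_fps_expansion[of UNIV]) auto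
    from det_higher_deriv_compose[where k = k and f = "\<lambda>i. f i \<circ> \<gamma>" and F = "\<lambda>i. fps_expansion (f i \<circ> \<gamma>) 0",
        OF hol_fun_compose_curve_germ_fps[OF \<gamma>(1) U \<gamma>(2) f] this \<phi>'(2)]
    show ?thesis
      using wronskian_jet[where k = k and f = f, OF \<gamma>(1) U \<gamma>(2) f]
        wronskian_jet[where k = k and f = f, OF \<gamma>\<phi>(1) U \<gamma>\<phi>(2) f]
      by (simp add: o_def)
  qed
  then show ?thesis
    using wronskian_in_jet_fun[OF M U f] by (auto simp: inv_jet_diff_def)
qed

text \<open>The jet is the same on both sides, so both Wronskians are evaluated along one curve, and
  the product rule for functions of one variable gives the factor \<open>g (jet_proj j)\<close> once
  for each of the \<open>k + 1\<close> rows.\<close>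

lemma wronskian_mult:
  assumes U: "openin (mtop M) U" "openin (mtop M) U'"
    and f: "\<And>i. i \<le> k \<Longrightarrow> f i \<in> hol_fun M U" and g: "g \<in> hol_fun M (U \<inter> U')"
    and f': "\<And>i x. i \<le> k \<Longrightarrow> x \<in> U \<inter> U' \<Longrightarrow> f' i x = f i x * g x"
    and j: "j \<in> jets_over M k (U \<inter> U')"
  shows "wronskian M k U' f' j = g (jet_proj j) ^ (k + 1) * wronskian M k U f j"
proof -
  define \<gamma> where "\<gamma> = jet_rep j"
  note j' = jets_overD[OF j, folded \<gamma>_def]
  have UU': "openin (mtop M) (U \<inter> U')" using U by blast
  \<comment> \<open>The chart is a means to shrink the parameter domain until the curve stays in
    \<open>U \<inter> U'\<close>, where \<open>f'\<close> is the product of \<open>f\<close> and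
    \<open>g\<close>.\<close>
  obtain V \<phi> where A: "(V, \<phi>) \<in> atlas M" "\<gamma> 0 \<in> V"
    using atlas_cover[OF M curve_germ_topspace[OF j'(1)]] by blast
  obtain N where N: "open N" "0 \<in> N" "\<And>t. t \<in> N \<Longrightarrow> \<gamma> t \<in> U \<inter> U' \<inter> V"
    by (rule curve_germ_chart[OF M j'(1) A(1) UU' j'(2) A(2)]) blast
  have jU: "j \<in> jets_over M k U" "j \<in> jets_over M k U'"
    using j by (simp_all add: jets_over_Int)
  have "(deriv ^^ p) (f' i \<circ> \<gamma>) 0 = (deriv ^^ p) (\<lambda>t. (f i \<circ> \<gamma>) t * (g \<circ> \<gamma>) t) 0" if "i \<le> k" for p i
  proof (rule higher_deriv_cong_ev[OF _ refl])
    show "\<forall>\<^sub>F t in nhds 0. (f' i \<circ> \<gamma>) t = (f i \<circ> \<gamma>) t * (g \<circ> \<gamma>) t"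
      using eventually_nhds_in_open[OF N(1,2)] N(3) f'[OF that] by (auto elim!: eventually_mono)
  qed
  then have "Matrix.mat (k + 1) (k + 1) (\<lambda>(p, i). (deriv ^^ p) (f' i \<circ> \<gamma>) 0) =
      Matrix.mat (k + 1) (k + 1) (\<lambda>(p, i). (deriv ^^ p) (\<lambda>t. (f i \<circ> \<gamma>) t * (g \<circ> \<gamma>) t) 0)"
    by (intro cong_mat) auto
  then have "wronskian M k U' f' j =
      Determinant.det (Matrix.mat (k + 1) (k + 1) (\<lambda>(p, i). (deriv ^^ p) (\<lambda>t. (f i \<circ> \<gamma>) t * (g \<circ> \<gamma>) t) 0))"
    using jU(2) by (simp add: wronskian_def jet_deriv_def \<gamma>_def)
  also have "\<dots> = (g \<circ> \<gamma>) 0 ^ (k + 1) *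
      Determinant.det (Matrix.mat (k + 1) (k + 1) (\<lambda>(p, i). (deriv ^^ p) (f i \<circ> \<gamma>) 0))"
    using j'(2)
    by (intro det_higher_deriv_mult[where F = "\<lambda>i. fps_expansion (f i \<circ> \<gamma>) 0", OF
          hol_fun_compose_curve_germ_fps[OF j'(1) U(1) _ f] hol_fun_compose_curve_germ_fps[OF j'(1) UU' _ g]]) auto
  also have "Determinant.det (Matrix.mat (k + 1) (k + 1) (\<lambda>(p, i). (deriv ^^ p) (f i \<circ> \<gamma>) 0)) = wronskian M k U f j"
    using jU(1) by (simp add: wronskian_def jet_deriv_def \<gamma>_def)
  finally show ?thesis by (simp add: jet_proj_def \<gamma>_def)
qed

section \<open>Module operations and restriction of sections\<close>

lemma inv_jet_diff_add:
  assumes "Q \<in> inv_jet_diff M k m U" "R \<in> inv_jet_diff M k m U"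
  shows "(\<lambda>j\<in>jets_over M k U. Q j + R j) \<in> inv_jet_diff M k m U"
proof -
  have "(\<lambda>j\<in>jets_over M k U. Q j + R j) \<in> jet_fun M k U"
    using assms hol_functions_add[OF chart_saturated_jet_atlas[OF M]] by (auto simp: inv_jet_diff_def jet_fun_def)
  moreover have "jet M k (\<gamma> \<circ> \<phi>) \<in> jets_over M k U" "jet M k \<gamma> \<in> jets_over M k U"
    if "\<gamma> \<in> curve_germs M" "\<gamma> 0 \<in> U" "\<phi> \<in> reparam k" for \<gamma> \<phi>
    using that curve_germ_compose[OF that(1) reparamD[OF that(3)]] reparamD(2)[OF that(3)]
    by (auto simp: jet_in_jets_over)
  ultimately show ?thesis
    using assms by (auto simp: inv_jet_diff_def distrib_left)
qed

text \<open>\<open>jet_deriv\<close> of order 0 is the pull-back of \<open>a\<close> to the jet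
  space, which gives its holomorphy in jet coordinates. Invariance persists because
  reparametrisation fixes the base point.\<close>

lemma inv_jet_diff_act:
  assumes U: "openin (mtop M) U" and a: "a \<in> hol_fun M U" and Q: "Q \<in> inv_jet_diff M k m U"
  shows "(\<lambda>j\<in>jets_over M k U. a (jet_proj j) * Q j) \<in> inv_jet_diff M k m U"
proof -
  have "jet_deriv M k U 0 a \<in> jet_fun M k U" by (rule jet_deriv_in_jet_fun[OF M U a]) simp
  then have "(\<lambda>j\<in>jets_over M k U. jet_deriv M k U 0 a j * Q j) \<in> jet_fun M k U"
    using Q hol_functions_mult[OF chart_saturated_jet_atlas[OF M]] by (auto simp: inv_jet_diff_def jet_fun_def)
  also have "(\<lambda>j\<in>jets_over M k U. jet_deriv M k U 0 a j * Q j) = (\<lambda>j\<in>jets_over M k U. a (jet_proj j) * Q j)"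
    by (auto simp: jet_deriv_def jet_proj_def restrict_def)
  finally have "(\<lambda>j\<in>jets_over M k U. a (jet_proj j) * Q j) \<in> jet_fun M k U" .
  moreover have "jet M k (\<gamma> \<circ> \<phi>) \<in> jets_over M k U" "jet M k \<gamma> \<in> jets_over M k U"
      "jet_proj (jet M k (\<gamma> \<circ> \<phi>)) = jet_proj (jet M k \<gamma>)"
    if "\<gamma> \<in> curve_germs M" "\<gamma> 0 \<in> U" "\<phi> \<in> reparam k" for \<gamma> \<phi>
    using that curve_germ_compose[OF that(1) reparamD[OF that(3)]] reparamD(2)[OF that(3)]
    by (auto simp: jet_in_jets_over jet_proj_jet)
  ultimately show ?thesis
    using Q by (auto simp: inv_jet_diff_def)
qed

lemma inv_jet_diff_restrict:
  assumes Q: "Q \<in> inv_jet_diff M k m U" and V: "V \<subseteq> U"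
  shows "restrict Q (jets_over M k V) \<in> inv_jet_diff M k m V"
proof -
  have "restrict Q (jets_over M k V) \<in> jet_fun M k V"
    using Q hol_functions_restrict[OF _ jets_over_mono[OF V] chart_saturated_jet_atlas[OF M]]
    by (auto simp: inv_jet_diff_def jet_fun_def)
  moreover have "jet M k (\<gamma> \<circ> \<phi>) \<in> jets_over M k V" "jet M k \<gamma> \<in> jets_over M k V"
    if "\<gamma> \<in> curve_germs M" "\<gamma> 0 \<in> V" "\<phi> \<in> reparam k" for \<gamma> \<phi>
    using that curve_germ_compose[OF that(1) reparamD[OF that(3)]] reparamD(2)[OF that(3)]
    by (auto simp: jet_in_jets_over)
  ultimately show ?thesis
    using Q V by (auto simp: inv_jet_diff_def)
qed

lemma lsections_restrict:
  assumes t: "t \<in> lsections M L U" and V: "V \<subseteq> U"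
  shows "restrict t V \<in> lsections M L V"
proof -
  have "(\<lambda>x\<in>V \<inter> W. \<sigma> (restrict t V x)) \<in> hol_fun M (V \<inter> W)" if "(W, \<sigma>) \<in> ltrivs L" for W \<sigma>
  proof -
    have "(\<lambda>x\<in>U \<inter> W. \<sigma> (t x)) \<in> hol_fun M (U \<inter> W)" using t that by (auto simp: lsections_def)
    then have "restrict (\<lambda>x\<in>U \<inter> W. \<sigma> (t x)) (V \<inter> W) \<in> hol_fun M (V \<inter> W)"
      unfolding hol_fun_def by (rule hol_functions_restrict) (use V in \<open>auto intro: chart_saturated_atlas[OF M]\<close>)
    also have "restrict (\<lambda>x\<in>U \<inter> W. \<sigma> (t x)) (V \<inter> W) = (\<lambda>x\<in>V \<inter> W. \<sigma> (restrict t V x))"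
      using V by (intro restrict_ext) auto
    finally show ?thesis .
  qed
  then show ?thesis using t V by (auto simp: lsections_def)
qed

end

section \<open>Line bundles and their tensor powers\<close>

lemma PiE_fun_upd_in:
  "v \<in> I \<rightarrow>\<^sub>E S \<Longrightarrow> i \<in> I \<Longrightarrow> u \<in> S \<Longrightarrow> v(i := u) \<in> I \<rightarrow>\<^sub>E S"
  using PiE_fun_upd[of u "\<lambda>_. S" i v I] by (simp add: insert_absorb)

lemma multilinear_formsD:
  assumes "m \<in> multilinear_forms L r x" "v \<in> {..<r} \<rightarrow>\<^sub>E lfibre L x" "i < r" "w \<in> lfibre L x"
  shows "w' \<in> lfibre L x \<Longrightarrow> m (v(i := lplus L w w')) = m (v(i := w)) + m (v(i := w'))"
    and "m (v(i := lscale L c w)) = c * m (v(i := w))"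
  using assms by (auto simp: multilinear_forms_def)

lemma trivializationD:
  assumes "trivialization M L U \<tau>"
  shows "openin (mtop M) U" "U \<subseteq> topspace (mtop M)"
    and "x \<in> U \<Longrightarrow> bij_betw \<tau> (lfibre L x) UNIV"
    and "x \<in> U \<Longrightarrow> v \<in> lfibre L x \<Longrightarrow> w \<in> lfibre L x \<Longrightarrow> \<tau> (lplus L v w) = \<tau> v + \<tau> w"
    and "x \<in> U \<Longrightarrow> v \<in> lfibre L x \<Longrightarrow> \<tau> (lscale L c v) = c * \<tau> v"
    and "(V, \<sigma>) \<in> ltrivs L \<Longrightarrow> (\<lambda>x\<in>U \<inter> V. \<tau> (lframe L \<sigma> x)) \<in> hol_fun M (U \<inter> V)"
  using assms openin_subset[of "mtop M" U] by (auto simp: trivialization_def)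

lemma lframe:
  assumes "trivialization M L U \<tau>" "x \<in> U"
  shows "lframe L \<tau> x \<in> lfibre L x" "\<tau> (lframe L \<tau> x) = 1"
proof -
  have "1 \<in> \<tau> ` lfibre L x"
    using trivializationD(3)[OF assms] by (simp add: bij_betw_def)
  then show "lframe L \<tau> x \<in> lfibre L x" "\<tau> (lframe L \<tau> x) = 1"
    unfolding lframe_def by (rule inv_into_into, rule f_inv_into_f)
qed

lemma lfibre_tensor_power:
  "lfibre (tensor_power M L r) x = (if x \<in> topspace (mtop M) then {x} \<times> tensor_fibre L r x else {})"
  by (auto simp: lfibre_def tensor_power_def)

lemma lsections_tensor_powerI:
  assumes "t \<in> extensional U" "U \<subseteq> topspace (mtop M)"
    and T: "\<And>x. x \<in> U \<Longrightarrow> t x = (x, T x) \<and> T x \<in> tensor_fibre L r x"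
    and hol: "\<And>V \<sigma>. (V, \<sigma>) \<in> ltrivs L \<Longrightarrow>
      (\<lambda>x\<in>U \<inter> V. T x (\<lambda>v\<in>{..<r} \<rightarrow>\<^sub>E lfibre L x. \<Prod>i<r. \<sigma> (v i))) \<in> hol_fun M (U \<inter> V)"
  shows "t \<in> lsections M (tensor_power M L r) U"
proof -
  have "(\<lambda>x\<in>U \<inter> V. (case t x of (x, T) \<Rightarrow> T (\<lambda>v\<in>{..<r} \<rightarrow>\<^sub>E lfibre L x. \<Prod>i<r. \<sigma> (v i)))) \<in> hol_fun M (U \<inter> V)"
    if V: "(V, \<sigma>) \<in> ltrivs L" for V \<sigma>
  proof -
    have "(\<lambda>x\<in>U \<inter> V. (case t x of (x, T) \<Rightarrow> T (\<lambda>v\<in>{..<r} \<rightarrow>\<^sub>E lfibre L x. \<Prod>i<r. \<sigma> (v i)))) =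
        (\<lambda>x\<in>U \<inter> V. T x (\<lambda>v\<in>{..<r} \<rightarrow>\<^sub>E lfibre L x. \<Prod>i<r. \<sigma> (v i)))"
      using T by (intro restrict_ext) auto
    then show ?thesis using hol[OF V] by simp
  qed
  moreover have "t x \<in> lfibre (tensor_power M L r) x" if "x \<in> U" for x
    using T[OF that] that assms(2) by (auto simp: lfibre_tensor_power)
  ultimately show ?thesis
    using assms(1) by (auto simp: lsections_def tensor_power_def)
qed

lemma lsections_tensor_powerE:
  assumes "t \<in> lsections M (tensor_power M L r) U"
  obtains T where "\<And>x. x \<in> U \<Longrightarrow> t x = (x, T x)" "\<And>x. x \<in> U \<Longrightarrow> T x \<in> tensor_fibre L r x"
    "\<And>V \<sigma>. (V, \<sigma>) \<in> ltrivs L \<Longrightarrow>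
      (\<lambda>x\<in>U \<inter> V. T x (\<lambda>v\<in>{..<r} \<rightarrow>\<^sub>E lfibre L x. \<Prod>i<r. \<sigma> (v i))) \<in> hol_fun M (U \<inter> V)"
proof -
  define T where "T x = snd (t x)" for x
  have tx: "t x = (x, T x)" "T x \<in> tensor_fibre L r x" if "x \<in> U" for x
  proof -
    have "t x \<in> lfibre (tensor_power M L r) x" using assms that by (simp add: lsections_def)
    then show "t x = (x, T x)" "T x \<in> tensor_fibre L r x"
      by (auto simp: lfibre_tensor_power T_def split: if_splits)
  qed
  moreover have "(\<lambda>x\<in>U \<inter> V. T x (\<lambda>v\<in>{..<r} \<rightarrow>\<^sub>E lfibre L x. \<Prod>i<r. \<sigma> (v i))) \<in> hol_fun M (U \<inter> V)"
    if V: "(V, \<sigma>) \<in> ltrivs L" for V \<sigma>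
  proof -
    have "(V, \<lambda>(x, T). T (\<lambda>v\<in>{..<r} \<rightarrow>\<^sub>E lfibre L x. \<Prod>i<r. \<sigma> (v i))) \<in> ltrivs (tensor_power M L r)"
      using V by (force simp: tensor_power_def)
    then have "(\<lambda>x\<in>U \<inter> V. (case t x of (x, T) \<Rightarrow> T (\<lambda>v\<in>{..<r} \<rightarrow>\<^sub>E lfibre L x. \<Prod>i<r. \<sigma> (v i)))) \<in> hol_fun M (U \<inter> V)"
      using assms by (auto simp: lsections_def)
    also have "(\<lambda>x\<in>U \<inter> V. (case t x of (x, T) \<Rightarrow> T (\<lambda>v\<in>{..<r} \<rightarrow>\<^sub>E lfibre L x. \<Prod>i<r. \<sigma> (v i)))) =
        (\<lambda>x\<in>U \<inter> V. T x (\<lambda>v\<in>{..<r} \<rightarrow>\<^sub>E lfibre L x. \<Prod>i<r. \<sigma> (v i)))"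
      using tx(1) by (intro restrict_ext) auto
    finally show ?thesis .
  qed
  ultimately show thesis by (rule that)
qed

context
  fixes M :: "'a manifold" and L :: "('a, 'l) line_bundle"
  assumes L: "holomorphic_line_bundle M L"
begin

lemma lplus_in_lfibre: "v \<in> lfibre L x \<Longrightarrow> w \<in> lfibre L x \<Longrightarrow> lplus L v w \<in> lfibre L x"
  using L by (simp add: holomorphic_line_bundle_def)

lemma lscale_in_lfibre: "v \<in> lfibre L x \<Longrightarrow> lscale L c v \<in> lfibre L x"
  using L by (simp add: holomorphic_line_bundle_def)

lemma ltrivs_trivialization: "(V, \<sigma>) \<in> ltrivs L \<Longrightarrow> trivialization M L V \<sigma>"
  using L by (auto simp: holomorphic_line_bundle_def)

lemma ltrivs_cover:
  assumes "x \<in> topspace (mtop M)"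
  shows "\<exists>V \<sigma>. (V, \<sigma>) \<in> ltrivs L \<and> x \<in> V"
proof -
  have "(\<Union>(V, \<sigma>)\<in>ltrivs L. V) = topspace (mtop M)"
    using L unfolding holomorphic_line_bundle_def by blast
  then have "x \<in> (\<Union>(V, \<sigma>)\<in>ltrivs L. V)" using assms by simp
  then show ?thesis by auto
qed

text \<open>Both sides have the same coordinate in \<open>\<tau>\<close>, which is injective on the
  fibre. Identities in the fibre are transported from the complex plane in this way, since no vector
  space axioms are postulated for it.\<close>

lemma lscale_lframe:
  assumes \<tau>: "trivialization M L U \<tau>" "x \<in> U" and v: "v \<in> lfibre L x"
  shows "lscale L (\<tau> v) (lframe L \<tau> x) = v"
proof (rule inj_onD[of \<tau> "lfibre L x"])
  show "inj_on \<tau> (lfibre L x)" using trivializationD(3)[OF \<tau>] by (simp add: bij_betw_def)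
  show "\<tau> (lscale L (\<tau> v) (lframe L \<tau> x)) = \<tau> v"
    using trivializationD(5)[OF \<tau> lframe(1)[OF \<tau>]] lframe(2)[OF \<tau>] by simp
qed (use lscale_in_lfibre lframe(1)[OF \<tau>] v in auto)

text \<open>Apply \<open>\<tau>'\<close> to \<open>v\<close> written as \<open>\<tau> v\<close>
  times the frame of \<open>\<tau>\<close>. The transition function from \<open>\<tau>\<close> to
  \<open>\<tau>'\<close> is thus the coordinate in \<open>\<tau>'\<close> of that frame.\<close>

lemma trivialization_change:
  assumes \<tau>: "trivialization M L U \<tau>" "x \<in> U" and \<tau>': "trivialization M L U' \<tau>'" "x \<in> U'"
    and v: "v \<in> lfibre L x"
  shows "\<tau>' v = \<tau> v * \<tau>' (lframe L \<tau> x)"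
  using trivializationD(5)[OF \<tau>' lframe(1)[OF \<tau>], of "\<tau> v"] lscale_lframe[OF \<tau> v] by simp

text \<open>The trivialisation of the tensor power evaluates a tensor on this form, and a tensor is
  \<open>undefined\<close> off \<open>multilinear_forms\<close>; every such evaluation relies on the
  membership.\<close>

lemma prod_form_in_multilinear_forms:
  assumes \<tau>: "trivialization M L U \<tau>" "x \<in> U"
  shows "(\<lambda>v\<in>{..<r} \<rightarrow>\<^sub>E lfibre L x. \<Prod>i<r. \<tau> (v i)) \<in> multilinear_forms L r x"
proof -
  have upd: "(\<Prod>j<r. \<tau> ((v(i := u)) j)) = \<tau> u * (\<Prod>j\<in>{..<r} - {i}. \<tau> (v j))" if "i < r" for v :: "nat \<Rightarrow> 'l" and i u
    using that by (subst prod.remove[of _ i]) auto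
  show ?thesis
    unfolding multilinear_forms_def
    using trivializationD(4,5)[OF \<tau>]
    by (auto simp: PiE_fun_upd_in lplus_in_lfibre lscale_in_lfibre upd distrib_right simp del: fun_upd_apply)
qed

lemma multilinear_forms_add:
  assumes "m \<in> multilinear_forms L r x" "m' \<in> multilinear_forms L r x"
  shows "(\<lambda>v\<in>{..<r} \<rightarrow>\<^sub>E lfibre L x. m v + m' v) \<in> multilinear_forms L r x"
  using assms multilinear_formsD[OF assms(1)] multilinear_formsD[OF assms(2)]
  by (simp add: multilinear_forms_def PiE_fun_upd_in lplus_in_lfibre lscale_in_lfibre distrib_left)

lemma multilinear_forms_scale:
  assumes "m \<in> multilinear_forms L r x"
  shows "(\<lambda>v\<in>{..<r} \<rightarrow>\<^sub>E lfibre L x. c * m v) \<in> multilinear_forms L r x"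
  using assms multilinear_formsD[OF assms]
  by (simp add: multilinear_forms_def PiE_fun_upd_in lplus_in_lfibre lscale_in_lfibre distrib_left)

lemma pure_tensor_in_tensor_fibre:
  assumes "\<And>i. i < r \<Longrightarrow> v i \<in> lfibre L x"
  shows "pure_tensor L r x v \<in> tensor_fibre L r x"
proof -
  have "restrict v {..<r} \<in> {..<r} \<rightarrow>\<^sub>E lfibre L x" using assms by auto
  then show ?thesis
    by (simp add: tensor_fibre_def pure_tensor_def multilinear_forms_add multilinear_forms_scale)
qed

lemma tensor_fibre_add:
  assumes "T \<in> tensor_fibre L r x" "T' \<in> tensor_fibre L r x"
  shows "(\<lambda>m\<in>multilinear_forms L r x. T m + T' m) \<in> tensor_fibre L r x"
  using assms by (simp add: tensor_fibre_def multilinear_forms_add multilinear_forms_scale distrib_left)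

lemma tensor_fibre_scale:
  assumes "T \<in> tensor_fibre L r x"
  shows "(\<lambda>m\<in>multilinear_forms L r x. c * T m) \<in> tensor_fibre L r x"
  using assms by (simp add: tensor_fibre_def multilinear_forms_add multilinear_forms_scale distrib_left)

text \<open>Multilinearity releases the scalar from one slot at a time, whence the induction on the
  number \<open>j\<close> of slots that carry it.\<close>

lemma pure_tensor_scale:
  assumes e: "e \<in> lfibre L x"
  shows "pure_tensor L r x (\<lambda>_. lscale L c e) = (\<lambda>m\<in>multilinear_forms L r x. c ^ r * pure_tensor L r x (\<lambda>_. e) m)"
  unfolding pure_tensor_def
proof (rule restrict_ext)
  fix m assume m: "m \<in> multilinear_forms L r x"
  have "m (\<lambda>i\<in>{..<r}. if i < j then lscale L c e else e) = c ^ j * m (\<lambda>i\<in>{..<r}. e)" if "j \<le> r" for j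
    using that
  proof (induction j)
    case (Suc j)
    let ?v = "\<lambda>i\<in>{..<r}. if i < j then lscale L c e else e"
    have v: "?v \<in> {..<r} \<rightarrow>\<^sub>E lfibre L x" using e lscale_in_lfibre by auto
    have j: "j < r" using Suc.prems by simp
    have "(\<lambda>i\<in>{..<r}. if i < Suc j then lscale L c e else e) = ?v(j := lscale L c e)"
      using j by (auto simp: fun_eq_iff less_Suc_eq)
    then have "m (\<lambda>i\<in>{..<r}. if i < Suc j then lscale L c e else e) = m (?v(j := lscale L c e))"
      by (simp only:)
    also have "\<dots> = c * m (?v(j := e))"
      by (rule multilinear_formsD(2)[OF m v j e])
    also have "?v(j := e) = ?v" using j by (auto simp: fun_eq_iff)
    also have "m ?v = c ^ j * m (\<lambda>i\<in>{..<r}. e)"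
      by (rule Suc.IH[OF Suc_leD[OF Suc.prems]])
    finally show ?case by (simp only: power_Suc mult.assoc)
  qed simp
  from this[of r] have "m (\<lambda>i\<in>{..<r}. lscale L c e) = c ^ r * m (\<lambda>i\<in>{..<r}. e)"
    by (simp cong: restrict_cong)
  then show "m (restrict (\<lambda>_. lscale L c e) {..<r}) =
      c ^ r * (\<lambda>m\<in>multilinear_forms L r x. m (restrict (\<lambda>_. e) {..<r})) m"
    using m by simp
qed

text \<open>The frame of \<open>\<tau>\<close> is \<open>\<tau>' (lframe L \<tau> x)\<close> times
  the frame of \<open>\<tau>'\<close>, and each of the \<open>r\<close> slots contributes this
  scalar once. The factor passes from \<open>\<tau>'\<close> to \<open>\<tau>\<close>, whereas the
  one of the Wronskians passes from \<open>\<tau>\<close> to \<open>\<tau>'\<close>.\<close>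

lemma frame_power_change:
  assumes \<tau>: "trivialization M L U \<tau>" and \<tau>': "trivialization M L U' \<tau>'" and x: "x \<in> U \<inter> U'"
  shows "frame_power L r U \<tau> x = lscale (tensor_power M L r) (\<tau>' (lframe L \<tau> x) ^ r) (frame_power L r U' \<tau>' x)"
  using x pure_tensor_scale[OF lframe(1)[OF \<tau>'], of x r "\<tau>' (lframe L \<tau> x)"]
    lscale_lframe[OF \<tau>' _ lframe(1)[OF \<tau>], of x]
  by (simp add: frame_power_def tensor_power_def)

section \<open>Holomorphic sections in arbitrary trivialisations\<close>

context
  assumes M: "complex_manifold M"
begin

text \<open>By definition a section is tested in members \<open>\<sigma>\<close> of
  \<open>ltrivs\<close>. Near each point its coordinate in \<open>\<tau>\<close> is the one in such
  a \<open>\<sigma>\<close> times the transition function from \<open>\<sigma>\<close> to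
  \<open>\<tau>\<close>, both holomorphic; locality does the rest.\<close>

lemma lsections_coordinate:
  assumes S: "S \<subseteq> topspace (mtop M)" and t: "t \<in> lsections M L S" and \<tau>: "trivialization M L U \<tau>"
  shows "(\<lambda>x\<in>S \<inter> U. \<tau> (t x)) \<in> hol_fun M (S \<inter> U)"
proof (rule hol_fun_local[OF M])
  show "S \<inter> U \<subseteq> topspace (mtop M)" using S by blast
  fix x assume x: "x \<in> S \<inter> U"
  obtain V \<sigma> where V: "(V, \<sigma>) \<in> ltrivs L" "x \<in> V" using ltrivs_cover x S by blast
  note \<sigma> = ltrivs_trivialization[OF V(1)]
  let ?W = "S \<inter> U \<inter> V"
  have "(\<lambda>x\<in>S \<inter> V. \<sigma> (t x)) \<in> hol_fun M (S \<inter> V)"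
    using t V(1) by (auto simp: lsections_def)
  then have 1: "restrict (\<lambda>x\<in>S \<inter> V. \<sigma> (t x)) ?W \<in> hol_fun M ?W"
    unfolding hol_fun_def by (rule hol_functions_restrict) (auto intro: chart_saturated_atlas[OF M])
  have 2: "restrict (\<lambda>x\<in>U \<inter> V. \<tau> (lframe L \<sigma> x)) ?W \<in> hol_fun M ?W"
    using trivializationD(6)[OF \<tau> V(1)]
    unfolding hol_fun_def by (rule hol_functions_restrict) (auto intro: chart_saturated_atlas[OF M])
  have "(\<lambda>x\<in>?W. restrict (\<lambda>x\<in>S \<inter> V. \<sigma> (t x)) ?W x * restrict (\<lambda>x\<in>U \<inter> V. \<tau> (lframe L \<sigma> x)) ?W x) \<in> hol_fun M ?W"
    using 1 2 unfolding hol_fun_def by (rule hol_functions_mult[OF chart_saturated_atlas[OF M]])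
  also have "(\<lambda>x\<in>?W. restrict (\<lambda>x\<in>S \<inter> V. \<sigma> (t x)) ?W x * restrict (\<lambda>x\<in>U \<inter> V. \<tau> (lframe L \<sigma> x)) ?W x)
      = restrict (\<lambda>x\<in>S \<inter> U. \<tau> (t x)) ?W"
  proof (rule restrict_ext)
    fix y assume y: "y \<in> ?W"
    then have "t y \<in> lfibre L y" using t by (auto simp: lsections_def)
    then show "restrict (\<lambda>x\<in>S \<inter> V. \<sigma> (t x)) ?W y * restrict (\<lambda>x\<in>U \<inter> V. \<tau> (lframe L \<sigma> x)) ?W y
        = (\<lambda>x\<in>S \<inter> U. \<tau> (t x)) y"
      using trivialization_change[OF \<sigma> _ \<tau>, of y "t y"] y by simp
  qed
  finally show "\<exists>T. openin (mtop M) T \<and> x \<in> T \<and> restrict (\<lambda>x\<in>S \<inter> U. \<tau> (t x)) (S \<inter> U \<inter> T) \<in> hol_fun M (S \<inter> U \<inter> T)"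
    using trivializationD(1)[OF \<sigma>] V(2) by blast
qed simp

text \<open>\<open>trivialization\<close> controls the transition functions from
  \<open>\<sigma>\<close> to \<open>\<tau>\<close>, whereas the coordinates of this frame are those
  from \<open>\<tau>\<close> to \<open>\<sigma>\<close>. The two are reciprocal and hence without
  zeros.\<close>

lemma lframe_in_lsections:
  assumes \<tau>: "trivialization M L U \<tau>"
  shows "(\<lambda>x\<in>U. lframe L \<tau> x) \<in> lsections M L U"
proof -
  have "(\<lambda>x\<in>U \<inter> V. \<sigma> ((\<lambda>x\<in>U. lframe L \<tau> x) x)) \<in> hol_fun M (U \<inter> V)" if V: "(V, \<sigma>) \<in> ltrivs L" for V \<sigma>
  proof -
    note \<sigma> = ltrivs_trivialization[OF V]
    have inv: "\<tau> (lframe L \<sigma> x) * \<sigma> (lframe L \<tau> x) = 1" if "x \<in> U \<inter> V" for x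
      using trivialization_change[OF \<tau> _ \<sigma> _ lframe(1)[OF \<sigma>], of x] lframe(2)[OF \<sigma>] that by simp
    let ?g = "\<lambda>x\<in>U \<inter> V. \<tau> (lframe L \<sigma> x)"
    have "(\<lambda>x\<in>U \<inter> V. inverse (?g x)) \<in> hol_fun M (U \<inter> V)"
      unfolding hol_fun_def
    proof (rule hol_functions_inverse[OF chart_saturated_atlas[OF M]])
      show "?g \<in> hol_functions (mdim M) (atlas M) (U \<inter> V)"
        using trivializationD(6)[OF \<tau> V] by (simp add: hol_fun_def)
      show "?g x \<noteq> 0" if "x \<in> U \<inter> V" for x using inv[OF that] that by auto
    qed
    also have "(\<lambda>x\<in>U \<inter> V. inverse (?g x)) = (\<lambda>x\<in>U \<inter> V. \<sigma> ((\<lambda>x\<in>U. lframe L \<tau> x) x))"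
      using inverse_unique[OF inv] by (intro restrict_ext) simp
    finally show ?thesis .
  qed
  then show ?thesis using lframe(1)[OF \<tau>] by (auto simp: lsections_def)
qed

lemma lsections_tensor_power_add:
  assumes U: "U \<subseteq> topspace (mtop M)"
    and s: "s \<in> lsections M (tensor_power M L r) U" and t: "t \<in> lsections M (tensor_power M L r) U"
  shows "(\<lambda>x\<in>U. lplus (tensor_power M L r) (s x) (t x)) \<in> lsections M (tensor_power M L r) U"
proof -
  obtain S where S: "\<And>x. x \<in> U \<Longrightarrow> s x = (x, S x)" "\<And>x. x \<in> U \<Longrightarrow> S x \<in> tensor_fibre L r x"
    "\<And>V \<sigma>. (V, \<sigma>) \<in> ltrivs L \<Longrightarrow>
      (\<lambda>x\<in>U \<inter> V. S x (\<lambda>v\<in>{..<r} \<rightarrow>\<^sub>E lfibre L x. \<Prod>i<r. \<sigma> (v i))) \<in> hol_fun M (U \<inter> V)"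
    by (rule lsections_tensor_powerE[OF s]) blast
  obtain T where T: "\<And>x. x \<in> U \<Longrightarrow> t x = (x, T x)" "\<And>x. x \<in> U \<Longrightarrow> T x \<in> tensor_fibre L r x"
    "\<And>V \<sigma>. (V, \<sigma>) \<in> ltrivs L \<Longrightarrow>
      (\<lambda>x\<in>U \<inter> V. T x (\<lambda>v\<in>{..<r} \<rightarrow>\<^sub>E lfibre L x. \<Prod>i<r. \<sigma> (v i))) \<in> hol_fun M (U \<inter> V)"
    by (rule lsections_tensor_powerE[OF t]) blast
  show ?thesis
  proof (rule lsections_tensor_powerI[OF _ U, where T = "\<lambda>x. \<lambda>m\<in>multilinear_forms L r x. S x m + T x m"])
    fix x assume x: "x \<in> U"
    show "(\<lambda>x\<in>U. lplus (tensor_power M L r) (s x) (t x)) x = (x, \<lambda>m\<in>multilinear_forms L r x. S x m + T x m) \<and>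
        (\<lambda>m\<in>multilinear_forms L r x. S x m + T x m) \<in> tensor_fibre L r x"
      using x S(1)[OF x] T(1)[OF x] tensor_fibre_add[OF S(2)[OF x] T(2)[OF x]] by (simp add: tensor_power_def)
  next
    fix V \<sigma> assume V: "(V, \<sigma>) \<in> ltrivs L"
    let ?f = "\<lambda>x. \<lambda>v\<in>{..<r} \<rightarrow>\<^sub>E lfibre L x. \<Prod>i<r. \<sigma> (v i)"
    have "(\<lambda>x\<in>U \<inter> V. (\<lambda>x\<in>U \<inter> V. S x (?f x)) x + (\<lambda>x\<in>U \<inter> V. T x (?f x)) x) \<in> hol_fun M (U \<inter> V)"
      using S(3)[OF V] T(3)[OF V] unfolding hol_fun_def by (rule hol_functions_add[OF chart_saturated_atlas[OF M]])
    also have "(\<lambda>x\<in>U \<inter> V. (\<lambda>x\<in>U \<inter> V. S x (?f x)) x + (\<lambda>x\<in>U \<inter> V. T x (?f x)) x) =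
        (\<lambda>x\<in>U \<inter> V. (\<lambda>m\<in>multilinear_forms L r x. S x m + T x m) (?f x))"
      using prod_form_in_multilinear_forms[OF ltrivs_trivialization[OF V]] by (intro restrict_ext) simp
    finally show "(\<lambda>x\<in>U \<inter> V. (\<lambda>m\<in>multilinear_forms L r x. S x m + T x m) (?f x)) \<in> hol_fun M (U \<inter> V)" .
  qed simp
qed

lemma lsections_tensor_power_act:
  assumes U: "U \<subseteq> topspace (mtop M)"
    and a: "a \<in> hol_fun M U" and t: "t \<in> lsections M (tensor_power M L r) U"
  shows "(\<lambda>x\<in>U. lscale (tensor_power M L r) (a x) (t x)) \<in> lsections M (tensor_power M L r) U"
proof -
  obtain T where T: "\<And>x. x \<in> U \<Longrightarrow> t x = (x, T x)" "\<And>x. x \<in> U \<Longrightarrow> T x \<in> tensor_fibre L r x"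
    "\<And>V \<sigma>. (V, \<sigma>) \<in> ltrivs L \<Longrightarrow>
      (\<lambda>x\<in>U \<inter> V. T x (\<lambda>v\<in>{..<r} \<rightarrow>\<^sub>E lfibre L x. \<Prod>i<r. \<sigma> (v i))) \<in> hol_fun M (U \<inter> V)"
    by (rule lsections_tensor_powerE[OF t]) blast
  show ?thesis
  proof (rule lsections_tensor_powerI[OF _ U, where T = "\<lambda>x. \<lambda>m\<in>multilinear_forms L r x. a x * T x m"])
    fix x assume x: "x \<in> U"
    show "(\<lambda>x\<in>U. lscale (tensor_power M L r) (a x) (t x)) x = (x, \<lambda>m\<in>multilinear_forms L r x. a x * T x m) \<and>
        (\<lambda>m\<in>multilinear_forms L r x. a x * T x m) \<in> tensor_fibre L r x"
      using x T(1)[OF x] tensor_fibre_scale[OF T(2)[OF x]] by (simp add: tensor_power_def)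
  next
    fix V \<sigma> assume V: "(V, \<sigma>) \<in> ltrivs L"
    let ?f = "\<lambda>x. \<lambda>v\<in>{..<r} \<rightarrow>\<^sub>E lfibre L x. \<Prod>i<r. \<sigma> (v i)"
    have "restrict a (U \<inter> V) \<in> hol_fun M (U \<inter> V)"
      using a unfolding hol_fun_def by (rule hol_functions_restrict) (auto intro: chart_saturated_atlas[OF M])
    then have "(\<lambda>x\<in>U \<inter> V. restrict a (U \<inter> V) x * (\<lambda>x\<in>U \<inter> V. T x (?f x)) x) \<in> hol_fun M (U \<inter> V)"
      using T(3)[OF V] unfolding hol_fun_def by (rule hol_functions_mult[OF chart_saturated_atlas[OF M]])
    also have "(\<lambda>x\<in>U \<inter> V. restrict a (U \<inter> V) x * (\<lambda>x\<in>U \<inter> V. T x (?f x)) x) =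
        (\<lambda>x\<in>U \<inter> V. (\<lambda>m\<in>multilinear_forms L r x. a x * T x m) (?f x))"
      using prod_form_in_multilinear_forms[OF ltrivs_trivialization[OF V]] by (intro restrict_ext) simp
    finally show "(\<lambda>x\<in>U \<inter> V. (\<lambda>m\<in>multilinear_forms L r x. a x * T x m) (?f x)) \<in> hol_fun M (U \<inter> V)" .
  qed simp
qed

text \<open>In the trivialisation induced by \<open>\<sigma>\<close>, the decomposable tensor
  evaluates the product form on a constant family, which gives a product of \<open>r\<close> copies
  of the coordinate of the frame.\<close>

lemma frame_power_in_lsections:
  assumes \<tau>: "trivialization M L U \<tau>"
  shows "frame_power L r U \<tau> \<in> lsections M (tensor_power M L r) U"
proof (rule lsections_tensor_powerI[where T = "\<lambda>x. pure_tensor L r x (\<lambda>_. lframe L \<tau> x)"])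
  show "frame_power L r U \<tau> \<in> extensional U" by (simp add: frame_power_def)
  show "U \<subseteq> topspace (mtop M)" by (rule trivializationD(2)[OF \<tau>])
  show "frame_power L r U \<tau> x = (x, pure_tensor L r x (\<lambda>_. lframe L \<tau> x)) \<and>
      pure_tensor L r x (\<lambda>_. lframe L \<tau> x) \<in> tensor_fibre L r x" if "x \<in> U" for x
    using that pure_tensor_in_tensor_fibre[of r "\<lambda>_. lframe L \<tau> x" x] lframe(1)[OF \<tau>] by (simp add: frame_power_def)
  fix V \<sigma> assume V: "(V, \<sigma>) \<in> ltrivs L"
  let ?f = "\<lambda>x. \<lambda>v\<in>{..<r} \<rightarrow>\<^sub>E lfibre L x. \<Prod>i<r. \<sigma> (v i)"
  have "(\<lambda>x\<in>U \<inter> V. \<sigma> (lframe L \<tau> x)) \<in> hol_fun M (U \<inter> V)"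
    using lsections_coordinate[OF trivializationD(2)[OF \<tau>] lframe_in_lsections[OF \<tau>] ltrivs_trivialization[OF V]]
    by (simp cong: restrict_cong)
  then have "(\<lambda>x\<in>U \<inter> V. \<Prod>i<r. \<sigma> (lframe L \<tau> x)) \<in> hol_fun M (U \<inter> V)"
    unfolding hol_fun_def by (rule hol_functions_prod[OF chart_saturated_atlas[OF M]])
  also have "(\<lambda>x\<in>U \<inter> V. \<Prod>i<r. \<sigma> (lframe L \<tau> x)) =
      (\<lambda>x\<in>U \<inter> V. pure_tensor L r x (\<lambda>_. lframe L \<tau> x) (?f x))"
  proof (rule restrict_ext)
    fix x assume x: "x \<in> U \<inter> V"
    have "(\<lambda>i\<in>{..<r}. lframe L \<tau> x) \<in> {..<r} \<rightarrow>\<^sub>E lfibre L x" using lframe(1)[OF \<tau>] x by auto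
    then show "(\<Prod>i<r. \<sigma> (lframe L \<tau> x)) = pure_tensor L r x (\<lambda>_. lframe L \<tau> x) (?f x)"
      using prod_form_in_multilinear_forms[OF ltrivs_trivialization[OF V]] x by (simp add: pure_tensor_def)
  qed
  finally show "(\<lambda>x\<in>U \<inter> V. pure_tensor L r x (\<lambda>_. lframe L \<tau> x) (?f x)) \<in> hol_fun M (U \<inter> V)" .
qed

lemma lwronskian_in_inv_jet_diff:
  assumes \<tau>: "trivialization M L U \<tau>" and s: "\<And>i. i \<le> k \<Longrightarrow> s i \<in> lsections M L (topspace (mtop M))"
  shows "lwronskian M L k U \<tau> s \<in> inv_jet_diff M k (k * (k + 1) div 2) U"
proof -
  have "(\<lambda>x\<in>U. \<tau> (s i x)) \<in> hol_fun M U" if "i \<le> k" for i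
    using lsections_coordinate[OF subset_refl s[OF that] \<tau>] trivializationD(2)[OF \<tau>] by (simp add: Int_absorb1)
  then show ?thesis
    unfolding lwronskian_def by (rule wronskian_in_inv_jet_diff[OF M trivializationD(1)[OF \<tau>]])
qed

lemma lwronskian_change:
  assumes \<tau>: "trivialization M L U \<tau>" and \<tau>': "trivialization M L U' \<tau>'"
    and s: "\<And>i. i \<le> k \<Longrightarrow> s i \<in> lsections M L (topspace (mtop M))"
    and j: "j \<in> jets_over M k (U \<inter> U')"
  shows "lwronskian M L k U' \<tau>' s j = \<tau>' (lframe L \<tau> (jet_proj j)) ^ (k + 1) * lwronskian M L k U \<tau> s j"
proof -
  let ?g = "\<lambda>x\<in>U \<inter> U'. \<tau>' (lframe L \<tau> x)"
  \<comment> \<open>The transition function is the coordinate in \<open>\<tau>'\<close> of a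
    section, the frame of \<open>\<tau>\<close>, and so is holomorphic for any two
    trivialisations.\<close>
  have g: "?g \<in> hol_fun M (U \<inter> U')"
    using lsections_coordinate[OF trivializationD(2)[OF \<tau>] lframe_in_lsections[OF \<tau>] \<tau>']
    by (simp cong: restrict_cong)
  have hol: "(\<lambda>x\<in>U. \<tau> (s i x)) \<in> hol_fun M U" if "i \<le> k" for i
    using lsections_coordinate[OF subset_refl s[OF that] \<tau>] trivializationD(2)[OF \<tau>] by (simp add: Int_absorb1)
  have change: "(\<lambda>x\<in>U'. \<tau>' (s i x)) x = (\<lambda>x\<in>U. \<tau> (s i x)) x * ?g x" if "i \<le> k" "x \<in> U \<inter> U'" for i x
  proof -
    have "s i x \<in> lfibre L x" using s[OF that(1)] that(2) trivializationD(2)[OF \<tau>] by (auto simp: lsections_def)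
    then show ?thesis using trivialization_change[OF \<tau> _ \<tau>'] that(2) by simp
  qed
  have "lwronskian M L k U' \<tau>' s j = ?g (jet_proj j) ^ (k + 1) * lwronskian M L k U \<tau> s j"
    unfolding lwronskian_def
    by (rule wronskian_mult[OF M trivializationD(1)[OF \<tau>] trivializationD(1)[OF \<tau>'] hol g change j])
  then show ?thesis using jets_overD(3)[OF j] by simp
qed

end

end

section \<open>Tensor products of sheaves of modules\<close>

text \<open>A common interface to jet differentials and sections of bundles, made of what
  restriction of tensors and comparison of germs use. In \<open>res_act\<close> the scalar is
  restricted along with the section, since a holomorphic function on \<open>V\<close> is
  \<open>undefined\<close> off \<open>V\<close>.\<close>

locale module_presheaf =
  fixes M :: "'a manifold" and F :: "('a, 'f) module_sheaf"
  assumes complex_manifold: "complex_manifold M"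
    and plus_closed: "openin (mtop M) U \<Longrightarrow> f \<in> sh_sec F U \<Longrightarrow> f' \<in> sh_sec F U \<Longrightarrow> sh_plus F U f f' \<in> sh_sec F U"
    and act_closed: "openin (mtop M) U \<Longrightarrow> a \<in> hol_fun M U \<Longrightarrow> f \<in> sh_sec F U \<Longrightarrow> sh_act F U a f \<in> sh_sec F U"
    and res_closed: "V \<subseteq> U \<Longrightarrow> f \<in> sh_sec F U \<Longrightarrow> sh_res F V f \<in> sh_sec F V"
    and res_plus: "V \<subseteq> U \<Longrightarrow> sh_res F V (sh_plus F U f f') = sh_plus F V (sh_res F V f) (sh_res F V f')"
    and res_act: "V \<subseteq> U \<Longrightarrow> sh_res F V (sh_act F U a f) = sh_act F V (restrict a V) (sh_res F V f)"
    and res_res: "W \<subseteq> V \<Longrightarrow> sh_res F W (sh_res F V f) = sh_res F W f"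

lemma inv_jet_sheaf_presheaf:
  assumes M: "complex_manifold M"
  shows "module_presheaf M (inv_jet_sheaf M k m)"
proof
  show "sh_res (inv_jet_sheaf M k m) V (sh_plus (inv_jet_sheaf M k m) U f f') =
      sh_plus (inv_jet_sheaf M k m) V (sh_res (inv_jet_sheaf M k m) V f) (sh_res (inv_jet_sheaf M k m) V f')"
    if "V \<subseteq> U" for V U f f'
    using jets_over_mono[OF that, of M k] by (auto simp: inv_jet_sheaf_def fun_eq_iff)
  show "sh_res (inv_jet_sheaf M k m) V (sh_act (inv_jet_sheaf M k m) U a f) =
      sh_act (inv_jet_sheaf M k m) V (restrict a V) (sh_res (inv_jet_sheaf M k m) V f)"
    if "V \<subseteq> U" for V U a f
    using jets_over_mono[OF that, of M k] jets_overD(3)[of _ M k V] by (auto simp: inv_jet_sheaf_def fun_eq_iff)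
  show "sh_res (inv_jet_sheaf M k m) W (sh_res (inv_jet_sheaf M k m) V f) = sh_res (inv_jet_sheaf M k m) W f"
    if "W \<subseteq> V" for W V f
    using jets_over_mono[OF that, of M k] by (auto simp: inv_jet_sheaf_def fun_eq_iff)
qed (simp_all add: M inv_jet_sheaf_def inv_jet_diff_add[OF M] inv_jet_diff_act[OF M] inv_jet_diff_restrict[OF M])

lemma tensor_power_presheaf:
  assumes M: "complex_manifold M" and L: "holomorphic_line_bundle M L"
  shows "module_presheaf M (bundle_sheaf M (tensor_power M L r))"
proof
  show "sh_res (bundle_sheaf M (tensor_power M L r)) V (sh_plus (bundle_sheaf M (tensor_power M L r)) U f f') =
      sh_plus (bundle_sheaf M (tensor_power M L r)) V (sh_res (bundle_sheaf M (tensor_power M L r)) V f)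
        (sh_res (bundle_sheaf M (tensor_power M L r)) V f')"
    if "V \<subseteq> U" for V U f f'
    using that by (auto simp: bundle_sheaf_def fun_eq_iff)
  show "sh_res (bundle_sheaf M (tensor_power M L r)) V (sh_act (bundle_sheaf M (tensor_power M L r)) U a f) =
      sh_act (bundle_sheaf M (tensor_power M L r)) V (restrict a V) (sh_res (bundle_sheaf M (tensor_power M L r)) V f)"
    if "V \<subseteq> U" for V U a f
    using that by (auto simp: bundle_sheaf_def fun_eq_iff)
  show "sh_res (bundle_sheaf M (tensor_power M L r)) W (sh_res (bundle_sheaf M (tensor_power M L r)) V f) =
      sh_res (bundle_sheaf M (tensor_power M L r)) W f"
    if "W \<subseteq> V" for W V f
    using that by (auto simp: bundle_sheaf_def fun_eq_iff)
qed (simp_all add: M bundle_sheaf_def openin_subset lsections_tensor_power_add[OF L M]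
    lsections_tensor_power_act[OF L M] lsections_restrict[OF M])

section \<open>Relations and germs in the presheaf tensor product\<close>

locale tensor_presheaf = F: module_presheaf M F + G: module_presheaf M G
  for M :: "'a manifold" and F :: "('a, 'f) module_sheaf" and G :: "('a, 'g) module_sheaf"

begin

definition rel_gen :: "'a set \<Rightarrow> ('f \<times> 'g \<Rightarrow>\<^sub>0 int) set" where
  "rel_gen U =
     {frag_of (sh_plus F U f f', g) - frag_of (f, g) - frag_of (f', g) |f f' g.
         f \<in> sh_sec F U \<and> f' \<in> sh_sec F U \<and> g \<in> sh_sec G U} \<union>
      {frag_of (f, sh_plus G U g g') - frag_of (f, g) - frag_of (f, g') |f g g'.
         f \<in> sh_sec F U \<and> g \<in> sh_sec G U \<and> g' \<in> sh_sec G U} \<union>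
      {frag_of (sh_act F U a f, g) - frag_of (f, sh_act G U a g) |a f g.
         a \<in> hol_fun M U \<and> f \<in> sh_sec F U \<and> g \<in> sh_sec G U}"

lemma tensor_rel_eq: "tensor_rel M F G U = generate (tensor_gen F G U) (rel_gen U)"
  by (simp add: tensor_rel_def rel_gen_def)

lemma carrier_tensor_gen: "c \<in> carrier (tensor_gen F G U) \<longleftrightarrow> Poly_Mapping.keys c \<subseteq> sh_sec F U \<times> sh_sec G U"
  by (simp add: tensor_gen_def)

lemma carrier_tensor_gen_diff:
  "c \<in> carrier (tensor_gen F G U) \<Longrightarrow> d \<in> carrier (tensor_gen F G U) \<Longrightarrow> c - d \<in> carrier (tensor_gen F G U)"
  unfolding carrier_tensor_gen using keys_diff[of c d] by blast

lemma carrier_tensor_gen_frag_of: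
  "frag_of (f, g) \<in> carrier (tensor_gen F G U) \<longleftrightarrow> f \<in> sh_sec F U \<and> g \<in> sh_sec G U"
  by (simp add: carrier_tensor_gen)

text \<open>Facts about \<open>generate\<close>, such as closure under inverses, presuppose
  generators in the carrier. Openness of \<open>U\<close> enters because the operations are known to
  preserve sections over open sets.\<close>

lemma rel_gen_subset_carrier:
  assumes "openin (mtop M) U"
  shows "rel_gen U \<subseteq> carrier (tensor_gen F G U)"
  unfolding rel_gen_def
  using assms
  by (auto intro!: carrier_tensor_gen_diff
      simp: carrier_tensor_gen_frag_of F.plus_closed F.act_closed G.plus_closed G.act_closed simp del: carrier_free_Abelian_group_iff)

lemma tensor_rel_act:
  assumes "a \<in> hol_fun M U" "f \<in> sh_sec F U" "g \<in> sh_sec G U"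
  shows "frag_of (sh_act F U a f, g) - frag_of (f, sh_act G U a g) \<in> tensor_rel M F G U"
proof -
  have "frag_of (sh_act F U a f, g) - frag_of (f, sh_act G U a g) \<in> rel_gen U"
    unfolding rel_gen_def using assms by blast
  then show ?thesis unfolding tensor_rel_eq by (rule generate.incl)
qed

lemma tensor_rel_add:
  "c \<in> tensor_rel M F G U \<Longrightarrow> d \<in> tensor_rel M F G U \<Longrightarrow> c + d \<in> tensor_rel M F G U"
  using generate.eng[of c "tensor_gen F G U" "rel_gen U" d] by (simp add: tensor_rel_eq tensor_gen_def)

lemma tensor_rel_uminus:
  assumes U: "openin (mtop M) U" and c: "c \<in> tensor_rel M F G U"
  shows "- c \<in> tensor_rel M F G U"
proof -
  have grp: "group (tensor_gen F G U)" by (simp add: tensor_gen_def)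
  have "c \<in> carrier (tensor_gen F G U)"
    using group.generate_in_carrier[OF grp rel_gen_subset_carrier[OF U]] c by (simp add: tensor_rel_eq)
  then have "inv\<^bsub>tensor_gen F G U\<^esub> c = - c"
    unfolding tensor_gen_def by (intro inv_free_Abelian_group) simp
  moreover have "inv\<^bsub>tensor_gen F G U\<^esub> c \<in> tensor_rel M F G U"
    using group.generate_m_inv_closed[OF grp rel_gen_subset_carrier[OF U]] c by (simp add: tensor_rel_eq)
  ultimately show ?thesis by simp
qed

lemma tensor_res_frag_of: "tensor_res F G V (frag_of (f, g)) = frag_of (sh_res F V f, sh_res G V g)"
  by (simp add: tensor_res_def)

lemma tensor_res_diff: "tensor_res F G V (c - d) = tensor_res F G V c - tensor_res F G V d"
  by (simp add: tensor_res_def frag_extend_diff)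

lemma tensor_res_res:
  assumes "W \<subseteq> V"
  shows "tensor_res F G W (tensor_res F G V c) = tensor_res F G W c"
proof -
  let ?h = "\<lambda>V (f, g). (sh_res F V f, sh_res G V g)"
  have res: "tensor_res F G V = frag_extend (frag_of \<circ> ?h V)" for V
    by (auto simp: tensor_res_def fun_eq_iff intro!: arg_cong2[where f = frag_extend])
  have "frag_extend ((frag_of \<circ> ?h W) \<circ> ?h V) c = frag_extend (frag_of \<circ> ?h W) c"
    using assms by (intro frag_extend_eq) (auto simp: F.res_res G.res_res)
  then show ?thesis unfolding res frag_extend_compose .
qed

lemma rel_gen_res:
  assumes V: "V \<subseteq> U" and c: "c \<in> rel_gen U"
  shows "tensor_res F G V c \<in> rel_gen V"
proof -
  have a: "restrict a V \<in> hol_fun M V" if "a \<in> hol_fun M U" for a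
    using that V unfolding hol_fun_def
    by (rule hol_functions_restrict[OF _ _ chart_saturated_atlas[OF F.complex_manifold]])
  consider (plus1) f f' g where "c = frag_of (sh_plus F U f f', g) - frag_of (f, g) - frag_of (f', g)"
      "f \<in> sh_sec F U" "f' \<in> sh_sec F U" "g \<in> sh_sec G U"
    | (plus2) f g g' where "c = frag_of (f, sh_plus G U g g') - frag_of (f, g) - frag_of (f, g')"
      "f \<in> sh_sec F U" "g \<in> sh_sec G U" "g' \<in> sh_sec G U"
    | (act) a f g where "c = frag_of (sh_act F U a f, g) - frag_of (f, sh_act G U a g)"
      "a \<in> hol_fun M U" "f \<in> sh_sec F U" "g \<in> sh_sec G U"
    using c unfolding rel_gen_def by blast
  then show ?thesis
  proof cases
    case plus1
    then show ?thesis
      unfolding rel_gen_def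
      by (intro UnI1, simp add: tensor_res_diff tensor_res_frag_of F.res_plus[OF V])
        (blast intro: F.res_closed[OF V] G.res_closed[OF V])
  next
    case plus2
    then show ?thesis
      unfolding rel_gen_def
      by (intro UnI1 UnI2, simp add: tensor_res_diff tensor_res_frag_of G.res_plus[OF V])
        (blast intro: F.res_closed[OF V] G.res_closed[OF V])
  next
    case act
    then show ?thesis
      unfolding rel_gen_def
      by (intro UnI2, simp add: tensor_res_diff tensor_res_frag_of F.res_act[OF V] G.res_act[OF V])
        (blast intro: F.res_closed[OF V] G.res_closed[OF V] a)
  qed
qed

text \<open>Restriction is additive and sends each kind of generator to a generator of the same
  kind, hence the generated subgroup into the generated subgroup.\<close>

lemma tensor_rel_res:
  assumes U: "openin (mtop M) U" and V: "openin (mtop M) V" "V \<subseteq> U" and c: "c \<in> tensor_rel M F G U"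
  shows "tensor_res F G V c \<in> tensor_rel M F G V"
  using c unfolding tensor_rel_eq[of U]
proof (induction rule: generate.induct)
  case one
  then show ?case
    using generate.one[of "tensor_gen F G V" "rel_gen V"] by (simp add: tensor_rel_eq tensor_gen_def tensor_res_def)
next
  case (incl h)
  then show ?case using generate.incl[OF rel_gen_res[OF V(2)]] by (simp add: tensor_rel_eq)
next
  case (inv h)
  \<comment> \<open>The inverse in the free abelian group is negation for elements of the carrier,
    so membership has to be established before it can be rewritten.\<close>
  have "Poly_Mapping.keys h \<subseteq> sh_sec F U \<times> sh_sec G U"
    using subsetD[OF rel_gen_subset_carrier[OF U] inv] by (simp add: carrier_tensor_gen)
  then have "inv\<^bsub>tensor_gen F G U\<^esub> h = - h" by (simp add: tensor_gen_def)
  moreover have "tensor_res F G V h \<in> tensor_rel M F G V"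
    using generate.incl[OF rel_gen_res[OF V(2) inv]] by (simp add: tensor_rel_eq)
  ultimately show ?case
    using tensor_rel_uminus[OF V(1)] by (simp add: tensor_res_def frag_extend_minus)
next
  case (eng h1 h2)
  then show ?case
    using tensor_rel_add by (simp add: tensor_gen_def tensor_res_def frag_extend_add)
qed

text \<open>Transitivity: the relation on \<open>W\<close> and the one that places a representative
  in the germ are both restricted to the intersection of their neighbourhoods, and their difference
  relates the representative to \<open>c'\<close>.\<close>

lemma tensor_germ_subset:
  assumes W: "openin (mtop M) W" "x \<in> W" "W \<subseteq> U \<inter> U'"
    and rel: "tensor_res F G W c - tensor_res F G W c' \<in> tensor_rel M F G W"
  shows "tensor_germ M F G x U c \<subseteq> tensor_germ M F G x U' c'"
proof
  fix z assume "z \<in> tensor_germ M F G x U c"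
  then obtain V' d W' where z: "z = (V', d)" "openin (mtop M) V'" "x \<in> V'" "d \<in> carrier (tensor_gen F G V')"
    and W': "openin (mtop M) W'" "x \<in> W'" "W' \<subseteq> U \<inter> V'"
    and rel': "tensor_res F G W' c - tensor_res F G W' d \<in> tensor_rel M F G W'"
    by (auto simp: tensor_germ_def)
  let ?W = "W \<inter> W'"
  have oW: "openin (mtop M) ?W" using W W' by blast
  have 1: "tensor_res F G ?W c - tensor_res F G ?W c' \<in> tensor_rel M F G ?W"
    using tensor_rel_res[OF W(1) oW _ rel] by (simp add: tensor_res_diff tensor_res_res)
  have 2: "tensor_res F G ?W c - tensor_res F G ?W d \<in> tensor_rel M F G ?W"
    using tensor_rel_res[OF W'(1) oW _ rel'] by (simp add: tensor_res_diff tensor_res_res)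
  have "tensor_res F G ?W c' - tensor_res F G ?W d \<in> tensor_rel M F G ?W"
    using tensor_rel_add[OF tensor_rel_uminus[OF oW 1] 2] by simp
  moreover have "x \<in> ?W" "?W \<subseteq> U' \<inter> V'" using W W' by auto
  ultimately show "z \<in> tensor_germ M F G x U' c'"
    using z oW unfolding tensor_germ_def by blast
qed

lemma tensor_germ_eqI:
  assumes W: "openin (mtop M) W" "x \<in> W" "W \<subseteq> U \<inter> U'"
    and rel: "tensor_res F G W c - tensor_res F G W c' \<in> tensor_rel M F G W"
  shows "tensor_germ M F G x U c = tensor_germ M F G x U' c'"
proof
  show "tensor_germ M F G x U c \<subseteq> tensor_germ M F G x U' c'"
    by (rule tensor_germ_subset[OF assms])
  have "tensor_res F G W c' - tensor_res F G W c \<in> tensor_rel M F G W"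
    using tensor_rel_uminus[OF W(1) rel] by simp
  then show "tensor_germ M F G x U' c' \<subseteq> tensor_germ M F G x U c"
    using W by (intro tensor_germ_subset[of W]) auto
qed

end

section \<open>Gluing the local tensors\<close>

theorem proposition2p3:
  fixes X :: "'a manifold" and L :: "('a, 'l) line_bundle"
    and k :: nat and s :: "nat \<Rightarrow> 'a \<Rightarrow> 'l"
  assumes "complex_manifold X"
    and "holomorphic_line_bundle X L"
    and "\<And>j. j \<le> k \<Longrightarrow> s j \<in> lsections X L (topspace (mtop X))"
  defines "E \<equiv> inv_jet_sheaf X k (k * (k + 1) div 2)"
    and "Lk \<equiv> bundle_sheaf X (tensor_power X L (k + 1))"
  shows "(\<forall>U \<tau>. trivialization X L U \<tau> \<longrightarrow> lwronskian X L k U \<tau> s \<in> sh_sec E U) \<and>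
    (\<exists>!W. W \<in> tensor_sections X E Lk (topspace (mtop X)) \<and>
      (\<forall>U \<tau>. trivialization X L U \<tau> \<longrightarrow>
        restrict W U =
          tensor_of X E Lk U (lwronskian X L k U \<tau> s) (frame_power L (k + 1) U \<tau>)))"
proof -
  note X = assms(1) and L = assms(2) and s = assms(3)
  interpret tensor_presheaf X E Lk
    unfolding E_def Lk_def
    by (intro tensor_presheaf.intro inv_jet_sheaf_presheaf[OF X] tensor_power_presheaf[OF X L])
  note trivD = trivializationD[where M = X and L = L]
  let ?w = "\<lambda>U \<tau>. lwronskian X L k U \<tau> s"
  let ?e = "\<lambda>U \<tau>. frame_power L (k + 1) U \<tau>"
  let ?germ = "\<lambda>x U \<tau>. tensor_germ X E Lk x U (frag_of (?w U \<tau>, ?e U \<tau>))"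
  have wE: "?w U \<tau> \<in> sh_sec E U" if "trivialization X L U \<tau>" for U \<tau>
    using lwronskian_in_inv_jet_diff[where k = k and s = s, OF L X that s] by (simp add: E_def inv_jet_sheaf_def)
  have eLk: "?e U \<tau> \<in> sh_sec Lk U" if "trivialization X L U \<tau>" for U \<tau>
    using frame_power_in_lsections[OF L X that] by (simp add: Lk_def bundle_sheaf_def)
  have germ_eq: "?germ x U \<tau> = ?germ x U' \<tau>'"
    if \<tau>: "trivialization X L U \<tau>" and \<tau>': "trivialization X L U' \<tau>'" and x: "x \<in> U \<inter> U'" for x U \<tau> U' \<tau>'
  proof -
    let ?W = "U \<inter> U'"
    have W: "openin (mtop X) ?W" using trivD(1)[OF \<tau>] trivD(1)[OF \<tau>'] by blast
    have w: "restrict (?w U \<tau>) (jets_over X k ?W) \<in> sh_sec E ?W"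
      using F.res_closed[OF Int_lower1 wE[OF \<tau>], of U'] by (simp add: E_def inv_jet_sheaf_def)
    have e: "restrict (?e U' \<tau>') ?W \<in> sh_sec Lk ?W"
      using G.res_closed[OF Int_lower2 eLk[OF \<tau>'], of U] by (simp add: Lk_def bundle_sheaf_def)
    \<comment> \<open>The scalar to be moved across the tensor sign. Both local tensors are written
      through the Wronskian in \<open>\<tau>\<close> and the frame of \<open>\<tau>'\<close>: over
      \<open>U'\<close> the scalar then sits on the jet differential, over \<open>U\<close> on the
      section of the tensor power.\<close>
    define a where "a = (\<lambda>x\<in>?W. \<tau>' (lframe L \<tau> x) ^ (k + 1))"
    have a: "a \<in> hol_fun X ?W"
    proof -
      have "(\<lambda>x\<in>?W. \<tau>' (lframe L \<tau> x)) \<in> hol_fun X ?W"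
        using lsections_coordinate[OF L X trivD(2)[OF \<tau>] lframe_in_lsections[OF L X \<tau>] \<tau>']
        by (simp cong: restrict_cong)
      then have "(\<lambda>x\<in>?W. \<Prod>i<k + 1. \<tau>' (lframe L \<tau> x)) \<in> hol_fun X ?W"
        unfolding hol_fun_def by (rule hol_functions_prod[OF chart_saturated_atlas[OF X]])
      then show ?thesis by (simp add: a_def)
    qed
    have res': "tensor_res E Lk ?W (frag_of (?w U' \<tau>', ?e U' \<tau>')) =
        frag_of (sh_act E ?W a (restrict (?w U \<tau>) (jets_over X k ?W)), restrict (?e U' \<tau>') ?W)"
    proof -
      have "restrict (?w U' \<tau>') (jets_over X k ?W) = sh_act E ?W a (restrict (?w U \<tau>) (jets_over X k ?W))"
        using lwronskian_change[where k = k and s = s, OF L X \<tau> \<tau>' s] jets_overD(3)[of _ X k ?W]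
        by (auto simp: E_def inv_jet_sheaf_def a_def fun_eq_iff)
      then show ?thesis
        by (simp add: tensor_res_frag_of) (simp add: E_def Lk_def inv_jet_sheaf_def bundle_sheaf_def)
    qed
    have res: "tensor_res E Lk ?W (frag_of (?w U \<tau>, ?e U \<tau>)) =
        frag_of (restrict (?w U \<tau>) (jets_over X k ?W), sh_act Lk ?W a (restrict (?e U' \<tau>') ?W))"
    proof -
      have "restrict (?e U \<tau>) ?W = sh_act Lk ?W a (restrict (?e U' \<tau>') ?W)"
        using frame_power_change[OF L \<tau> \<tau>']
        by (auto simp: Lk_def bundle_sheaf_def a_def fun_eq_iff)
      then show ?thesis
        by (simp add: tensor_res_frag_of) (simp add: E_def Lk_def inv_jet_sheaf_def bundle_sheaf_def)
    qed
    have "tensor_res E Lk ?W (frag_of (?w U' \<tau>', ?e U' \<tau>')) -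
        tensor_res E Lk ?W (frag_of (?w U \<tau>, ?e U \<tau>)) \<in> tensor_rel X E Lk ?W"
      unfolding res res' by (rule tensor_rel_act[OF a w e])
    then show ?thesis
      using tensor_germ_eqI[OF W x, of U' U] by blast
  qed
  \<comment> \<open>One trivialisation is chosen at each point without any coherence between the
    points; \<open>germ_eq\<close> makes the resulting germ independent of the choice.\<close>
  define c where "c x = (SOME (U, \<tau>). trivialization X L U \<tau> \<and> x \<in> U)" for x
  define W where "W = (\<lambda>x\<in>topspace (mtop X). ?germ x (fst (c x)) (snd (c x)))"
  have triv: "\<exists>U \<tau>. trivialization X L U \<tau> \<and> x \<in> U" if "x \<in> topspace (mtop X)" for x
    using ltrivs_cover[OF L that] ltrivs_trivialization[OF L] by blast
  have W: "W x = ?germ x U \<tau>" if \<tau>: "trivialization X L U \<tau>" "x \<in> U" for x U \<tau>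
  proof -
    have "case c x of (U, \<tau>) \<Rightarrow> trivialization X L U \<tau> \<and> x \<in> U"
      unfolding c_def by (rule someI[of _ "(U, \<tau>)"]) (simp add: \<tau>)
    then show ?thesis
      using germ_eq[of "fst (c x)" "snd (c x)" U \<tau> x] \<tau> trivD(2)[OF \<tau>(1)] by (auto simp: W_def)
  qed
  have res: "restrict W U = tensor_of X E Lk U (?w U \<tau>) (?e U \<tau>)" if "trivialization X L U \<tau>" for U \<tau>
    unfolding tensor_of_def by (rule restrict_ext) (rule W[OF that])
  have sec: "W \<in> tensor_sections X E Lk (topspace (mtop X))"
    unfolding tensor_sections_def
  proof (intro CollectI conjI ballI)
    show "W \<in> extensional (topspace (mtop X))" by (simp add: W_def)
    fix x assume "x \<in> topspace (mtop X)"
    then obtain U \<tau> where \<tau>: "trivialization X L U \<tau>" "x \<in> U" using triv by blast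
    show "\<exists>V c. openin (mtop X) V \<and> x \<in> V \<and> V \<subseteq> topspace (mtop X) \<and>
        c \<in> carrier (tensor_gen E Lk V) \<and> (\<forall>y\<in>V. W y = tensor_germ X E Lk y V c)"
      using trivD(1,2)[OF \<tau>(1)] \<tau> wE[OF \<tau>(1)] eLk[OF \<tau>(1)] W[OF \<tau>(1)]
      by (intro exI[of _ U] exI[of _ "frag_of (?w U \<tau>, ?e U \<tau>)"]) (simp add: carrier_tensor_gen_frag_of)
  qed
  \<comment> \<open>The trivialisations cover the base, so the prescribed restrictions determine
    every value; extensionality settles the points outside.\<close>
  have unique: "W' = W"
    if W': "W' \<in> tensor_sections X E Lk (topspace (mtop X))"
      "\<forall>U \<tau>. trivialization X L U \<tau> \<longrightarrow> restrict W' U = tensor_of X E Lk U (?w U \<tau>) (?e U \<tau>)" for W'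
  proof (rule extensionalityI)
    show "W' \<in> extensional (topspace (mtop X))" using W'(1) by (simp add: tensor_sections_def)
    show "W \<in> extensional (topspace (mtop X))" by (simp add: W_def)
    fix x assume "x \<in> topspace (mtop X)"
    then obtain U \<tau> where \<tau>: "trivialization X L U \<tau>" "x \<in> U" using triv by blast
    have "restrict W' U = restrict W U" using W'(2) res \<tau>(1) by simp
    then show "W' x = W x" using \<tau>(2) by (metis restrict_apply')
  qed
  show ?thesis
    using wE sec res unique by blast
qed

end
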